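(* Let $0<\alpha<1$, $a>0$, and let $\min\{\alpha,1-\alpha\}<\gamma\le 2$. Let $k:[0,a]\times[0,a]\to\mathbb{R}$ have Lipschitz continuous partial derivatives up to order $2$ and satisfy $k(x,x)=1$ for $0\le x\le a$. Let $f:[0,a]\to\mathbb{R}$ and suppose $u\in F^{\gamma}[0,a]$ solves $$\frac{1}{\Gamma(\alpha)}\int_0^x (x-y)^{\alpha-1}k(x,y)u(y)\,dy=f(x),\qquad 0\le x\le a .$$ For an integer $N\ge2$ let $h=a/N$ and $x_n=nh$ (for integer and half-integer $n$), let $\delta>0$, and let $f_1^\delta,\dots,f_N^\delta\in\mathbb{R}$ satisfy $|f_n^\delta-f(x_n)|\le\delta$ for $n=1,\dots,N$. Let $\widetilde u^\delta_{1/2},\widetilde u^\delta_{3/2},\dots,\widetilde u^\delta_{N-1/2}$ be determined by the modified scheme $$h^\alpha\sum_{j=1}^n\omega_{n-j}k(x_n,x_{j-1/2})\widetilde u^\delta_{j-1/2}+h^\alpha\sum_{j=1}^2w_{nj}k(x_n,x_{j-1/2})\widetilde u^\delta_{j-1/2}=f_n^\delta,\qquad n=1,2,\dots,N,$$ with weights $\omega_s$, $w_{nj}$ as defined in the context. Then: (a) If $\alpha\le1/2$, then, as $(h,\delta)\to0$, $$\max_{n=1,\dots,N}|\widetilde u^\delta_{n-1/2}-u(x_{n-1/2})|=\begin{cases}O\big(h^{\gamma-\alpha}+\frac{\delta}{h^\alpha}\big)&\text{if }\alpha<\gamma\le\alpha+1,\\[1mm] O\big(h^{\gamma-1+\alpha}+\frac{\delta}{h^\alpha}\big)&\text{if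 }2-\alpha<\gamma\le2.\end{cases}$$ (b) If $\alpha\ge1/2$ and $1-\alpha<\gamma\le2$, then $$\max_{n=1,\dots,N}|\widetilde u^\delta_{n-1/2}-u(x_{n-1/2})|=O\Big(h^{\gamma-1+\alpha}+\frac{\delta}{h^\alpha}\Big)\quad\text{as }(h,\delta)\to0.$$
   Context: For $c<d$, $m\in\{0,1,\dots\}$ and $0<\beta\le1$, $F^{m+\beta}[c,d]$ is the space of all $\varphi\in C^m[c,d]$ for which there is a constant $L\ge0$ with $|\varphi^{(m)}(x)-\varphi^{(m)}(y)|\le L|x-y|^\beta$ for all $x,y\in[c,d]$. (So $F^1$ means Lipschitz continuous, and $F^2$ means $C^1$ with Lipschitz continuous derivative.) Weights: $\omega_s=\frac{1}{\Gamma(\alpha+1)}\{(s+1)^\alpha-s^\alpha\}$ for $s=0,1,\dots$. The correction weights $w_{n1},w_{n2}$ ($n=1,\dots,N$) are chosen so that $h^\alpha\sum_{j=1}^n\omega_{n-j}\varphi(x_{j-1/2})+h^\alpha\sum_{j=1}^2w_{nj}\varphi(x_{j-1/2})$ equals $\frac1{\Gamma(\alpha)}\int_0^{x_n}(x_n-y)^{\alpha-1}\varphi(y)\,dy$ for $\varphi(y)=1$ and $\varphi(y)=y$; explicitly, $-w_{n1}=w_{n2}=\sum_{j=0}^{n-1}\tau_j$ with $$\tau_n=\frac{1}{\Gamma(\alpha+2)}\{(n+1)^{\alpha+1}-n^{\alpha+1}\}-\frac{1}{2\Gamma(\alpha+1)}\{(n+1)^\alpha+n^\alpha\},\quad n=0,1,\dots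 .$$ "$=O(\cdot)$ as $(h,\delta)\to0$" means: for all sufficiently small $h$ and $\delta$ the bound holds with a constant independent of $h$, $\delta$ and the noisy data $f_n^\delta$. For sufficiently small $h$ the scheme is uniquely solvable: the equations $n=1,2$ form a linear $2\times2$ system for $\widetilde u^\delta_{1/2},\widetilde u^\delta_{3/2}$, and the remaining values are then obtained recursively. *)

theory Defs
  imports "HOL-Analysis.Analysis"
begin

text \<open>
  \<open>C_derivs m c d \<phi> D\<close>: \<open>\<phi>\<close> belongs to \<open>C\<^sup>m[c,d]\<close>, and \<open>D i\<close> is its \<open>i\<close>-th derivative on
  \<open>[c,d]\<close> for \<open>i \<le> m\<close> (one-sided at the endpoints). Values outside \<open>[c,d]\<close> are irrelevant.
\<close>
definition C_derivs :: "nat \<Rightarrow> real \<Rightarrow> real \<Rightarrow> (real \<Rightarrow> real) \<Rightarrow> (nat \<Rightarrow> real \<Rightarrow> real) \<Rightarrow> bool" where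
  "C_derivs m c d \<phi> D \<longleftrightarrow>
     (\<forall>x\<in>{c..d}. D 0 x = \<phi> x) \<and>
     (\<forall>i<m. \<forall>x\<in>{c..d}. (D i has_real_derivative D (Suc i) x) (at x within {c..d})) \<and>
     continuous_on {c..d} (D m)"

text \<open>
  The space \<open>F\<^sup>\<gamma>[c,d]\<close>. A real \<open>\<gamma> > 0\<close> has exactly one decomposition \<open>\<gamma> = m + \<beta>\<close> with
  \<open>m\<close> a natural number and \<open>0 < \<beta> \<le> 1\<close>; so for an integer \<open>\<gamma>\<close> it is the one with \<open>\<beta> = 1\<close>.
\<close>
definition F_space :: "real \<Rightarrow> real \<Rightarrow> real \<Rightarrow> (real \<Rightarrow> real) set" where
  "F_space \<gamma> c d = {\<phi>. \<exists>m \<beta> D. \<gamma> = real m + \<beta> \<and> 0 < \<beta> \<and> \<beta> \<le> 1 \<and> C_derivs m c d \<phi> D \<and>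
     (\<exists>L\<ge>0. \<forall>x\<in>{c..d}. \<forall>y\<in>{c..d}. \<bar>D m x - D m y\<bar> \<le> L * \<bar>x - y\<bar> powr \<beta>)}"

text \<open>
  \<open>lipschitz_partials m I k\<close>: all partial derivatives of \<open>k\<close> of order at most \<open>m\<close> (including
  \<open>k\<close> itself and the mixed ones, in every order of differentiation) exist on \<open>I \<times> I\<close> and are
  Lipschitz continuous there, jointly in both variables.
\<close>
primrec lipschitz_partials :: "nat \<Rightarrow> real set \<Rightarrow> (real \<Rightarrow> real \<Rightarrow> real) \<Rightarrow> bool" where
  "lipschitz_partials 0 I k \<longleftrightarrow> (\<exists>L. L-lipschitz_on (I \<times> I) (\<lambda>(x, y). k x y))"
| "lipschitz_partials (Suc m) I k \<longleftrightarrow>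
     (\<exists>L. L-lipschitz_on (I \<times> I) (\<lambda>(x, y). k x y)) \<and>
     (\<exists>kx ky.
        (\<forall>x\<in>I. \<forall>y\<in>I. ((\<lambda>s. k s y) has_real_derivative kx x y) (at x within I)) \<and>
        (\<forall>x\<in>I. \<forall>y\<in>I. ((\<lambda>t. k x t) has_real_derivative ky x y) (at y within I)) \<and>
        lipschitz_partials m I kx \<and> lipschitz_partials m I ky)"

definition omega_wt :: "real \<Rightarrow> nat \<Rightarrow> real" where
  "omega_wt \<alpha> s = 1 / Gamma (\<alpha> + 1) * ((real s + 1) powr \<alpha> - real s powr \<alpha>)"

definition tau :: "real \<Rightarrow> nat \<Rightarrow> real" where
  "tau \<alpha> n = 1 / Gamma (\<alpha> + 2) * ((real n + 1) powr (\<alpha> + 1) - real n powr (\<alpha> + 1))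
     - 1 / (2 * Gamma (\<alpha> + 1)) * ((real n + 1) powr \<alpha> + real n powr \<alpha>)"

text \<open>
  The correction weights \<open>w\<^bsub>nj\<^esub>\<close>, used only for \<open>j = 1, 2\<close>. They make the corrected quadrature
  rule exact for \<open>\<phi>(y) = 1\<close> and \<open>\<phi>(y) = y\<close>.
\<close>
definition corr_wt :: "real \<Rightarrow> nat \<Rightarrow> nat \<Rightarrow> real" where
  "corr_wt \<alpha> n j = (if j = 1 then - (\<Sum>i<n. tau \<alpha> i) else (\<Sum>i<n. tau \<alpha> i))"

text \<open>Grid points \<open>x\<^bsub>n\<^esub> = n h\<close> and midpoints \<open>x\<^bsub>j-1/2\<^esub> = (j - 1/2) h\<close>.\<close>

definition grid :: "real \<Rightarrow> nat \<Rightarrow> real" where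
  "grid h n = real n * h"

definition midgrid :: "real \<Rightarrow> nat \<Rightarrow> real" where
  "midgrid h j = (real j - 1 / 2) * h"

text \<open>The modified scheme with data \<open>g n\<close>; the entry \<open>v j\<close> stands for the unknown at \<open>x\<^bsub>j-1/2\<^esub>\<close>.\<close>
definition modified_scheme ::
    "real \<Rightarrow> (real \<Rightarrow> real \<Rightarrow> real) \<Rightarrow> real \<Rightarrow> nat \<Rightarrow> (nat \<Rightarrow> real) \<Rightarrow> (nat \<Rightarrow> real) \<Rightarrow> bool" where
  "modified_scheme \<alpha> k h N g v \<longleftrightarrow>
     (\<forall>n\<in>{1..N}.
        h powr \<alpha> * (\<Sum>j=1..n. omega_wt \<alpha> (n - j) * k (grid h n) (midgrid h j) * v j)
      + h powr \<alpha> * (\<Sum>j=1..2. corr_wt \<alpha> n j * k (grid h n) (midgrid h j) * v j)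
      = g n)"

text \<open>
  \<open>scheme_error_bigo \<alpha> a k f u R\<close>: the maximal error of the modified scheme at the midpoints is
  \<open>O(R h \<delta>)\<close> as \<open>(h, \<delta>) \<rightarrow> 0\<close>, where \<open>h = a / N\<close>. The constants are chosen before \<open>N\<close>, \<open>\<delta>\<close>
  and the noisy data \<open>g\<close>.
\<close>
definition scheme_error_bigo ::
    "real \<Rightarrow> real \<Rightarrow> (real \<Rightarrow> real \<Rightarrow> real) \<Rightarrow> (real \<Rightarrow> real) \<Rightarrow> (real \<Rightarrow> real)
      \<Rightarrow> (real \<Rightarrow> real \<Rightarrow> real) \<Rightarrow> bool" where
  "scheme_error_bigo \<alpha> a k f u R \<longleftrightarrow>
     (\<exists>C h0 \<delta>0. 0 < h0 \<and> 0 < \<delta>0 \<and>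
        (\<forall>(N::nat) h \<delta> g v.
           2 \<le> N \<and> h = a / real N \<and> h \<le> h0 \<and> 0 < \<delta> \<and> \<delta> \<le> \<delta>0 \<and>
           (\<forall>n\<in>{1..N}. \<bar>g n - f (grid h n)\<bar> \<le> \<delta>) \<and>
           modified_scheme \<alpha> k h N g v
           \<longrightarrow> Max ((\<lambda>n. \<bar>v n - u (midgrid h n)\<bar>) ` {1..N}) \<le> C * R h \<delta>))"

end

theory Submission
  imports Defs "HOL-Computational_Algebra.Formal_Power_Series"
begin

unbundle no vec_syntax
unbundle fps_syntax

text \<open>
  Up to the factor \<open>Gamma (\<alpha> + 1)\<close> the weights are \<open>(n+1)\<^sup>\<alpha> - n\<^sup>\<alpha>\<close>, a positive, decreasing and log-convex
  sequence. By Kaluza's theorem its convolution inverse \<open>c\<close> has \<open>c\<^sub>0 = 1\<close>, \<open>c\<^sub>n \<le> 0\<close> for \<open>n \<ge> 1\<close>, and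
  nonnegative partial sums \<open>b\<^sub>n\<close>; since \<open>b\<close> convolved with the weights is constantly \<open>1\<close>, sums of \<open>b\<close> are
  bounded by the reciprocals of the weights. Applying \<open>c\<close> to the error equation leaves the identity
  plus a kernel of size \<open>O(h)\<close>, so Gronwall's inequality bounds the error by a multiple of \<open>h\<^sup>-\<^sup>\<alpha>\<close>
  times the residual or, after summation by parts, of \<open>h\<^sup>-\<^sup>1\<close> times the increments of the residual. The two starting
  values come from a \<open>2 \<times> 2\<close> system whose determinant stays away from \<open>0\<close>.

  For the residual, write \<open>\<phi>(y) = \<phi>(m) + \<phi>'(m) (y - m) + O(h\<^sup>\<gamma>)\<close> around each midpoint \<open>m\<close> (with \<open>\<phi>'\<close> replaced
  by \<open>0\<close> if \<open>\<gamma> \<le> 1\<close>). The linear terms contribute \<open>h\<^bsup>\<alpha>+1\<^esup>\<close> times a convolution of \<open>\<tau>\<close>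
  with \<open>\<phi>'(m) - \<phi>'(x\<^bsub>1/2\<^esub>)\<close>, where the subtracted value is the effect of the correction
  weights; it vanishes at the first midpoint, so its increments in \<open>n\<close> are \<open>O(h\<^bsup>\<gamma>-1\<^esup>)\<close>. This gives a residual
  \<open>O(h\<^bsup>min \<gamma> (\<alpha>+1)\<^esup>)\<close> with increments \<open>O(h\<^bsup>\<gamma>+\<alpha>\<^esup>)\<close>, and the two rates follow.
\<close>

section \<open>Fractional quadrature weights and their convolution inverse\<close>

text \<open>These are the weights \<open>omega_wt\<close> multiplied by
  \<open>Gamma (\<alpha> + 1)\<close>, so that the first one is \<open>1\<close>. Moreover
  \<open>h powr \<alpha> * powr_step \<alpha> m\<close> is \<open>\<alpha>\<close> times the
  integral of \<open>(x - y) powr (\<alpha> - 1)\<close> over a cell of length \<open>h\<close>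
  whose right end is \<open>x - m * h\<close>.\<close>

definition powr_step :: "real \<Rightarrow> nat \<Rightarrow> real" where
  "powr_step \<alpha> n = (real n + 1) powr \<alpha> - real n powr \<alpha>"

lemma powr_step_0 [simp]: "powr_step \<alpha> 0 = 1"
  by (simp add: powr_step_def)

lemma powr_step_pos: "0 < \<alpha> \<Longrightarrow> 0 < powr_step \<alpha> n"
  by (simp add: powr_step_def powr_less_mono2)

lemma sum_powr_step: "(\<Sum>i<n. powr_step \<alpha> i) = real n powr \<alpha>"
  by (induction n) (auto simp: powr_step_def add.commute)

text \<open>A positive exponent keeps the power continuous at base \<open>0\<close>, which is where
  the mean value arguments and the antiderivatives of the kernel meet the singularity.\<close>

lemma continuous_on_powr_pos:
  fixes \<alpha> :: real
  assumes "0 < \<alpha>" "continuous_on S f" "\<And>x. x \<in> S \<Longrightarrow> 0 \<le> f x"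
  shows "continuous_on S (\<lambda>x. f x powr \<alpha>)"
  using assms by (intro continuous_on_powr') auto

text \<open>The mean value theorem writes the step as
  \<open>\<alpha> * z powr (\<alpha> - 1)\<close> with \<open>z < n + 1\<close>, an expression that
  decreases in \<open>z\<close>. Reciprocals of weights are thereby bounded by powers of
  \<open>n + 1\<close>.\<close>

lemma powr_step_lower:
  assumes "0 < \<alpha>" "\<alpha> < 1"
  shows "\<alpha> * (real n + 1) powr (\<alpha> - 1) \<le> powr_step \<alpha> n"
proof -
  \<comment> \<open>For \<open>n = 0\<close> the power has no derivative at the left endpoint, hence
    the version of the mean value theorem that asks for differentiability only in the
    interior.\<close>
  have "\<exists>l z. real n < z \<and> z < real n + 1 \<and> ((\<lambda>s. s powr \<alpha>) has_real_derivative l) (at z) \<and>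
      (real n + 1) powr \<alpha> - real n powr \<alpha> = (real n + 1 - real n) * l"
  proof (intro MVT)
    show "continuous_on {real n..real n + 1} (\<lambda>s. s powr \<alpha>)"
      using assms by (intro continuous_on_powr_pos) auto
    fix s assume "real n < s"
    then have "0 < s" by linarith
    then show "(\<lambda>s. s powr \<alpha>) differentiable (at s)"
      using has_real_derivative_powr real_differentiable_def by blast
  qed simp
  then obtain l z where z: "z > real n" "z < real n + 1" "powr_step \<alpha> n = l"
      and l: "((\<lambda>s. s powr \<alpha>) has_real_derivative l) (at z)"
    by (auto simp: powr_step_def)
  have "l = \<alpha> * z powr (\<alpha> - 1)"
    using l has_real_derivative_powr[of z \<alpha>] z by (intro DERIV_unique[OF l]) auto
  have "(real n + 1) powr (\<alpha> - 1) \<le> z powr (\<alpha> - 1)"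
    using z assms by (intro powr_mono2') auto
  then show ?thesis using z assms \<open>l = _\<close> by simp
qed

text \<open>The quadratic form \<open>\<lambda>\<^sup>2 \<omega>\<^sub>n - 2 \<lambda> \<omega>\<^bsub>n+1\<^esub> + \<omega>\<^bsub>n+2\<^esub>\<close> is an increment of the function \<open>H\<close> below,
  which is nondecreasing because \<open>s \<mapsto> s powr (\<alpha> - 1)\<close> is log-convex; \<open>\<lambda>\<close> is taken to be its minimiser.\<close>

lemma powr_step_log_convex:
  assumes "0 < \<alpha>" "\<alpha> < 1"
  shows "powr_step \<alpha> (Suc n) ^ 2 \<le> powr_step \<alpha> n * powr_step \<alpha> (Suc (Suc n))"
proof -
  define l where "l = powr_step \<alpha> (Suc n) / powr_step \<alpha> n"
  define H where "H s = l\<^sup>2 * (s - 1) powr \<alpha> - 2 * l * s powr \<alpha> + (s + 1) powr \<alpha>" for s :: real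
  have "H (Suc n) \<le> H (Suc (Suc n))"
  proof (rule DERIV_nonneg_imp_increasing_open[of "real (Suc n)" "real (Suc (Suc n))" H])
    show "continuous_on {real (Suc n)..real (Suc (Suc n))} H"
      unfolding H_def using assms
      by (intro continuous_on_powr_pos continuous_on_add continuous_on_diff continuous_on_mult
          continuous_on_const continuous_on_id) auto
  next
    fix s assume s: "real (Suc n) < s"
    have s1: "s > 1" using s by simp
    let ?d = "l\<^sup>2 * (\<alpha> * (s - 1) powr (\<alpha> - 1)) - 2 * l * (\<alpha> * s powr (\<alpha> - 1)) + \<alpha> * (s + 1) powr (\<alpha> - 1)"
    have "(H has_real_derivative ?d) (at s)"
      unfolding H_def using s1 by (auto intro!: derivative_eq_intros)
    moreover have "0 \<le> ?d"
    proof -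
      \<comment> \<open>With these square roots the derivative is at least
        \<open>\<alpha> * (l * p - q)\<^sup>2\<close>: as
        \<open>(s - 1) * (s + 1) \<le> s\<^sup>2\<close> and the exponent is negative,
        \<open>s powr (\<alpha> - 1) \<le> p * q\<close>.\<close>
      define p where "p = (s - 1) powr ((\<alpha> - 1) / 2)"
      define q where "q = (s + 1) powr ((\<alpha> - 1) / 2)"
      have pp: "(s - 1) powr (\<alpha> - 1) = p\<^sup>2" "(s + 1) powr (\<alpha> - 1) = q\<^sup>2"
        by (simp_all add: p_def q_def power2_eq_square flip: powr_add)
      have "s powr (\<alpha> - 1) = (s powr 2) powr ((\<alpha> - 1) / 2)"
        by (simp only: powr_powr times_divide_eq_right nonzero_mult_div_cancel_left[OF zero_neq_numeral[symmetric]])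
      also have "\<dots> = (s\<^sup>2) powr ((\<alpha> - 1) / 2)"
        using s1 by simp
      also have "\<dots> \<le> ((s - 1) * (s + 1)) powr ((\<alpha> - 1) / 2)"
        using s1 assms by (intro powr_mono2') (auto simp: algebra_simps power2_eq_square less_1_mult)
      also have "\<dots> = p * q"
        using s1 by (simp add: p_def q_def powr_mult)
      finally have sp: "s powr (\<alpha> - 1) \<le> p * q" .
      have "l \<ge> 0" unfolding l_def using powr_step_pos assms by (simp add: less_imp_le)
      have "0 \<le> (l * p - q)\<^sup>2" by simp
      also have "\<dots> = l\<^sup>2 * p\<^sup>2 - 2 * l * (p * q) + q\<^sup>2"
        by (simp add: power2_eq_square algebra_simps)
      also have "\<dots> \<le> l\<^sup>2 * p\<^sup>2 - 2 * l * s powr (\<alpha> - 1) + q\<^sup>2"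
        using sp \<open>l \<ge> 0\<close> by (simp add: mult_left_mono)
      finally have "0 \<le> \<alpha> * (l\<^sup>2 * p\<^sup>2 - 2 * l * s powr (\<alpha> - 1) + q\<^sup>2)"
        using assms by simp
      then show ?thesis unfolding pp by (simp add: algebra_simps)
    qed
    ultimately show "\<exists>y. (H has_real_derivative y) (at s) \<and> 0 \<le> y" by blast
  qed simp
  then have "0 \<le> l\<^sup>2 * powr_step \<alpha> n - 2 * l * powr_step \<alpha> (Suc n) + powr_step \<alpha> (Suc (Suc n))"
    by (simp add: H_def powr_step_def algebra_simps)
  also have "\<dots> = powr_step \<alpha> (Suc (Suc n)) - powr_step \<alpha> (Suc n) ^ 2 / powr_step \<alpha> n"
    using powr_step_pos[OF assms(1), of n] by (simp add: l_def field_simps power2_eq_square)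
  finally show ?thesis
    using powr_step_pos[OF assms(1), of n] by (simp add: field_simps)
qed

text \<open>The left difference is a second difference of the power function, of order
  \<open>i powr (\<alpha> - 2)\<close>, while the weight is at least of order
  \<open>i powr (\<alpha> - 1)\<close>; the factor \<open>i + 2\<close> makes up for the missing
  power. The bound later absorbs the linear growth of a Lipschitz factor.\<close>

lemma powr_step_diff_bound:
  assumes "0 < \<alpha>" "\<alpha> < 1"
  shows "(real i + 2) * (powr_step \<alpha> i - powr_step \<alpha> (Suc i)) \<le> (9 + 4 / \<alpha>) * powr_step \<alpha> (Suc i)"
proof (cases "i = 0")
  \<comment> \<open>The second derivative of the power is unbounded near \<open>0\<close>, so
    \<open>i = 0\<close> is done by hand: the left side is at most \<open>2\<close>, and
    \<open>powr_step \<alpha> 1\<close> is at least \<open>\<alpha> / 2\<close>.\<close>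
  case True
  have "(1/2) powr 1 \<le> (1/2::real) powr (1 - \<alpha>)"
    using assms by (intro powr_mono') auto
  also have "\<dots> = 2 powr (\<alpha> - 1)"
    by (simp add: powr_divide powr_diff)
  finally have "\<alpha> * (1/2) \<le> \<alpha> * 2 powr (\<alpha> - 1)" using assms by simp
  also have "\<dots> \<le> powr_step \<alpha> 1" using powr_step_lower[OF assms, of 1] by simp
  finally have "2 \<le> 4 / \<alpha> * powr_step \<alpha> 1" using assms by (simp add: field_simps)
  moreover have "0 < powr_step \<alpha> 1" using powr_step_pos assms by blast
  ultimately show ?thesis using True by (simp add: algebra_simps)
next
  case False
  define p where "p s = (s + 1) powr \<alpha> - s powr \<alpha>" for s :: real
  have "\<exists>z::real. z > real i \<and> z < real i + 1 \<and>
      p (real i + 1) - p (real i) = (real i + 1 - real i) * (\<alpha> * (z + 1) powr (\<alpha> - 1) - \<alpha> * z powr (\<alpha> - 1))"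
    unfolding p_def using assms False
    by (intro MVT2) (auto intro!: derivative_eq_intros)
  then obtain z where z: "z > real i" "z < i + 1"
      "p (real i + 1) - p (real i) = \<alpha> * ((z + 1) powr (\<alpha> - 1) - z powr (\<alpha> - 1))"
    by (auto simp: algebra_simps)
  have "\<exists>y::real. y > z \<and> y < z + 1 \<and>
      (z + 1) powr (\<alpha> - 1) - z powr (\<alpha> - 1) = (z + 1 - z) * ((\<alpha> - 1) * y powr (\<alpha> - 2))"
    using z by (intro MVT2) (auto intro!: derivative_eq_intros simp: diff_diff_eq)
  then obtain y where y: "y > z" "(z + 1) powr (\<alpha> - 1) - z powr (\<alpha> - 1) = (\<alpha> - 1) * y powr (\<alpha> - 2)"
    by auto
  have "powr_step \<alpha> i - powr_step \<alpha> (Suc i) = p (real i) - p (real i + 1)"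
    by (simp add: powr_step_def p_def add.commute)
  also have "\<dots> = \<alpha> * (1 - \<alpha>) * y powr (\<alpha> - 2)"
    using z(3) unfolding y(2) by (simp add: algebra_simps)
  also have "\<dots> \<le> \<alpha> * 1 * (9 * (real i + 2) powr (\<alpha> - 2))"
  proof (intro mult_mono)
    \<comment> \<open>For \<open>i \<ge> 1\<close> one has \<open>y > i \<ge> (i + 2) / 3\<close>;
      the negative exponent turns the third into a factor \<open>3 powr (2 - \<alpha>)\<close>,
      which is at most \<open>9\<close>.\<close>
    have "y powr (\<alpha> - 2) \<le> ((real i + 2) / 3) powr (\<alpha> - 2)"
      using y z False assms by (intro powr_mono2') auto
    also have "\<dots> = (real i + 2) powr (\<alpha> - 2) * 3 powr (2 - \<alpha>)"
      by (simp add: powr_divide powr_diff)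
    also have "\<dots> \<le> (real i + 2) powr (\<alpha> - 2) * 3 powr 2"
      using assms by (intro mult_left_mono powr_mono) auto
    finally show "y powr (\<alpha> - 2) \<le> 9 * (real i + 2) powr (\<alpha> - 2)" by simp
  qed (use assms in auto)
  finally have "(real i + 2) * (powr_step \<alpha> i - powr_step \<alpha> (Suc i)) \<le> (real i + 2) * (\<alpha> * 1 * (9 * (real i + 2) powr (\<alpha> - 2)))"
    by (intro mult_left_mono) auto
  also have "\<dots> = 9 * (\<alpha> * ((real i + 2) * (real i + 2) powr (\<alpha> - 2)))" by simp
  also have "(real i + 2) * (real i + 2) powr (\<alpha> - 2) = (real i + 2) powr (\<alpha> - 1)"
    using powr_mult_base[of "real i + 2" "\<alpha> - 2"] by simp
  also have "9 * (\<alpha> * (real i + 2) powr (\<alpha> - 1)) \<le> 9 * powr_step \<alpha> (Suc i)"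
    using powr_step_lower[OF assms, of "Suc i"] by (simp add: add.commute add.left_commute)
  also have "\<dots> \<le> (9 + 4 / \<alpha>) * powr_step \<alpha> (Suc i)"
    using powr_step_pos[OF assms(1), of "Suc i"] assms by (intro mult_right_mono) auto
  finally show ?thesis .
qed

text \<open>This is concavity of the power function: unit increments have a nonpositive
  derivative.\<close>

lemma powr_step_antimono:
  assumes "0 < \<alpha>" "\<alpha> < 1" "i \<le> j"
  shows "powr_step \<alpha> j \<le> powr_step \<alpha> i"
proof -
  have "powr_step \<alpha> (Suc n) \<le> powr_step \<alpha> n" for n
  proof -
    define p where "p s = (s + 1) powr \<alpha> - s powr \<alpha>" for s :: real
    have "p (real n + 1) \<le> p n"
    proof (rule DERIV_nonpos_imp_decreasing_open[of "real n" "real n + 1" p])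
      show "continuous_on {real n..real n + 1} p"
        unfolding p_def using assms
      by (intro continuous_on_powr_pos continuous_on_add continuous_on_diff continuous_on_mult
          continuous_on_const continuous_on_id) auto
    next
      fix s assume s: "real n < s"
      have "(p has_real_derivative \<alpha> * (s + 1) powr (\<alpha> - 1) - \<alpha> * s powr (\<alpha> - 1)) (at s)"
        unfolding p_def using s by (auto intro!: derivative_eq_intros)
      moreover have "(s + 1) powr (\<alpha> - 1) \<le> s powr (\<alpha> - 1)"
        using s assms by (intro powr_mono2') auto
      ultimately show "\<exists>y. (p has_real_derivative y) (at s) \<and> y \<le> 0"
        using assms by (intro exI[of _ "\<alpha> * (s + 1) powr (\<alpha> - 1) - \<alpha> * s powr (\<alpha> - 1)"]) auto
    qed simp
    then show ?thesis by (simp add: powr_step_def p_def add.commute add.left_commute)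
  qed
  then show ?thesis using lift_Suc_antimono_le[of "powr_step \<alpha>"] assms(3) by blast
qed

section \<open>The convolution inverse of the weights and its partial sums\<close>

text \<open>Formal power series serve only as a calculus of sequences under convolution; no
  convergence is involved. The inverse exists because the constant coefficient is
  \<open>1\<close>.\<close>

definition powr_step_inv :: "real \<Rightarrow> real fps" where
  "powr_step_inv \<alpha> = inverse (Abs_fps (powr_step \<alpha>))"

lemma powr_step_inv_mult: "powr_step_inv \<alpha> * Abs_fps (powr_step \<alpha>) = 1"
  unfolding powr_step_inv_def by (rule inverse_mult_eq_1) simp

lemma powr_step_inv_0 [simp]: "powr_step_inv \<alpha> $ 0 = 1"
  by (simp add: powr_step_inv_def)

lemma powr_step_inv_conv: "(\<Sum>k\<le>n. powr_step_inv \<alpha> $ k * powr_step \<alpha> (n - k)) = (if n = 0 then 1 else 0)"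
  using arg_cong[OF powr_step_inv_mult, of "\<lambda>F. F $ n"] by (simp add: fps_mult_nth atLeast0AtMost)

text \<open>Log-convexity means that consecutive ratios increase; chaining this and clearing
  denominators gives the form that Kaluza's argument needs.\<close>

lemma powr_step_ratio_mono:
  assumes "0 < \<alpha>" "\<alpha> < 1" "i \<le> j"
  shows "powr_step \<alpha> (Suc i) * powr_step \<alpha> j \<le> powr_step \<alpha> (Suc j) * powr_step \<alpha> i"
proof -
  have "powr_step \<alpha> (Suc n) / powr_step \<alpha> n \<le> powr_step \<alpha> (Suc (Suc n)) / powr_step \<alpha> (Suc n)" for n
    using powr_step_log_convex[OF assms(1,2), of n] powr_step_pos[OF assms(1), of n] powr_step_pos[OF assms(1), of "Suc n"]
    by (simp add: field_simps power2_eq_square)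
  then have "powr_step \<alpha> (Suc i) / powr_step \<alpha> i \<le> powr_step \<alpha> (Suc j) / powr_step \<alpha> j"
    using lift_Suc_mono_le[of "\<lambda>n. powr_step \<alpha> (Suc n) / powr_step \<alpha> n"] assms(3) by blast
  then show ?thesis using powr_step_pos[OF assms(1), of i] powr_step_pos[OF assms(1), of j]
    by (simp add: field_simps)
qed

text \<open>Kaluza's theorem: subtract a multiple of the convolution identity at \<open>n - 1\<close> from
  the one at \<open>n\<close>, chosen so that the contribution of the zeroth coefficient cancels.\<close>

lemma powr_step_inv_nonpos:
  assumes "0 < \<alpha>" "\<alpha> < 1"
  shows "0 < n \<Longrightarrow> powr_step_inv \<alpha> $ n \<le> 0"
proof (induction n rule: less_induct)
  case (less n)
  then obtain m where m: "n = Suc m" by (cases n) auto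
  show ?case
  proof (cases "m = 0")
    case True
    have "powr_step_inv \<alpha> $ 1 = - powr_step \<alpha> 1" using powr_step_inv_conv[of \<alpha> 1] by simp
    then show ?thesis using m True powr_step_pos[OF assms(1), of 1] by simp
  next
    case False
    have split: "(\<Sum>k\<le>m. g k) = g 0 + (\<Sum>k=1..m. g k)" for g :: "nat \<Rightarrow> real"
      by (metis atLeast0AtMost le0 sum.atLeast_Suc_atMost One_nat_def)
    define r where "r = powr_step \<alpha> (Suc m) / powr_step \<alpha> m"
    have r: "r * powr_step \<alpha> m = powr_step \<alpha> (Suc m)" using powr_step_pos[OF assms(1), of m] by (simp add: r_def)
    have "0 = (\<Sum>k\<le>m. powr_step_inv \<alpha> $ k * powr_step \<alpha> (Suc m - k)) + powr_step_inv \<alpha> $ Suc m"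
      using powr_step_inv_conv[of \<alpha> "Suc m"] by simp
    also have "(\<Sum>k\<le>m. powr_step_inv \<alpha> $ k * powr_step \<alpha> (Suc m - k)) =
        powr_step \<alpha> (Suc m) + (\<Sum>k=1..m. powr_step_inv \<alpha> $ k * powr_step \<alpha> (Suc m - k))"
      unfolding split by simp
    finally have 1: "powr_step_inv \<alpha> $ Suc m = - powr_step \<alpha> (Suc m) - (\<Sum>k=1..m. powr_step_inv \<alpha> $ k * powr_step \<alpha> (Suc m - k))"
      by simp
    have "0 = r * (\<Sum>k\<le>m. powr_step_inv \<alpha> $ k * powr_step \<alpha> (m - k))"
      using powr_step_inv_conv[of \<alpha> m] False by simp
    also have "\<dots> = powr_step \<alpha> (Suc m) + (\<Sum>k=1..m. powr_step_inv \<alpha> $ k * (r * powr_step \<alpha> (m - k)))"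
      unfolding split by (simp add: r ring_distribs sum_distrib_left mult_ac)
    finally have "powr_step_inv \<alpha> $ Suc m =
        (\<Sum>k=1..m. powr_step_inv \<alpha> $ k * (r * powr_step \<alpha> (m - k) - powr_step \<alpha> (Suc m - k)))"
      unfolding 1 by (simp add: ring_distribs sum_subtractf)
    also have "\<dots> \<le> 0"
    proof (intro sum_nonpos mult_nonpos_nonneg)
      fix k assume k: "k \<in> {1..m}"
      show "powr_step_inv \<alpha> $ k \<le> 0" using k m less.IH by simp
      \<comment> \<open>The ratio \<open>r\<close> at index \<open>m\<close> is at least the ratio
        at \<open>m - k\<close>, so the bracket is nonnegative.\<close>
      have "powr_step \<alpha> (Suc (m - k)) * powr_step \<alpha> m \<le> powr_step \<alpha> (Suc m) * powr_step \<alpha> (m - k)"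
        using powr_step_ratio_mono[OF assms, of "m - k" m] by simp
      then show "0 \<le> r * powr_step \<alpha> (m - k) - powr_step \<alpha> (Suc m - k)"
        using powr_step_pos[OF assms(1), of m] k by (simp add: r_def field_simps Suc_diff_le)
    qed
    finally show ?thesis using m by simp
  qed
qed

text \<open>These are the coefficients of \<open>powr_step_inv \<alpha>\<close> divided by
  \<open>1 - X\<close>. They appear when summation by parts moves a difference onto the other factor
  of a convolution.\<close>

definition powr_step_inv_sum :: "real \<Rightarrow> nat \<Rightarrow> real" where
  "powr_step_inv_sum \<alpha> n = (\<Sum>k\<le>n. powr_step_inv \<alpha> $ k)"

text \<open>For \<open>k \<ge> 1\<close> the inverse coefficients are nonpositive and the weights
  decrease, so replacing the weight at \<open>n - k\<close> by the one at \<open>n\<close> can only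
  increase the convolution, whose value is \<open>0\<close> or \<open>1\<close>. The result is the
  partial sum times a positive weight.\<close>

lemma powr_step_inv_sum_nonneg:
  assumes "0 < \<alpha>" "\<alpha> < 1"
  shows "0 \<le> powr_step_inv_sum \<alpha> n"
proof -
  have "0 \<le> (\<Sum>k\<le>n. powr_step_inv \<alpha> $ k * powr_step \<alpha> (n - k))"
    by (simp add: powr_step_inv_conv)
  also have "\<dots> \<le> (\<Sum>k\<le>n. powr_step_inv \<alpha> $ k * powr_step \<alpha> n)"
  proof (intro sum_mono)
    fix k assume "k \<in> {..n}"
    show "powr_step_inv \<alpha> $ k * powr_step \<alpha> (n - k) \<le> powr_step_inv \<alpha> $ k * powr_step \<alpha> n"
    proof (cases "k = 0")
      case False
      then show ?thesis
        using powr_step_inv_nonpos[OF assms, of k] powr_step_antimono[OF assms, of "n - k" n]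
        by (intro mult_left_mono_neg) auto
    qed simp
  qed
  also have "\<dots> = powr_step_inv_sum \<alpha> n * powr_step \<alpha> n" by (simp add: powr_step_inv_sum_def sum_distrib_right)
  finally show ?thesis using powr_step_pos[OF assms(1), of n] by (simp add: zero_le_mult_iff)
qed

text \<open>Only the zeroth coefficient, which is \<open>1\<close>, is positive. The absolute sum is
  therefore \<open>2\<close> minus a partial sum, and partial sums are nonnegative.\<close>

lemma powr_step_inv_abs_sum_le:
  assumes "0 < \<alpha>" "\<alpha> < 1"
  shows "(\<Sum>k\<le>n. \<bar>powr_step_inv \<alpha> $ k\<bar>) \<le> 2"
proof -
  have "(\<Sum>k\<le>n. \<bar>powr_step_inv \<alpha> $ k\<bar>) = (\<Sum>k\<le>n. (if k = 0 then 2 else 0) - powr_step_inv \<alpha> $ k)"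
    using powr_step_inv_nonpos[OF assms] by (intro sum.cong) auto
  also have "\<dots> = 2 - powr_step_inv_sum \<alpha> n"
    by (simp add: powr_step_inv_sum_def sum_subtractf)
  finally show ?thesis using powr_step_inv_sum_nonneg[OF assms, of n] by simp
qed

lemma powr_step_inv_sum_fps: "Abs_fps (powr_step_inv_sum \<alpha>) = powr_step_inv \<alpha> * Abs_fps (\<lambda>_. 1)"
  by (rule fps_ext) (simp add: fps_mult_nth powr_step_inv_sum_def atLeast0AtMost)

lemma geometric_fps: "Abs_fps (\<lambda>_. 1 :: real) * (1 - fps_X) = 1"
  by (rule fps_ext) (simp add: right_diff_distrib mult.commute[of _ fps_X])

lemma powr_step_inv_sum_conv_fps: "Abs_fps (powr_step_inv_sum \<alpha>) * Abs_fps (powr_step \<alpha>) = Abs_fps (\<lambda>_. 1)"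
proof -
  have "Abs_fps (powr_step_inv_sum \<alpha>) * Abs_fps (powr_step \<alpha>) = Abs_fps (\<lambda>_. 1) * (powr_step_inv \<alpha> * Abs_fps (powr_step \<alpha>))"
    unfolding powr_step_inv_sum_fps by (simp only: mult_ac)
  then show ?thesis by (simp add: powr_step_inv_mult)
qed

lemma powr_step_inv_sum_conv: "(\<Sum>k\<le>n. powr_step_inv_sum \<alpha> k * powr_step \<alpha> (n - k)) = 1"
  using arg_cong[OF powr_step_inv_sum_conv_fps, of "\<lambda>F. F $ n"] by (simp add: fps_mult_nth atLeast0AtMost)

text \<open>In the identity that convolves the partial sums with the weights to \<open>1\<close>,
  every weight is at least the last one. So the sum is at most the reciprocal of
  \<open>powr_step \<alpha> n\<close>, for which \<open>powr_step_lower\<close> gives the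
  power.\<close>

lemma powr_step_inv_sum_sum_le:
  assumes "0 < \<alpha>" "\<alpha> < 1"
  shows "(\<Sum>k\<le>n. powr_step_inv_sum \<alpha> k) \<le> (real n + 1) powr (1 - \<alpha>) / \<alpha>"
proof -
  have "(\<Sum>k\<le>n. powr_step_inv_sum \<alpha> k) * powr_step \<alpha> n \<le> (\<Sum>k\<le>n. powr_step_inv_sum \<alpha> k * powr_step \<alpha> (n - k))"
    unfolding sum_distrib_right using powr_step_inv_sum_nonneg[OF assms] powr_step_antimono[OF assms]
    by (intro sum_mono mult_left_mono) auto
  then have "(\<Sum>k\<le>n. powr_step_inv_sum \<alpha> k) * powr_step \<alpha> n \<le> 1" by (simp add: powr_step_inv_sum_conv)
  moreover have "(\<Sum>k\<le>n. powr_step_inv_sum \<alpha> k) * (\<alpha> * (real n + 1) powr (\<alpha> - 1)) \<le> (\<Sum>k\<le>n. powr_step_inv_sum \<alpha> k) * powr_step \<alpha> n"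
    using powr_step_lower[OF assms] powr_step_inv_sum_nonneg[OF assms] by (intro mult_left_mono sum_nonneg) auto
  ultimately have "(\<Sum>k\<le>n. powr_step_inv_sum \<alpha> k) * (\<alpha> * (real n + 1) powr (\<alpha> - 1)) \<le> 1" by linarith
  then have "(\<Sum>k\<le>n. powr_step_inv_sum \<alpha> k) * (\<alpha> * (real n + 1) powr (\<alpha> - 1)) * (real n + 1) powr (1 - \<alpha>)
      \<le> 1 * (real n + 1) powr (1 - \<alpha>)"
    by (rule mult_right_mono) simp
  moreover have "(real n + 1) powr (\<alpha> - 1) * (real n + 1) powr (1 - \<alpha>) = 1"
    by (simp flip: powr_add)
  ultimately show ?thesis using assms by (simp add: mult.assoc pos_le_divide_eq)
qed

lemma fps_mult_nth_atMost: 
  fixes F G :: "real fps"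
  shows "(F * G) $ n = (\<Sum>k\<le>n. F $ k * G $ (n - k))"
  by (simp add: fps_mult_nth atLeast0AtMost)

text \<open>Convolution is bounded in the supremum norm by the absolute sum of the kernel. This
  estimate is for data with bounded size but arbitrary oscillation, such as noise.\<close>

lemma powr_step_inv_conv_bound:
  assumes "0 < \<alpha>" "\<alpha> < 1" and "\<And>l. l \<le> n \<Longrightarrow> \<bar>q $ l\<bar> \<le> B"
  shows "\<bar>(powr_step_inv \<alpha> * q) $ n\<bar> \<le> 2 * B"
proof -
  have "0 \<le> B" using assms(3)[of 0] by simp
  have "\<bar>(powr_step_inv \<alpha> * q) $ n\<bar> \<le> (\<Sum>k\<le>n. \<bar>powr_step_inv \<alpha> $ k * q $ (n - k)\<bar>)"
    unfolding fps_mult_nth_atMost by (rule sum_abs)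
  also have "\<dots> \<le> (\<Sum>k\<le>n. \<bar>powr_step_inv \<alpha> $ k\<bar> * B)"
    unfolding abs_mult using assms(3) by (intro sum_mono mult_left_mono) auto
  also have "\<dots> \<le> 2 * B"
    using powr_step_inv_abs_sum_le[OF assms(1,2), of n] \<open>0 \<le> B\<close>
    by (simp flip: sum_distrib_right add: mult_right_mono)
  finally show ?thesis .
qed

text \<open>Summation by parts, done by inserting \<open>1 - X\<close> and its inverse between the
  factors. The case \<open>k = n\<close> encodes the convention that the sequence is
  \<open>0\<close> at index \<open>-1\<close>.\<close>

lemma powr_step_inv_conv_diff:
  "(powr_step_inv \<alpha> * q) $ n = (\<Sum>k\<le>n. powr_step_inv_sum \<alpha> k * (q $ (n - k) - (if k = n then 0 else q $ (n - k - 1))))"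
proof -
  have "powr_step_inv \<alpha> * q = Abs_fps (powr_step_inv_sum \<alpha>) * ((1 - fps_X) * q)"
    unfolding powr_step_inv_sum_fps using geometric_fps
    by (metis (no_types, lifting) mult.assoc mult_1_right)
  also have "\<dots> $ n = (\<Sum>k\<le>n. powr_step_inv_sum \<alpha> k * ((1 - fps_X) * q) $ (n - k))"
    unfolding fps_mult_nth_atMost[of "Abs_fps (powr_step_inv_sum \<alpha>)"] by simp
  also have "\<dots> = (\<Sum>k\<le>n. powr_step_inv_sum \<alpha> k * (q $ (n - k) - (if k = n then 0 else q $ (n - k - 1))))"
    by (intro sum.cong) (auto simp: left_diff_distrib)
  finally show ?thesis .
qed

section \<open>The weights of the correction term\<close>

text \<open>When \<open>q = x\<close> the integrand is singular at the right end, but the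
  antiderivative is still continuous there, so the fundamental theorem with derivatives in the open
  interval applies.\<close>

lemma kernel_has_integral:
  fixes \<alpha> x p q :: real
  assumes "0 < \<alpha>" "p \<le> q" "q \<le> x"
  shows "((\<lambda>y. (x - y) powr (\<alpha> - 1)) has_integral ((x - p) powr \<alpha> - (x - q) powr \<alpha>) / \<alpha>) {p..q}"
proof -
  have "((\<lambda>y. (x - y) powr (\<alpha> - 1)) has_integral - ((x - q) powr \<alpha>) / \<alpha> - - ((x - p) powr \<alpha>) / \<alpha>) {p..q}"
  proof (rule fundamental_theorem_of_calculus_interior)
    show "continuous_on {p..q} (\<lambda>y. - ((x - y) powr \<alpha>) / \<alpha>)"
      using assms by (intro continuous_on_divide continuous_on_minus continuous_on_powr_pos
          continuous_on_diff continuous_on_const continuous_on_id) auto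
    show "((\<lambda>y. - ((x - y) powr \<alpha>) / \<alpha>) has_vector_derivative (x - y) powr (\<alpha> - 1)) (at y)"
      if "y \<in> {p<..<q}" for y
      unfolding has_real_derivative_iff_has_vector_derivative[symmetric]
      using that assms by (auto intro!: derivative_eq_intros)
  qed (use assms in auto)
  then show ?thesis by (simp add: diff_divide_distrib)
qed

text \<open>The antiderivative comes from the splitting
  \<open>y - c = (x - c) - (x - y)\<close>.\<close>

lemma kernel_linear_has_integral:
  fixes \<alpha> x p q c :: real
  assumes "0 < \<alpha>" "p \<le> q" "q \<le> x"
  defines "F \<equiv> \<lambda>y. (x - y) powr (\<alpha> + 1) / (\<alpha> + 1) - (x - c) * (x - y) powr \<alpha> / \<alpha>"
  shows "((\<lambda>y. (x - y) powr (\<alpha> - 1) * (y - c)) has_integral (F q - F p)) {p..q}"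
proof (rule fundamental_theorem_of_calculus_interior)
  show "continuous_on {p..q} F"
    unfolding F_def
    using assms by (intro continuous_on_divide continuous_on_mult continuous_on_powr_pos
        continuous_on_diff continuous_on_const continuous_on_id) auto
  show "(F has_vector_derivative (x - y) powr (\<alpha> - 1) * (y - c)) (at y)"
    if "y \<in> {p<..<q}" for y
  proof -
    have y: "x - y > 0" using that assms by auto
    have "((\<lambda>y. (x - y) powr (\<alpha> + 1) / (\<alpha> + 1)) has_real_derivative - ((x - y) powr \<alpha>)) (at y)"
      using y assms(1) by (auto intro!: derivative_eq_intros)
    moreover have "((\<lambda>y. (x - c) * (x - y) powr \<alpha> / \<alpha>) has_real_derivative
        - ((x - c) * (x - y) powr (\<alpha> - 1))) (at y)"
      using y assms(1) by (auto intro!: derivative_eq_intros)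
    ultimately have "(F has_real_derivative - ((x - y) powr \<alpha>) - - ((x - c) * (x - y) powr (\<alpha> - 1))) (at y)"
      unfolding F_def by (rule DERIV_diff)
    moreover have "(x - y) powr \<alpha> = (x - y) * (x - y) powr (\<alpha> - 1)"
      using y powr_mult_base[of "x - y" "\<alpha> - 1"] by simp
    ultimately show ?thesis
      unfolding has_real_derivative_iff_has_vector_derivative[symmetric]
      by (simp add: algebra_simps)
  qed
qed (use assms in auto)

text \<open>Same normalisation as for \<open>powr_step\<close>. Up to the factor
  \<open>h powr (\<alpha> + 1) / \<alpha>\<close> this is the first moment of the kernel about the
  midpoint of a cell, that is, the defect of the midpoint rule on linear functions;
  \<open>kernel_linear_has_integral_scaled_tau\<close> shows this.\<close>

definition scaled_tau :: "real \<Rightarrow> nat \<Rightarrow> real" where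
  "scaled_tau \<alpha> m = Gamma (\<alpha> + 1) * tau \<alpha> m"

lemma scaled_tau_eq:
  assumes "0 < \<alpha>"
  shows "scaled_tau \<alpha> m = ((real m + 1) powr (\<alpha> + 1) - real m powr (\<alpha> + 1)) / (\<alpha> + 1)
     - ((real m + 1) powr \<alpha> + real m powr \<alpha>) / 2"
proof -
  have G: "Gamma (\<alpha> + 2) = (\<alpha> + 1) * Gamma (\<alpha> + 1)"
    using Gamma_plus1[of "\<alpha> + 1"] assms by (simp add: add.assoc nonpos_Ints_def)
  have "Gamma (\<alpha> + 1) \<noteq> 0" using Gamma_real_pos[of "\<alpha> + 1"] assms by linarith
  then have "Gamma (\<alpha> + 1) * (1 / ((\<alpha> + 1) * Gamma (\<alpha> + 1)) * A - 1 / (2 * Gamma (\<alpha> + 1)) * B)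
      = A / (\<alpha> + 1) - B / 2" for A B
    using assms by (simp add: right_diff_distrib)
  then show ?thesis unfolding scaled_tau_def tau_def G .
qed

lemma kernel_linear_has_integral_scaled_tau:
  fixes \<alpha> h c :: real
  assumes "0 < \<alpha>" "0 < h"
  shows "((\<lambda>y. (c + (real m + 1/2) * h - y) powr (\<alpha> - 1) * (y - c)) has_integral h powr (\<alpha> + 1) * scaled_tau \<alpha> m / \<alpha>)
    {c - h/2..c + h/2}"
proof -
  let ?x = "c + (real m + 1/2) * h"
  have "((\<lambda>y. (?x - y) powr (\<alpha> - 1) * (y - c)) has_integral
      (((?x - (c + h/2)) powr (\<alpha> + 1) / (\<alpha> + 1) - (?x - c) * (?x - (c + h/2)) powr \<alpha> / \<alpha>)
       - ((?x - (c - h/2)) powr (\<alpha> + 1) / (\<alpha> + 1) - (?x - c) * (?x - (c - h/2)) powr \<alpha> / \<alpha>)))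
    {c - h/2..c + h/2}"
    using assms by (intro kernel_linear_has_integral) (auto simp: field_simps)
  moreover have "?x - (c + h/2) = h * real m" "?x - (c - h/2) = h * (real m + 1)" "?x - c = h * (real m + 1/2)"
    by (auto simp: field_simps)
  moreover have pow: "s powr (\<alpha> + 1) = s * s powr \<alpha>" if "0 \<le> s" for s :: real
    using powr_mult_base[OF that, of \<alpha>] by (simp add: add.commute)
  have "(h * real m) powr (\<alpha> + 1) = h * real m * (h powr \<alpha> * real m powr \<alpha>)"
    using assms by (subst pow) (auto simp: powr_mult)
  moreover have "(h * (real m + 1)) powr (\<alpha> + 1) = h * (real m + 1) * (h powr \<alpha> * (real m + 1) powr \<alpha>)"
    using assms by (subst pow) (auto simp: powr_mult)
  moreover have "(h * real m) powr \<alpha> = h powr \<alpha> * real m powr \<alpha>"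
      "(h * (real m + 1)) powr \<alpha> = h powr \<alpha> * (real m + 1) powr \<alpha>"
    using assms by (auto simp: powr_mult)
  moreover have "h powr (\<alpha> + 1) * scaled_tau \<alpha> m / \<alpha> = h * h powr \<alpha> *
      (((real m + 1) * (real m + 1) powr \<alpha> - real m * real m powr \<alpha>) / (\<alpha> + 1)
       - ((real m + 1) powr \<alpha> + real m powr \<alpha>) / 2) / \<alpha>"
    unfolding scaled_tau_eq[OF assms(1)] using assms pow[of h] pow[of "real m"] pow[of "real m + 1"] by simp
  moreover have "h * real m * (H * B) / (\<alpha> + 1) - h * (real m + 1/2) * (H * B) / \<alpha>
      - (h * (real m + 1) * (H * A) / (\<alpha> + 1) - h * (real m + 1/2) * (H * A) / \<alpha>)
      = h * H * (((real m + 1) * A - real m * B) / (\<alpha> + 1) - (A + B) / 2) / \<alpha>" for A B H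
  proof -
    \<comment> \<open>The two sides differ only by the partial fraction \<open>1 / (\<alpha> *
      (\<alpha> + 1)) = 1 / \<alpha> - 1 / (\<alpha> + 1)\<close>; naming the reciprocals leaves a
      polynomial identity.\<close>
    define I J where "I = 1 / \<alpha>" and "J = 1 / (\<alpha> + 1)"
    have IJ: "J * I = I - J" using assms(1) by (simp add: I_def J_def divide_simps)
    have "h * real m * (H * B) * J - h * (real m + 1/2) * (H * B) * I
        - (h * (real m + 1) * (H * A) * J - h * (real m + 1/2) * (H * A) * I)
        = h * H * (((real m + 1) * A - real m * B) * (I - J) - (A + B) / 2 * I)"
      by (simp add: algebra_simps add_divide_distrib)
    also have "\<dots> = h * H * (((real m + 1) * A - real m * B) * J - (A + B) / 2) * I"
      unfolding IJ[symmetric] by (simp add: left_diff_distrib)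
    finally show ?thesis by (simp add: I_def J_def)
  qed
  ultimately show ?thesis by (simp only:)
qed

section \<open>Sign and total mass of the \<tau> weights\<close>

text \<open>Since \<open>y - 1/2\<close> has mean zero on the unit cell, the value of the kernel at
  the midpoint may be subtracted. The kernel increases in \<open>y\<close>, so the new integrand is
  nonnegative and at most half the oscillation of the kernel. The index starts at
  \<open>Suc m\<close> because for \<open>0\<close> the kernel is singular inside the closed cell
  and its oscillation is infinite.\<close>

lemma scaled_tau_bounds:
  assumes "0 < \<alpha>" "\<alpha> < 1"
  shows "0 \<le> scaled_tau \<alpha> (Suc m)"
    and "scaled_tau \<alpha> (Suc m) \<le> ((real m + 1) powr (\<alpha> - 1) - (real m + 2) powr (\<alpha> - 1)) / 2"
proof -
  define K where "K y = (real m + 2 - y) powr (\<alpha> - 1)" for y :: real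
  have "((\<lambda>y. K y * (y - 1/2)) has_integral scaled_tau \<alpha> (Suc m) / \<alpha>) {0..1}"
    using kernel_linear_has_integral_scaled_tau[of \<alpha> 1 "1/2" "Suc m"] assms by (simp add: K_def algebra_simps)
  moreover have "((\<lambda>y. y - 1/2) has_integral (1\<^sup>2/2 - 1/2 - (0\<^sup>2/2 - 0/2))) {0..1::real}"
    by (rule fundamental_theorem_of_calculus)
       (auto intro!: derivative_eq_intros simp flip: has_real_derivative_iff_has_vector_derivative)
  then have "((\<lambda>y. K (1/2) * (y - 1/2)) has_integral (K (1/2) * 0)) {0..1::real}"
    by (intro has_integral_mult_right) simp
  ultimately have "((\<lambda>y. K y * (y - 1/2) - K (1/2) * (y - 1/2)) has_integral scaled_tau \<alpha> (Suc m) / \<alpha> - K (1/2) * 0) {0..1}"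
    by (rule has_integral_diff)
  then have I: "((\<lambda>y. (K y - K (1/2)) * (y - 1/2)) has_integral scaled_tau \<alpha> (Suc m) / \<alpha>) {0..1}"
    by (simp add: left_diff_distrib)
  have mono: "K y \<le> K z" if "y \<le> z" "z \<le> 1" for y z
    unfolding K_def using that assms by (intro powr_mono2') auto
  have nonneg: "0 \<le> (K y - K (1/2)) * (y - 1/2)" if "y \<in> {0..1}" for y
    using mono[of y "1/2"] mono[of "1/2" y] that by (cases "y \<le> 1/2") (auto simp: zero_le_mult_iff)
  have "0 \<le> scaled_tau \<alpha> (Suc m) / \<alpha>"
    using has_integral_nonneg[OF I] nonneg by blast
  then show "0 \<le> scaled_tau \<alpha> (Suc m)" using assms by (simp add: zero_le_divide_iff)
  have "(K y - K (1/2)) * (y - 1/2) \<le> (K 1 - K 0) * (1/2)" if "y \<in> {0..1}" for y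
  proof -
    have "(K y - K (1/2)) * (y - 1/2) = \<bar>K y - K (1/2)\<bar> * \<bar>y - 1/2\<bar>"
      using nonneg[OF that] by (simp flip: abs_mult)
    also have "\<dots> \<le> (K 1 - K 0) * (1/2)"
    proof (rule mult_mono)
      show "\<bar>K y - K (1/2)\<bar> \<le> K 1 - K 0"
        using mono[of 0 y] mono[of y 1] mono[of 0 "1/2"] mono[of "1/2" 1] that by auto
      show "\<bar>y - 1/2\<bar> \<le> 1/2" using that by (auto simp: abs_if)
    qed (use mono[of 0 1] in auto)
    finally show ?thesis .
  qed
  moreover have "((\<lambda>y. (K 1 - K 0) * (1/2)) has_integral (K 1 - K 0) * (1/2)) {0..1::real}"
    using has_integral_const_real[of "(K 1 - K 0) * (1/2)" 0 1] by simp
  ultimately have "scaled_tau \<alpha> (Suc m) / \<alpha> \<le> (K 1 - K 0) * (1/2)"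
    using I has_integral_le by blast
  then have "scaled_tau \<alpha> (Suc m) \<le> \<alpha> * ((K 1 - K 0) / 2)" using assms by (simp add: field_simps)
  also have "\<dots> \<le> 1 * ((K 1 - K 0) / 2)"
    using assms mono[of 0 1] by (intro mult_right_mono) auto
  finally show "scaled_tau \<alpha> (Suc m) \<le> ((real m + 1) powr (\<alpha> - 1) - (real m + 2) powr (\<alpha> - 1)) / 2"
    by (simp add: K_def add.commute)
qed

lemma scaled_tau_0: "0 < \<alpha> \<Longrightarrow> scaled_tau \<alpha> 0 = 1 / (\<alpha> + 1) - 1/2"
  by (simp add: scaled_tau_eq)

lemma scaled_tau_0_bounds:
  assumes "0 < \<alpha>" "\<alpha> < 1"
  shows "0 \<le> scaled_tau \<alpha> 0" "scaled_tau \<alpha> 0 \<le> 1/2"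
  using assms by (auto simp: scaled_tau_0 field_simps)

lemma scaled_tau_nonneg: "0 < \<alpha> \<Longrightarrow> \<alpha> < 1 \<Longrightarrow> 0 \<le> scaled_tau \<alpha> m"
  using scaled_tau_0_bounds(1) scaled_tau_bounds(1) by (cases m) auto

lemma sum_scaled_tau_le_1:
  assumes "0 < \<alpha>" "\<alpha> < 1"
  shows "(\<Sum>i<n. scaled_tau \<alpha> i) \<le> 1"
proof -
  \<comment> \<open>The bounds on single terms telescope. The subtracted half power is the rest of
    the telescoping sum and makes the induction go through; at \<open>n = 0\<close> the claim is
    that the first term is at most \<open>1/2\<close>.\<close>
  have "(\<Sum>i<Suc n. scaled_tau \<alpha> i) \<le> 1 - (real n + 1) powr (\<alpha> - 1) / 2" for n
  proof (induction n)
    case 0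
    then show ?case using scaled_tau_0_bounds[OF assms] by simp
  next
    case (Suc n)
    then show ?case using scaled_tau_bounds(2)[OF assms, of n] by (simp add: add.commute)
  qed
  then have "(\<Sum>i<Suc n. scaled_tau \<alpha> i) \<le> 1" for n
    by (smt (verit) divide_nonneg_pos powr_ge_zero)
  then show ?thesis by (cases n) (auto simp del: sum.lessThan_Suc)
qed

section \<open>Stability\<close>

text \<open>Here \<open>x l\<close> stands for \<open>k(x\<^sub>l, x\<^bsub>j-1/2\<^esub>) - 1\<close>. Summation by parts replaces the inverse weights
  by their partial sums, and the increments of the remaining factor are again dominated by the weights themselves,
  so that the convolution identity for the partial sums applies once more.\<close>

lemma powr_step_inv_conv_kernel:
  fixes x :: "nat \<Rightarrow> real"
  assumes "0 < \<alpha>" "\<alpha> < 1" "0 \<le> K" "j \<le> n"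
    and "\<And>l. j \<le> l \<Longrightarrow> l \<le> n \<Longrightarrow> \<bar>x l\<bar> \<le> K * (real (l - j) + 1)"
    and "\<And>l. j \<le> l \<Longrightarrow> Suc l \<le> n \<Longrightarrow> \<bar>x (Suc l) - x l\<bar> \<le> K"
  shows "\<bar>(powr_step_inv \<alpha> * Abs_fps (\<lambda>l. if j \<le> l then powr_step \<alpha> (l - j) * x l else 0)) $ n\<bar> \<le> (19 + 8 / \<alpha>) * K"
proof -
  define A where "A l = (if j \<le> l then powr_step \<alpha> (l - j) * x l else 0)" for l
  \<comment> \<open>The constant is \<open>9 + 4 / \<alpha>\<close> from the increment of the weight
    plus \<open>10 + 4 / \<alpha>\<close> from the increment of \<open>x\<close>.\<close>
  define C where "C = 19 + 8 / \<alpha>"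
  have C: "1 \<le> C" using assms by (simp add: C_def)
  have diff: "\<bar>A l - (if l = 0 then 0 else A (l - 1))\<bar> \<le> C * K * (if j \<le> l then powr_step \<alpha> (l - j) else 0)"
    if "l \<le> n" for l
  proof -
    consider "l < j" | "l = j" | "j < l" by linarith
    then show ?thesis
    proof cases
      case 1
      then show ?thesis by (auto simp: A_def)
    next
      case 2
      then have "\<bar>x l\<bar> \<le> K" using assms(5)[of j] assms(4) by simp
      also have "K \<le> C * K" using C assms(3) by (simp add: mult_le_cancel_right1)
      finally show ?thesis using 2 by (auto simp: A_def)
    next
      case 3
      define i where "i = l - j - 1"
      have l: "l = Suc (j + i)" using 3 by (simp add: i_def)
      have o: "0 \<le> powr_step \<alpha> i - powr_step \<alpha> (Suc i)" using powr_step_antimono[OF assms(1,2), of i "Suc i"] by simp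
      \<comment> \<open>The same bound, used with \<open>i + 2 \<ge> 1\<close>, also shows that
        consecutive weights are comparable.\<close>
      have "(powr_step \<alpha> i - powr_step \<alpha> (Suc i)) * 1 \<le> (powr_step \<alpha> i - powr_step \<alpha> (Suc i)) * (real i + 2)"
        using o by (intro mult_left_mono) auto
      then have d: "(powr_step \<alpha> i - powr_step \<alpha> (Suc i)) * (real i + 2) \<le> (9 + 4 / \<alpha>) * powr_step \<alpha> (Suc i)"
          "powr_step \<alpha> i \<le> (10 + 4 / \<alpha>) * powr_step \<alpha> (Suc i)"
        using powr_step_diff_bound[OF assms(1,2), of i] by (auto simp: algebra_simps)
      have "\<bar>A l - A (l - 1)\<bar> = \<bar>(powr_step \<alpha> (Suc i) - powr_step \<alpha> i) * x l + powr_step \<alpha> i * (x (Suc (j + i)) - x (j + i))\<bar>"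
        unfolding l A_def by (simp add: algebra_simps)
      also have "\<dots> \<le> \<bar>powr_step \<alpha> (Suc i) - powr_step \<alpha> i\<bar> * \<bar>x l\<bar> + \<bar>powr_step \<alpha> i\<bar> * \<bar>x (Suc (j + i)) - x (j + i)\<bar>"
        by (metis abs_mult abs_triangle_ineq)
      also have "\<dots> \<le> (powr_step \<alpha> i - powr_step \<alpha> (Suc i)) * (K * (real i + 2)) + powr_step \<alpha> i * K"
      proof (intro add_mono mult_mono)
        show "\<bar>x l\<bar> \<le> K * (real i + 2)" using assms(5)[of l] that l by (simp add: algebra_simps)
        show "\<bar>x (Suc (j + i)) - x (j + i)\<bar> \<le> K" using assms(6)[of "j + i"] that l by simp
      qed (use o powr_step_pos[OF assms(1), of i] in auto)
      also have "\<dots> = K * ((powr_step \<alpha> i - powr_step \<alpha> (Suc i)) * (real i + 2) + powr_step \<alpha> i)"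
        by (simp add: algebra_simps)
      also have "\<dots> \<le> K * ((9 + 4 / \<alpha>) * powr_step \<alpha> (Suc i) + (10 + 4 / \<alpha>) * powr_step \<alpha> (Suc i))"
        using d assms(3) by (intro mult_left_mono add_mono) auto
      also have "\<dots> = C * K * powr_step \<alpha> (Suc i)" by (simp add: C_def algebra_simps)
      finally show ?thesis using l by simp
    qed
  qed
  have "\<bar>(powr_step_inv \<alpha> * Abs_fps A) $ n\<bar> \<le>
      (\<Sum>k\<le>n. \<bar>powr_step_inv_sum \<alpha> k * (A (n - k) - (if n - k = 0 then 0 else A (n - k - 1)))\<bar>)"
    unfolding powr_step_inv_conv_diff
    by (rule order_trans[OF sum_abs]) (auto intro!: sum_mono)
  also have "\<dots> \<le> (\<Sum>k\<le>n. powr_step_inv_sum \<alpha> k * (C * K * (if j \<le> n - k then powr_step \<alpha> (n - k - j) else 0)))"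
    unfolding abs_mult
  proof (intro sum_mono mult_mono)
    fix k
    show "\<bar>A (n - k) - (if n - k = 0 then 0 else A (n - k - 1))\<bar>
        \<le> C * K * (if j \<le> n - k then powr_step \<alpha> (n - k - j) else 0)"
      by (rule diff) simp
  qed (use powr_step_inv_sum_nonneg[OF assms(1,2)] in auto)
  also have "\<dots> = C * K * (\<Sum>k\<le>n. if k \<le> n - j then powr_step_inv_sum \<alpha> k * powr_step \<alpha> (n - j - k) else 0)"
    unfolding sum_distrib_left using assms(4)
    by (intro sum.cong) (auto simp: algebra_simps)
  also have "(\<Sum>k\<le>n. if k \<le> n - j then powr_step_inv_sum \<alpha> k * powr_step \<alpha> (n - j - k) else 0)
      = (\<Sum>k\<le>n - j. powr_step_inv_sum \<alpha> k * powr_step \<alpha> (n - j - k))"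
    by (intro sum.mono_neutral_cong_right) auto
  also have "\<dots> = 1" by (rule powr_step_inv_sum_conv)
  finally show ?thesis by (simp add: A_def[abs_def] C_def)
qed

section \<open>Gronwall's inequality and the starting values\<close>

text \<open>The induction runs on the entire right-hand side
  \<open>B + q * (\<Sum>j<m. x j)\<close>, which grows by a factor of at most \<open>1 + q\<close>
  per step.\<close>

lemma discrete_gronwall:
  fixes x :: "nat \<Rightarrow> real"
  assumes "0 \<le> q" "n \<le> N" and "\<And>m. m \<le> N \<Longrightarrow> x m \<le> B + q * (\<Sum>j<m. x j)"
  shows "x n \<le> B * (1 + q) ^ n"
proof -
  have "B + q * (\<Sum>j<m. x j) \<le> B * (1 + q) ^ m" if "m \<le> N" for m
    using that
  proof (induction m)
    case (Suc m)
    have "B + q * (\<Sum>j<Suc m. x j) = (B + q * (\<Sum>j<m. x j)) + q * x m"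
      by (simp add: algebra_simps)
    also have "\<dots> \<le> (B + q * (\<Sum>j<m. x j)) * (1 + q)"
      using mult_left_mono[OF assms(3)[of m] assms(1)] Suc.prems by (simp add: algebra_simps)
    also have "\<dots> \<le> B * (1 + q) ^ m * (1 + q)"
      using Suc assms(1) by (intro mult_right_mono) auto
    finally show ?case by (simp add: mult_ac)
  qed simp
  from order_trans[OF assms(3)[OF assms(2)] this[OF assms(2)]] show ?thesis .
qed

text \<open>Cramer's rule. The determinant simplifies to \<open>1 + t2 - t1 - t1 * w\<close>, which
  is at least \<open>1 - t1 \<ge> 1/2\<close>. The perturbations \<open>p1\<close>,
  \<open>p2\<close> depend on the unknowns themselves; they contribute at most \<open>14 * d\<close>
  times the total, which is absorbed because \<open>28 * d \<le> 1\<close>.\<close>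

lemma perturbed_2x2_bound:
  fixes e1 e2 y1 y2 p1 p2 t1 t2 w S d :: real
  assumes "(1 - t1) * e1 + t1 * e2 = y1 - p1" "(w - t2) * e1 + (1 + t2) * e2 = y2 - p2"
    and "0 \<le> t1" "t1 \<le> 1/2" "t1 \<le> t2" "t2 \<le> 1" "0 \<le> w" "w \<le> 1"
    and "\<bar>p1\<bar> \<le> d * (\<bar>e1\<bar> + \<bar>e2\<bar>)" "\<bar>p2\<bar> \<le> 2 * d * (\<bar>e1\<bar> + \<bar>e2\<bar>)" "28 * d \<le> 1"
    and "\<bar>y1\<bar> \<le> Y" "\<bar>y2\<bar> \<le> Y"
  shows "\<bar>e1\<bar> + \<bar>e2\<bar> \<le> 20 * Y"
proof -
  define \<Delta> where "\<Delta> = (1 - t1) * (1 + t2) - t1 * (w - t2)"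
  have "t1 * w \<le> t1 * 1" using assms by (intro mult_left_mono) auto
  then have \<Delta>: "1/2 \<le> \<Delta>" using assms by (simp add: \<Delta>_def algebra_simps)
  define z1 where "z1 = y1 - p1"
  define z2 where "z2 = y2 - p2"
  have "\<Delta> * e1 = (1 + t2) * z1 - t1 * z2"
    unfolding z1_def z2_def assms(1,2)[symmetric] \<Delta>_def by algebra
  have "\<Delta> * e2 = (1 - t1) * z2 - (w - t2) * z1"
    unfolding z1_def z2_def assms(1,2)[symmetric] \<Delta>_def by algebra
  have half: "\<bar>e\<bar> \<le> 2 * \<bar>\<Delta> * e\<bar>" for e
  proof -
    have "1/2 * \<bar>e\<bar> \<le> \<bar>\<Delta>\<bar> * \<bar>e\<bar>" using \<Delta> by (intro mult_right_mono) auto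
    then show ?thesis by (simp add: abs_mult)
  qed
  have "\<bar>\<Delta> * e1\<bar> \<le> \<bar>1 + t2\<bar> * \<bar>z1\<bar> + \<bar>t1\<bar> * \<bar>z2\<bar>"
    unfolding \<open>\<Delta> * e1 = _\<close> by (metis abs_mult abs_triangle_ineq4)
  also have "\<dots> \<le> 2 * \<bar>z1\<bar> + 1 * \<bar>z2\<bar>"
    using assms by (intro add_mono mult_right_mono) auto
  finally have 1: "\<bar>\<Delta> * e1\<bar> \<le> 2 * \<bar>z1\<bar> + 1 * \<bar>z2\<bar>" .
  have "\<bar>\<Delta> * e2\<bar> \<le> \<bar>1 - t1\<bar> * \<bar>z2\<bar> + \<bar>w - t2\<bar> * \<bar>z1\<bar>"
    unfolding \<open>\<Delta> * e2 = _\<close> by (metis abs_mult abs_triangle_ineq4)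
  also have "\<dots> \<le> 1 * \<bar>z2\<bar> + 1 * \<bar>z1\<bar>"
    using assms by (intro add_mono mult_right_mono) auto
  finally have 2: "\<bar>\<Delta> * e2\<bar> \<le> 1 * \<bar>z2\<bar> + 1 * \<bar>z1\<bar>" .
  define T where "T = \<bar>e1\<bar> + \<bar>e2\<bar>"
  have dT: "28 * (d * T) \<le> T"
    using mult_right_mono[OF assms(11), of T] by (simp add: T_def)
  have "\<bar>z1\<bar> \<le> Y + d * T" "\<bar>z2\<bar> \<le> Y + 2 * (d * T)"
    using assms(9,10,12,13) unfolding z1_def z2_def T_def[symmetric] by linarith+
  then have "T \<le> 10 * Y + 14 * (d * T)"
    using 1 2 half[of e1] half[of e2] unfolding T_def by linarith
  then have "T \<le> 20 * Y" using dT by linarith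
  then show ?thesis by (simp add: T_def)
qed

lemma powr_step_1_le: "0 < \<alpha> \<Longrightarrow> \<alpha> < 1 \<Longrightarrow> powr_step \<alpha> n \<le> 1"
  using powr_step_antimono[of \<alpha> 0 n] by simp

lemma modified_scheme_normalized:
  fixes \<alpha> h :: real
  assumes "0 < \<alpha>" "0 < h" and "modified_scheme \<alpha> k h N g v" "n \<in> {1..N}"
  shows "(\<Sum>j=1..n. powr_step \<alpha> (n - j) * k (grid h n) (midgrid h j) * v j)
      + (\<Sum>i<n. scaled_tau \<alpha> i) * (k (grid h n) (midgrid h 2) * v 2 - k (grid h n) (midgrid h 1) * v 1)
      = Gamma (\<alpha> + 1) * g n / h powr \<alpha>"
proof -
  have G: "Gamma (\<alpha> + 1) \<noteq> 0" using Gamma_real_pos[of "\<alpha> + 1"] assms(1) by linarith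
  have 1: "Gamma (\<alpha> + 1) * (\<Sum>j=1..n. omega_wt \<alpha> (n - j) * k (grid h n) (midgrid h j) * v j)
      = (\<Sum>j=1..n. powr_step \<alpha> (n - j) * k (grid h n) (midgrid h j) * v j)"
    unfolding sum_distrib_left using G by (intro sum.cong) (auto simp: omega_wt_def powr_step_def)
  have "{1..2::nat} = {1, 2}" by auto
  then have 2: "Gamma (\<alpha> + 1) * (\<Sum>j=1..2. corr_wt \<alpha> n j * k (grid h n) (midgrid h j) * v j)
      = (\<Sum>i<n. scaled_tau \<alpha> i) * (k (grid h n) (midgrid h 2) * v 2 - k (grid h n) (midgrid h 1) * v 1)"
    using sum_distrib_left[of "Gamma (\<alpha> + 1)" "tau \<alpha>" "{..<n}", symmetric]
    by (simp add: corr_wt_def scaled_tau_def[abs_def] algebra_simps)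
  have "Gamma (\<alpha> + 1) * g n / h powr \<alpha> =
     Gamma (\<alpha> + 1) * (\<Sum>j=1..n. omega_wt \<alpha> (n - j) * k (grid h n) (midgrid h j) * v j)
     + Gamma (\<alpha> + 1) * (\<Sum>j=1..2. corr_wt \<alpha> n j * k (grid h n) (midgrid h j) * v j)"
    using assms(2,3) bspec[OF assms(3)[unfolded modified_scheme_def] assms(4), symmetric]
    by (simp add: ring_distribs add_divide_distrib)
  then show ?thesis unfolding 1 2 by simp
qed

text \<open>The first two equations are the unperturbed system for \<open>k = 1\<close> plus terms
  with the factor \<open>k - 1\<close>, which is at most \<open>2 * L * h\<close> near the corner.
  The right-hand side is split into a part \<open>\<eta>\<close> of bounded size and a part
  \<open>R\<close> with bounded increments, since the two are amplified differently later.\<close>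

lemma scheme_start_bound:
  fixes \<alpha> a h L :: real
  assumes "0 < \<alpha>" "\<alpha> < 1" "0 < a" "0 \<le> L" "2 \<le> N" "h = a / real N" "h \<le> 1" "56 * (L * h) \<le> 1"
    and lip: "\<And>x y. x \<in> {0..a} \<Longrightarrow> y \<in> {0..a} \<Longrightarrow> \<bar>k x y - 1\<bar> \<le> L * \<bar>x - y\<bar>"
    and "modified_scheme \<alpha> k h N (\<lambda>n. \<eta> n + R n) e"
    and bd: "\<And>n. n \<in> {1..N} \<Longrightarrow> \<bar>\<eta> n\<bar> \<le> E" "\<And>n. n \<in> {1..N} \<Longrightarrow> \<bar>R n - R (n - 1)\<bar> \<le> D"
    and "R 0 = 0"
  shows "\<bar>e 1\<bar> + \<bar>e 2\<bar> \<le> 40 * Gamma (\<alpha> + 1) * (E / h powr \<alpha> + D / h)"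
proof -
  have h: "0 < h" "real N * h = a" using assms by auto
  have h2: "2 * h \<le> a" using assms(5) h by (metis mult_right_mono of_nat_le_iff of_nat_numeral less_imp_le)
  have G: "0 < Gamma (\<alpha> + 1)" using assms by (intro Gamma_real_pos) auto
  define Y where "Y = Gamma (\<alpha> + 1) * (E + 2 * D) / h powr \<alpha>"
  define p1 where "p1 = (1 - scaled_tau \<alpha> 0) * (k (grid h 1) (midgrid h 1) - 1) * e 1
      + scaled_tau \<alpha> 0 * (k (grid h 1) (midgrid h 2) - 1) * e 2"
  define p2 where "p2 = (powr_step \<alpha> 1 - (scaled_tau \<alpha> 0 + scaled_tau \<alpha> 1)) * (k (grid h 2) (midgrid h 1) - 1) * e 1
      + (1 + (scaled_tau \<alpha> 0 + scaled_tau \<alpha> 1)) * (k (grid h 2) (midgrid h 2) - 1) * e 2"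
  have near: "\<bar>k (grid h n) (midgrid h j) - 1\<bar> \<le> 2 * L * h" if "n \<in> {1,2}" "j \<in> {1,2}" for n j
  proof -
    have "\<bar>k (grid h n) (midgrid h j) - 1\<bar> \<le> L * \<bar>grid h n - midgrid h j\<bar>"
      using that h(1) h2 by (intro lip) (auto simp: grid_def midgrid_def algebra_simps)
    also have "\<dots> \<le> L * (2 * h)"
      using that h(1) assms(4) by (intro mult_left_mono) (auto simp: grid_def midgrid_def algebra_simps)
    finally show ?thesis by simp
  qed
  have scaled_tau: "0 \<le> scaled_tau \<alpha> 0" "scaled_tau \<alpha> 0 \<le> 1/2" "0 \<le> scaled_tau \<alpha> 1" "scaled_tau \<alpha> 0 + scaled_tau \<alpha> 1 \<le> 1"
    using scaled_tau_0_bounds[OF assms(1,2)] scaled_tau_nonneg[OF assms(1,2)] sum_scaled_tau_le_1[OF assms(1,2), of 2]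
    by (auto simp: eval_nat_numeral)
  have om1: "0 \<le> powr_step \<alpha> 1" "powr_step \<alpha> 1 \<le> 1"
    using powr_step_pos[OF assms(1), of 1] powr_step_1_le[OF assms(1,2)] by auto
  have eqs: "(1 - scaled_tau \<alpha> 0) * e 1 + scaled_tau \<alpha> 0 * e 2 = Gamma (\<alpha> + 1) * (\<eta> 1 + R 1) / h powr \<alpha> - p1"
    "(powr_step \<alpha> 1 - (scaled_tau \<alpha> 0 + scaled_tau \<alpha> 1)) * e 1 + (1 + (scaled_tau \<alpha> 0 + scaled_tau \<alpha> 1)) * e 2
       = Gamma (\<alpha> + 1) * (\<eta> 2 + R 2) / h powr \<alpha> - p2"
    using modified_scheme_normalized[OF assms(1) h(1) assms(10), of 1]
      modified_scheme_normalized[OF assms(1) h(1) assms(10), of 2] assms(5)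
    by (auto simp: p1_def p2_def eval_nat_numeral algebra_simps)
  have D: "0 \<le> D" and E: "0 \<le> E" using bd[of 1] assms(5) by force+
  have Rb: "\<bar>\<eta> 1\<bar> \<le> E" "\<bar>\<eta> 2\<bar> \<le> E" "\<bar>R 1\<bar> \<le> D" "\<bar>R 2 - R 1\<bar> \<le> D"
    using bd(1)[of 1] bd(1)[of 2] bd(2)[of 1] bd(2)[of 2] assms(5,13) by auto
  have y: "\<bar>Gamma (\<alpha> + 1) * (\<eta> n + R n) / h powr \<alpha>\<bar> \<le> Y" if "n \<in> {1, 2}" for n
  proof -
    \<comment> \<open>\<open>R\<close> starts at \<open>0\<close>, so after at most two increments
      it is at most \<open>2 * D\<close>.\<close>
    have "\<bar>\<eta> n + R n\<bar> \<le> E + 2 * D" using that Rb D E by auto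
    then show ?thesis unfolding Y_def using G h by (simp add: abs_mult abs_divide divide_right_mono)
  qed
  have abs2: "\<bar>b1 * c1 * z1 + b2 * c2 * z2\<bar> \<le> b * (2 * L * h) * (\<bar>z1\<bar> + \<bar>z2\<bar>)"
    if "\<bar>b1\<bar> \<le> b" "\<bar>b2\<bar> \<le> b" "\<bar>c1\<bar> \<le> 2 * L * h" "\<bar>c2\<bar> \<le> 2 * L * h" for b b1 b2 c1 c2 z1 z2 :: real
  proof -
    have "\<bar>b1 * c1 * z1 + b2 * c2 * z2\<bar> \<le> \<bar>b1\<bar> * \<bar>c1\<bar> * \<bar>z1\<bar> + \<bar>b2\<bar> * \<bar>c2\<bar> * \<bar>z2\<bar>"
      by (metis abs_mult abs_triangle_ineq)
    also have "\<dots> \<le> b * (2 * L * h) * \<bar>z1\<bar> + b * (2 * L * h) * \<bar>z2\<bar>"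
      using that by (intro add_mono mult_right_mono mult_mono) auto
    finally show ?thesis by (simp add: algebra_simps)
  qed
  have "\<bar>p1\<bar> \<le> 1 * (2 * L * h) * (\<bar>e 1\<bar> + \<bar>e 2\<bar>)"
    unfolding p1_def using scaled_tau near by (intro abs2) auto
  moreover have "\<bar>p2\<bar> \<le> 2 * (2 * L * h) * (\<bar>e 1\<bar> + \<bar>e 2\<bar>)"
    unfolding p2_def using scaled_tau om1 near by (intro abs2) auto
  ultimately have "\<bar>e 1\<bar> + \<bar>e 2\<bar> \<le> 20 * Y"
    using perturbed_2x2_bound[OF eqs, of "2 * L * h" Y] scaled_tau om1 assms(8) y by auto
  also have "20 * Y \<le> 40 * Gamma (\<alpha> + 1) * (E / h powr \<alpha> + D / h powr \<alpha>)"
    using G E h by (simp add: Y_def field_simps)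
  also have "\<dots> \<le> 40 * Gamma (\<alpha> + 1) * (E / h powr \<alpha> + D / h)"
  proof -
    \<comment> \<open>For the first two values \<open>D / h powr \<alpha>\<close> would do; the
      weaker \<open>D / h\<close> matches the global estimate.\<close>
    have "h powr 1 \<le> h powr \<alpha>" using h assms by (intro powr_mono') auto
    then have "D / h powr \<alpha> \<le> D / h" using D h by (intro divide_left_mono) auto
    then show ?thesis using G by (intro mult_left_mono) auto
  qed
  finally show ?thesis .
qed

section \<open>Error representation and the global stability estimate\<close>

text \<open>Writing \<open>k\<close> as \<open>1 + (k - 1)\<close> makes the normalised scheme a
  pure convolution of the weights with the unknown plus two perturbations; multiplication by the
  inverse series isolates the unknown. The correction term \<open>t\<close> depends only on the two
  starting values and is treated as data.\<close>

lemma scheme_error_representation: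
  fixes \<alpha> h :: real
  assumes "0 < \<alpha>" "0 < h" and "modified_scheme \<alpha> k h N g e" "n \<in> {1..N}"
  defines "t \<equiv> \<lambda>l. (\<Sum>i<l. scaled_tau \<alpha> i) * (k (grid h l) (midgrid h 2) * e 2 - k (grid h l) (midgrid h 1) * e 1)"
  shows "e n = (powr_step_inv \<alpha> * Abs_fps (\<lambda>l. if l = 0 then 0 else Gamma (\<alpha> + 1) * g l / h powr \<alpha> - t l)) $ n
     - (\<Sum>j=1..n. e j * (powr_step_inv \<alpha> * Abs_fps (\<lambda>l. if j \<le> l then
           powr_step \<alpha> (l - j) * (k (grid h l) (midgrid h j) - 1) else 0)) $ n)"
proof -
  define V where "V = Abs_fps (\<lambda>n. if n = 0 then 0 else e n)"
  define q where "q = (\<lambda>l. if l = 0 then 0 else Gamma (\<alpha> + 1) * g l / h powr \<alpha> - t l)"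
  define x where "x = (\<lambda>j l. k (grid h l) (midgrid h j) - 1)"
  \<comment> \<open>The sum over \<open>j\<close> is extended from \<open>l\<close> to the fixed
    bound \<open>n\<close> by zero terms, so that the two summations can be interchanged
    below.\<close>
  have conv: "(Abs_fps (powr_step \<alpha>) * V) $ l = q l - (\<Sum>j=1..n. e j * (if j \<le> l then powr_step \<alpha> (l - j) * x j l else 0))"
    if "l \<le> n" for l
  proof (cases "l = 0")
    case True
    then show ?thesis by (auto simp: V_def q_def)
  next
    case False
    have "(Abs_fps (powr_step \<alpha>) * V) $ l = (V * Abs_fps (powr_step \<alpha>)) $ l" by (simp add: mult.commute)
    also have "\<dots> = (\<Sum>j\<le>l. V $ j * powr_step \<alpha> (l - j))" unfolding fps_mult_nth_atMost by simp
    also have "\<dots> = (\<Sum>j=1..l. powr_step \<alpha> (l - j) * e j)"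
      by (intro sum.mono_neutral_cong_right) (auto simp: V_def)
    finally have "(Abs_fps (powr_step \<alpha>) * V) $ l = (\<Sum>j=1..l. powr_step \<alpha> (l - j) * e j)" .
    moreover have "(\<Sum>j=1..l. powr_step \<alpha> (l - j) * k (grid h l) (midgrid h j) * e j) + t l
        = Gamma (\<alpha> + 1) * g l / h powr \<alpha>"
      unfolding t_def using modified_scheme_normalized[OF assms(1,2,3), of l] that False assms(4) by simp
    moreover have "(\<Sum>j=1..l. powr_step \<alpha> (l - j) * k (grid h l) (midgrid h j) * e j)
       = (\<Sum>j=1..l. powr_step \<alpha> (l - j) * e j) + (\<Sum>j=1..l. e j * (powr_step \<alpha> (l - j) * x j l))"
      unfolding sum.distrib[symmetric] by (intro sum.cong) (auto simp: x_def algebra_simps)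
    moreover have "(\<Sum>j=1..l. e j * (powr_step \<alpha> (l - j) * x j l))
       = (\<Sum>j=1..n. e j * (if j \<le> l then powr_step \<alpha> (l - j) * x j l else 0))"
      using that by (intro sum.mono_neutral_cong_left) auto
    ultimately show ?thesis using False by (simp add: q_def)
  qed
  have "e n = V $ n" using assms(4) by (simp add: V_def)
  also have "V = powr_step_inv \<alpha> * (Abs_fps (powr_step \<alpha>) * V)"
    by (simp add: mult.assoc[symmetric] powr_step_inv_mult)
  also have "\<dots> $ n = (\<Sum>l\<le>n. powr_step_inv \<alpha> $ l * (q (n - l)
      - (\<Sum>j=1..n. e j * (if j \<le> n - l then powr_step \<alpha> (n - l - j) * x j (n - l) else 0))))"
    unfolding fps_mult_nth_atMost[of "powr_step_inv \<alpha>"] using conv by (intro sum.cong) auto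
  also have "\<dots> = (\<Sum>l\<le>n. powr_step_inv \<alpha> $ l * q (n - l))
      - (\<Sum>l\<le>n. \<Sum>j=1..n. powr_step_inv \<alpha> $ l * (e j * (if j \<le> n - l then powr_step \<alpha> (n - l - j) * x j (n - l) else 0)))"
    by (simp add: right_diff_distrib sum_subtractf sum_distrib_left)
  also have "(\<Sum>l\<le>n. powr_step_inv \<alpha> $ l * q (n - l)) = (powr_step_inv \<alpha> * Abs_fps q) $ n"
    by (simp add: fps_mult_nth_atMost)
  also have "(\<Sum>l\<le>n. \<Sum>j=1..n. powr_step_inv \<alpha> $ l * (e j * (if j \<le> n - l then powr_step \<alpha> (n - l - j) * x j (n - l) else 0)))
     = (\<Sum>j=1..n. e j * (powr_step_inv \<alpha> * Abs_fps (\<lambda>l. if j \<le> l then powr_step \<alpha> (l - j) * x j l else 0)) $ n)"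
    by (subst sum.swap) (simp add: fps_mult_nth_atMost sum_distrib_left mult.left_commute)
  finally show ?thesis unfolding q_def x_def .
qed

text \<open>By summation by parts the convolution is at most \<open>D\<close> times a sum of
  \<open>powr_step_inv_sum\<close>, hence at most
  \<open>D * (n + 1) powr (1 - \<alpha>) / \<alpha>\<close>. The factor
  \<open>h powr \<alpha>\<close> is kept explicit because it cancels against the division in the
  normalised scheme.\<close>

lemma powr_step_inv_conv_increments:
  assumes "0 < \<alpha>" "\<alpha> < 1" "0 < h" "0 < a" "real n * h \<le> a" "n \<ge> 1" "R 0 = 0"
    and "\<And>l. l \<in> {1..n} \<Longrightarrow> \<bar>R l - R (l - 1)\<bar> \<le> D"
  shows "\<bar>(powr_step_inv \<alpha> * Abs_fps R) $ n\<bar> \<le> 2 * a powr (1 - \<alpha>) / \<alpha> * h powr \<alpha> * (D / h)"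
proof -
  have D: "0 \<le> D" using assms(8)[of 1] assms(6) by force
  have "\<bar>(powr_step_inv \<alpha> * Abs_fps R) $ n\<bar> \<le>
      (\<Sum>k\<le>n. \<bar>powr_step_inv_sum \<alpha> k * (R (n - k) - (if k = n then 0 else R (n - k - 1)))\<bar>)"
    unfolding powr_step_inv_conv_diff by (rule order_trans[OF sum_abs]) (simp cong: if_cong)
  also have "\<dots> \<le> (\<Sum>k\<le>n. powr_step_inv_sum \<alpha> k * D)"
    unfolding abs_mult
  proof (intro sum_mono mult_mono)
    fix k assume "k \<in> {..n}"
    then show "\<bar>R (n - k) - (if k = n then 0 else R (n - k - 1))\<bar> \<le> D"
      using assms(7) assms(8)[of "n - k"] D by auto
  qed (use powr_step_inv_sum_nonneg[OF assms(1,2)] in auto)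
  also have "\<dots> \<le> (real n + 1) powr (1 - \<alpha>) / \<alpha> * D"
    unfolding sum_distrib_right[symmetric] using powr_step_inv_sum_sum_le[OF assms(1,2)] D
    by (intro mult_right_mono) auto
  also have "\<dots> \<le> 2 * a powr (1 - \<alpha>) * h powr (\<alpha> - 1) / \<alpha> * D"
  proof -
    \<comment> \<open>From \<open>n \<ge> 1\<close> the extra step is at most
      \<open>n * h \<le> a\<close>, whence \<open>n + 1 \<le> 2 * a / h\<close>.\<close>
    have "1 * h \<le> real n * h" using assms(3,6) by (intro mult_right_mono) auto
    then have "(real n + 1) * h \<le> 2 * a" using assms(5) by (simp add: distrib_right)
    then have "real n + 1 \<le> 2 * (a / h)" using assms(3) by (simp add: pos_le_divide_eq)
    then have "(real n + 1) powr (1 - \<alpha>) \<le> (2 * (a / h)) powr (1 - \<alpha>)"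
      using assms by (intro powr_mono2) auto
    also have "\<dots> = 2 powr (1 - \<alpha>) * (a powr (1 - \<alpha>) * h powr (\<alpha> - 1))"
      using assms(3,4) powr_minus[of h "1 - \<alpha>"] by (simp add: powr_mult powr_divide field_simps)
    also have "\<dots> \<le> 2 powr 1 * (a powr (1 - \<alpha>) * h powr (\<alpha> - 1))"
      using assms by (intro mult_right_mono powr_mono) auto
    finally have "(real n + 1) powr (1 - \<alpha>) \<le> 2 * a powr (1 - \<alpha>) * h powr (\<alpha> - 1)" by simp
    then show ?thesis using assms D by (intro mult_right_mono divide_right_mono) auto
  qed
  also have "h powr (\<alpha> - 1) = h powr \<alpha> / h" using assms by (simp add: powr_diff)
  finally show ?thesis by (simp add: mult_ac)
qed

text \<open>The part \<open>\<eta>\<close> is handled through the absolute sum of the inverse, which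
  costs \<open>h powr (- \<alpha>)\<close>; the part \<open>R\<close> through its increments, which
  costs \<open>1 / h\<close>. The kernel perturbation has entries of size \<open>O(h)\<close> after
  inversion, and Gronwall's inequality absorbs it.\<close>

lemma modified_scheme_stability:
  fixes \<alpha> a L :: real
  assumes "0 < \<alpha>" "\<alpha> < 1" "0 < a" "0 \<le> L"
    and lip: "\<And>x x' y. x \<in> {0..a} \<Longrightarrow> x' \<in> {0..a} \<Longrightarrow> y \<in> {0..a} \<Longrightarrow> \<bar>k x y - k x' y\<bar> \<le> L * \<bar>x - x'\<bar>"
    and diag: "\<And>x. x \<in> {0..a} \<Longrightarrow> k x x = 1"
  obtains C h0 where "0 < h0" "0 \<le> C"
    "\<And>N h e \<eta> R E D n. 2 \<le> N \<Longrightarrow> h = a / real N \<Longrightarrow> h \<le> h0 \<Longrightarrow>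
      modified_scheme \<alpha> k h N (\<lambda>n. \<eta> n + R n) e \<Longrightarrow>
      (\<And>n. n \<in> {1..N} \<Longrightarrow> \<bar>\<eta> n\<bar> \<le> E) \<Longrightarrow>
      (\<And>n. n \<in> {1..N} \<Longrightarrow> \<bar>R n - R (n - 1)\<bar> \<le> D) \<Longrightarrow> R 0 = 0 \<Longrightarrow> n \<in> {1..N} \<Longrightarrow>
      \<bar>e n\<bar> \<le> C * (E / h powr \<alpha> + D / h)"
proof -
  define G where "G = Gamma (\<alpha> + 1)"
  have G: "0 < G" using assms unfolding G_def by (intro Gamma_real_pos) auto
  \<comment> \<open>\<open>M * h\<close> is the bound of \<open>powr_step_inv_conv_kernel\<close>
    for Lipschitz steps \<open>L * h\<close>; below, \<open>K\<close> bounds \<open>k\<close> at the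
    nodes. In \<open>C1\<close> the first summand comes from \<open>\<eta>\<close> and the
    correction term, the second from \<open>R\<close>.\<close>
  define M where "M = (19 + 8 / \<alpha>) * L"
  have M: "0 \<le> M" using assms by (simp add: M_def)
  define K where "K = 1 + L * a"
  have K: "1 \<le> K" using assms by (simp add: K_def)
  define C1 where "C1 = 2 * (G + K * (40 * G)) + G * (2 * a powr (1 - \<alpha>) / \<alpha>)"
  have C1: "0 \<le> C1" using G K assms by (simp add: C1_def)
  define C where "C = 2 * C1 * exp (2 * M * a)"
  \<comment> \<open>This yields \<open>h \<le> 1\<close>, \<open>56 * (L * h) \<le> 1\<close> for
    the starting system, and \<open>2 * (M * h) \<le> 1\<close> for absorbing the diagonal
    term.\<close>
  define h0 where "h0 = min 1 (1 / (56 * L + 2 * M + 1))"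
  have LM: "0 < 56 * L + 2 * M + 1" using M assms by linarith
  have h0: "0 < h0" using LM by (simp add: h0_def)
  show ?thesis
  proof (rule that[OF h0])
    show "0 \<le> C" using C1 by (simp add: C_def)
    fix N :: nat and h :: real and e \<eta> R :: "nat \<Rightarrow> real" and E D :: real and n :: nat
    assume N: "2 \<le> N" and h: "h = a / real N" and hh0: "h \<le> h0"
      and sch: "modified_scheme \<alpha> k h N (\<lambda>n. \<eta> n + R n) e"
      and bd: "\<And>n. n \<in> {1..N} \<Longrightarrow> \<bar>\<eta> n\<bar> \<le> E" "\<And>n. n \<in> {1..N} \<Longrightarrow> \<bar>R n - R (n - 1)\<bar> \<le> D"
      and R0: "R 0 = 0" and n: "n \<in> {1..N}"
    have hpos: "0 < h" using h N assms by simp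
    have Nh: "real N * h = a" using h N by simp
    have h1: "h \<le> 1" using hh0 by (simp add: h0_def)
    have "h \<le> 1 / (56 * L + 2 * M + 1)" using hh0 by (simp add: h0_def)
    then have "56 * (L * h) + 2 * (M * h) + h \<le> 1" using LM by (simp add: field_simps)
    moreover have "0 \<le> L * h" "0 \<le> M * h" using assms M hpos by auto
    ultimately have Lh: "56 * (L * h) \<le> 1" and Mh: "2 * (M * h) \<le> 1" using hpos by linarith+
    have D: "0 \<le> D" and E: "0 \<le> E" using bd[of 1] N by force+
    define B where "B = E / h powr \<alpha> + D / h"
    have B: "0 \<le> B" "E / h powr \<alpha> \<le> B" using D E hpos by (auto simp: B_def)
    have in_a: "midgrid h j \<in> {0..a}" "grid h j \<in> {0..a}" if "j \<in> {1..N}" for j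
    proof -
      have "real j * h \<le> real N * h" using that hpos by (intro mult_right_mono) auto
      then have "real j * h \<le> a" using Nh by simp
      moreover have "1 * h \<le> real j * h" using that hpos by (intro mult_right_mono) auto
      ultimately show "midgrid h j \<in> {0..a}" "grid h j \<in> {0..a}"
        using hpos by (auto simp: midgrid_def grid_def left_diff_distrib)
    qed
    have k1: "\<bar>k x y - 1\<bar> \<le> L * \<bar>x - y\<bar>" if "x \<in> {0..a}" "y \<in> {0..a}" for x y
      using lip[of x y y] diag[of y] that by simp
    have kK: "\<bar>k (grid h l) (midgrid h j)\<bar> \<le> K" if "l \<in> {1..N}" "j \<in> {1..N}" for l j
    proof -
      have "\<bar>k (grid h l) (midgrid h j) - 1\<bar> \<le> L * \<bar>grid h l - midgrid h j\<bar>"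
        using in_a that by (intro k1) auto
      also have "\<dots> \<le> L * a" using in_a[OF that(1)] in_a[OF that(2)] assms(4)
        by (intro mult_left_mono) auto
      finally show ?thesis by (simp add: K_def)
    qed
    have e12: "\<bar>e 1\<bar> + \<bar>e 2\<bar> \<le> 40 * G * B"
      unfolding G_def B_def using scheme_start_bound[OF assms(1-4) N h h1 Lh k1 sch bd R0] .
    define t where "t = (\<lambda>l. (\<Sum>i<l. scaled_tau \<alpha> i) * (k (grid h l) (midgrid h 2) * e 2 - k (grid h l) (midgrid h 1) * e 1))"
    have t: "\<bar>t l\<bar> \<le> K * (40 * G * B)" if "l \<in> {1..N}" for l
    proof -
      have s: "0 \<le> (\<Sum>i<l. scaled_tau \<alpha> i)" "(\<Sum>i<l. scaled_tau \<alpha> i) \<le> 1"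
        using scaled_tau_nonneg[OF assms(1,2)] sum_scaled_tau_le_1[OF assms(1,2)] by (auto intro: sum_nonneg)
      have "\<bar>k (grid h l) (midgrid h 2) * e 2 - k (grid h l) (midgrid h 1) * e 1\<bar>
          \<le> \<bar>k (grid h l) (midgrid h 2)\<bar> * \<bar>e 2\<bar> + \<bar>k (grid h l) (midgrid h 1)\<bar> * \<bar>e 1\<bar>"
        by (metis abs_mult abs_triangle_ineq4)
      also have "\<dots> \<le> K * \<bar>e 2\<bar> + K * \<bar>e 1\<bar>"
        using kK that N by (intro add_mono mult_right_mono) auto
      also have "\<dots> = K * (\<bar>e 1\<bar> + \<bar>e 2\<bar>)" by (simp add: algebra_simps)
      also have "\<dots> \<le> K * (40 * G * B)" using e12 K by (intro mult_left_mono) auto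
      finally have "\<bar>t l\<bar> \<le> 1 * (K * (40 * G * B))"
        unfolding t_def abs_mult using s by (intro mult_mono) auto
      then show ?thesis by simp
    qed
    have rec: "\<bar>e m\<bar> \<le> C1 * B + M * h * (\<Sum>j=1..m. \<bar>e j\<bar>)" if m: "m \<in> {1..N}" for m
    proof -
      \<comment> \<open>\<open>?q1\<close> collects what is bounded in size, namely noise and
        correction term; \<open>?q2\<close> collects what has small increments. The latter needs no
        case distinction at index \<open>0\<close> because \<open>R 0 = 0\<close>.\<close>
      let ?q1 = "Abs_fps (\<lambda>l. if l = 0 then 0 else G * \<eta> l / h powr \<alpha> - t l)"
      let ?q2 = "Abs_fps (\<lambda>l. G * R l / h powr \<alpha>)"
      let ?x = "\<lambda>j. Abs_fps (\<lambda>l. if j \<le> l then powr_step \<alpha> (l - j) * (k (grid h l) (midgrid h j) - 1) else 0)"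
      have q: "Abs_fps (\<lambda>l. if l = 0 then 0 else G * (\<eta> l + R l) / h powr \<alpha> - t l) = ?q1 + ?q2"
        by (rule fps_ext) (simp add: R0 ring_distribs add_divide_distrib)
      have "e m = (powr_step_inv \<alpha> * (?q1 + ?q2)) $ m - (\<Sum>j=1..m. e j * (powr_step_inv \<alpha> * ?x j) $ m)"
        unfolding q[symmetric] unfolding G_def t_def
        by (rule scheme_error_representation[OF assms(1) hpos sch m])
      then have em: "\<bar>e m\<bar> \<le> \<bar>(powr_step_inv \<alpha> * ?q1) $ m\<bar> + \<bar>(powr_step_inv \<alpha> * ?q2) $ m\<bar>
          + (\<Sum>j=1..m. \<bar>e j * (powr_step_inv \<alpha> * ?x j) $ m\<bar>)"
        using sum_abs[of "\<lambda>j. e j * (powr_step_inv \<alpha> * ?x j) $ m" "{1..m}"]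
        unfolding distrib_left fps_add_nth by linarith
      have 1: "\<bar>(powr_step_inv \<alpha> * ?q1) $ m\<bar> \<le> 2 * ((G + K * (40 * G)) * B)"
      proof (rule powr_step_inv_conv_bound[OF assms(1,2)])
        fix l assume l: "l \<le> m"
        show "\<bar>?q1 $ l\<bar> \<le> (G + K * (40 * G)) * B"
        proof (cases "l = 0")
          case True
          then show ?thesis using G K B by simp
        next
          case False
          then have l': "l \<in> {1..N}" using l m by simp
          have "\<bar>G * \<eta> l / h powr \<alpha>\<bar> = G * (\<bar>\<eta> l\<bar> / h powr \<alpha>)"
            using G by (simp add: abs_mult abs_divide)
          also have "\<dots> \<le> G * (E / h powr \<alpha>)"
            using bd(1)[OF l'] G by (intro mult_left_mono divide_right_mono) auto
          also have "\<dots> \<le> G * B" using B G by (intro mult_left_mono) auto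
          finally have "\<bar>G * \<eta> l / h powr \<alpha> - t l\<bar> \<le> G * B + K * (40 * G * B)"
            using t[OF l'] by linarith
          then show ?thesis using False by (simp add: algebra_simps)
        qed
      qed
      have "\<bar>(powr_step_inv \<alpha> * ?q2) $ m\<bar> \<le> 2 * a powr (1 - \<alpha>) / \<alpha> * h powr \<alpha> * ((G * D / h powr \<alpha>) / h)"
      proof (rule powr_step_inv_conv_increments[OF assms(1,2) hpos assms(3)])
        have "real m * h \<le> real N * h" using m hpos by (intro mult_right_mono) auto
        then show "real m * h \<le> a" using Nh by simp
        fix l assume "l \<in> {1..m}"
        then have "\<bar>R l - R (l - 1)\<bar> \<le> D" using m bd(2)[of l] by simp
        then have "G * \<bar>R l - R (l - 1)\<bar> / h powr \<alpha> \<le> G * D / h powr \<alpha>"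
          using G by (intro divide_right_mono mult_left_mono) auto
        moreover have "G * R l / h powr \<alpha> - G * R (l - 1) / h powr \<alpha> = G * (R l - R (l - 1)) / h powr \<alpha>"
          by (simp add: right_diff_distrib diff_divide_distrib)
        ultimately show "\<bar>G * R l / h powr \<alpha> - G * R (l - 1) / h powr \<alpha>\<bar> \<le> G * D / h powr \<alpha>"
          using G by (simp add: abs_mult abs_divide)
      qed (use m R0 in auto)
      also have "\<dots> = G * (2 * a powr (1 - \<alpha>) / \<alpha>) * (D / h)" using hpos by simp
      also have "\<dots> \<le> G * (2 * a powr (1 - \<alpha>) / \<alpha>) * B"
        using G assms E hpos by (intro mult_left_mono) (auto simp: B_def)
      finally have 2: "\<bar>(powr_step_inv \<alpha> * ?q2) $ m\<bar> \<le> G * (2 * a powr (1 - \<alpha>) / \<alpha>) * B" .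
      have "\<bar>(powr_step_inv \<alpha> * ?x j) $ m\<bar> \<le> M * h" if j: "j \<in> {1..m}" for j
      proof -
        have "\<bar>(powr_step_inv \<alpha> * ?x j) $ m\<bar> \<le> (19 + 8 / \<alpha>) * (L * h)"
        proof (rule powr_step_inv_conv_kernel[OF assms(1,2)])
          fix l assume l: "j \<le> l" "l \<le> m"
          have "\<bar>k (grid h l) (midgrid h j) - 1\<bar> \<le> L * \<bar>grid h l - midgrid h j\<bar>"
            using in_a l j m by (intro k1) auto
          also have "L * \<bar>grid h l - midgrid h j\<bar> \<le> L * ((real (l - j) + 1) * h)"
          proof (rule mult_left_mono[OF _ assms(4)])
            have "grid h l - midgrid h j = (real (l - j) + 1/2) * h"
              using l by (simp add: grid_def midgrid_def of_nat_diff algebra_simps)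
            moreover have "\<bar>(real (l - j) + 1/2) * h\<bar> = (real (l - j) + 1/2) * h"
              using hpos by (intro abs_of_nonneg) simp
            moreover have "(real (l - j) + 1/2) * h \<le> (real (l - j) + 1) * h"
              using hpos by (intro mult_right_mono) auto
            ultimately show "\<bar>grid h l - midgrid h j\<bar> \<le> (real (l - j) + 1) * h" by simp
          qed
          finally show "\<bar>k (grid h l) (midgrid h j) - 1\<bar> \<le> L * h * (real (l - j) + 1)"
            by (simp add: mult_ac)
        next
          fix l assume l: "j \<le> l" "Suc l \<le> m"
          have "\<bar>k (grid h (Suc l)) (midgrid h j) - k (grid h l) (midgrid h j)\<bar>
              \<le> L * \<bar>grid h (Suc l) - grid h l\<bar>"
            using in_a l j m by (intro lip) auto
          also have "grid h (Suc l) - grid h l = h" by (simp add: grid_def algebra_simps)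
          finally show "\<bar>(k (grid h (Suc l)) (midgrid h j) - 1) - (k (grid h l) (midgrid h j) - 1)\<bar> \<le> L * h"
            using hpos by simp
        qed (use j assms(4) hpos in auto)
        then show ?thesis by (simp add: M_def)
      qed
      then have "(\<Sum>j=1..m. \<bar>e j * (powr_step_inv \<alpha> * ?x j) $ m\<bar>) \<le> (\<Sum>j=1..m. \<bar>e j\<bar> * (M * h))"
        unfolding abs_mult by (intro sum_mono mult_left_mono) auto
      also have "\<dots> = M * h * (\<Sum>j=1..m. \<bar>e j\<bar>)" by (simp add: sum_distrib_left mult.commute)
      finally show ?thesis using em 1 2 by (simp add: C1_def algebra_simps)
    qed
    define z where "z j = (if j = 0 then 0 else \<bar>e j\<bar>)" for j
    have "z n \<le> 2 * C1 * B * (1 + 2 * M * h) ^ n"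
    proof (rule discrete_gronwall[of "2 * M * h" n N])
      fix m assume m: "m \<le> N"
      show "z m \<le> 2 * C1 * B + 2 * M * h * (\<Sum>j<m. z j)"
      proof (cases "m = 0")
        case True
        then show ?thesis using C1 B by (simp add: z_def)
      next
        case False
        have "(\<Sum>j=1..m. \<bar>e j\<bar>) = (\<Sum>j<Suc m. z j)"
          by (intro sum.mono_neutral_cong_left) (auto simp: z_def)
        then have "z m \<le> C1 * B + M * h * ((\<Sum>j<m. z j) + z m)"
          using rec[of m] m False by (simp add: z_def)
        \<comment> \<open>The recursion contains its own left-hand side with factor
          \<open>M * h \<le> 1/2\<close>; moving it over doubles the constants.\<close>
        moreover have "0 \<le> z m" by (simp add: z_def)
        then have "2 * (M * h * z m) \<le> 1 * z m"
          using mult_right_mono[OF Mh, of "z m"] by (simp add: mult_ac)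
        ultimately show ?thesis by (simp add: algebra_simps)
      qed
    qed (use M hpos n in auto)
    also have "\<dots> \<le> 2 * C1 * B * exp (2 * M * a)"
    proof (intro mult_left_mono)
      have "(1 + 2 * M * h) ^ n \<le> exp (2 * M * h) ^ n"
        using M hpos by (intro power_mono exp_ge_add_one_self) auto
      also have "\<dots> = exp (real n * (2 * M * h))" by (simp add: exp_of_nat_mult)
      also have "\<dots> \<le> exp (2 * M * a)"
      proof -
        have "real n * h \<le> real N * h" using n hpos by (intro mult_right_mono) auto
        then have "2 * M * (real n * h) \<le> 2 * M * a" using M Nh by (intro mult_left_mono) auto
        then show ?thesis by (simp add: mult_ac)
      qed
      finally show "(1 + 2 * M * h) ^ n \<le> exp (2 * M * a)" .
    qed (use C1 B in auto)
    finally have "z n \<le> C * B" by (simp add: C_def mult_ac)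
    then show "\<bar>e n\<bar> \<le> C * (E / h powr \<alpha> + D / h)"
      using n by (simp add: z_def B_def)
  qed
qed

section \<open>Quadrature residual\<close>

definition taylor_holder :: "real \<Rightarrow> real \<Rightarrow> real \<Rightarrow> (real \<Rightarrow> real) \<Rightarrow> (real \<Rightarrow> real) \<Rightarrow> bool" where
  "taylor_holder \<gamma> a L \<phi> \<phi>' \<longleftrightarrow> continuous_on {0..a} \<phi> \<and>
     (\<forall>x\<in>{0..a}. \<bar>\<phi> x\<bar> \<le> L \<and> \<bar>\<phi>' x\<bar> \<le> L) \<and>
     (\<forall>x\<in>{0..a}. \<forall>y\<in>{0..a}. \<bar>\<phi>' x - \<phi>' y\<bar> \<le> L * \<bar>x - y\<bar> powr (\<gamma> - 1) \<and>
        \<bar>\<phi> y - \<phi> x - \<phi>' x * (y - x)\<bar> \<le> L * \<bar>x - y\<bar> powr \<gamma>)"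

definition quad_residual :: "real \<Rightarrow> real \<Rightarrow> nat \<Rightarrow> (real \<Rightarrow> real) \<Rightarrow> real" where
  "quad_residual \<alpha> h n \<phi> =
     1 / Gamma \<alpha> * integral {0..grid h n} (\<lambda>y. (grid h n - y) powr (\<alpha> - 1) * \<phi> y)
     - (h powr \<alpha> * (\<Sum>j=1..n. omega_wt \<alpha> (n - j) * \<phi> (midgrid h j))
        + h powr \<alpha> * (\<Sum>j=1..2. corr_wt \<alpha> n j * \<phi> (midgrid h j)))"

section \<open>Integrals of continuous functions against the singular kernel\<close>

text \<open>The kernel may be unbounded, but it is nonnegative and integrable, hence absolutely
  integrable; multiplying by a bounded measurable function preserves this.\<close>

lemma kernel_mult_integrable:
  fixes \<alpha> x p q :: real
  assumes "0 < \<alpha>" "p \<le> q" "q \<le> x" "continuous_on {p..q} r"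
  shows "(\<lambda>y. (x - y) powr (\<alpha> - 1) * r y) integrable_on {p..q}"
proof -
  have "(\<lambda>y. (x - y) powr (\<alpha> - 1)) integrable_on {p..q}"
    using kernel_has_integral[OF assms(1-3)] by blast
  then have "(\<lambda>y. (x - y) powr (\<alpha> - 1)) absolutely_integrable_on {p..q}"
    by (rule nonnegative_absolutely_integrable_1) simp
  moreover have "r \<in> borel_measurable (lebesgue_on {p..q})"
    using assms(4) by (intro continuous_imp_measurable_on_sets_lebesgue) auto
  moreover have "bounded (r ` {p..q})"
    using assms(4) by (intro compact_imp_bounded compact_continuous_image) auto
  ultimately have "(\<lambda>y. r y * (x - y) powr (\<alpha> - 1)) absolutely_integrable_on {p..q}"
    by (intro absolutely_integrable_bounded_measurable_product_real) auto
  then show ?thesis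
    by (simp add: mult.commute set_lebesgue_integral_eq_integral)
qed

lemma abs_integral_le:
  fixes f g :: "real \<Rightarrow> real"
  assumes "(f has_integral I) S" "(g has_integral J) S" "\<And>y. y \<in> S \<Longrightarrow> \<bar>f y\<bar> \<le> g y"
  shows "\<bar>I\<bar> \<le> J"
proof -
  have "I \<le> J" using assms(3) by (intro has_integral_le[OF assms(1,2)]) (auto simp: abs_le_iff)
  moreover have "- I \<le> J" using assms(3)
    by (intro has_integral_le[OF has_integral_neg[OF assms(1)] assms(2)]) (auto simp: abs_le_iff)
  ultimately show ?thesis by auto
qed

lemma kernel_mult_bound:
  fixes \<alpha> x p q \<epsilon> :: real
  assumes "0 < \<alpha>" "p \<le> q" "q \<le> x" "continuous_on {p..q} r" "\<And>y. y \<in> {p..q} \<Longrightarrow> \<bar>r y\<bar> \<le> \<epsilon>"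
  shows "\<bar>\<alpha> * integral {p..q} (\<lambda>y. (x - y) powr (\<alpha> - 1) * r y)\<bar> \<le> \<epsilon> * ((x - p) powr \<alpha> - (x - q) powr \<alpha>)"
proof -
  have "\<bar>integral {p..q} (\<lambda>y. (x - y) powr (\<alpha> - 1) * r y)\<bar> \<le> ((x - p) powr \<alpha> - (x - q) powr \<alpha>) / \<alpha> * \<epsilon>"
  proof (rule abs_integral_le)
    show "((\<lambda>y. (x - y) powr (\<alpha> - 1) * \<epsilon>) has_integral ((x - p) powr \<alpha> - (x - q) powr \<alpha>) / \<alpha> * \<epsilon>) {p..q}"
      by (intro has_integral_mult_left kernel_has_integral assms)
  qed (use assms kernel_mult_integrable[OF assms(1-4)] in \<open>auto simp: abs_mult intro!: mult_left_mono\<close>)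
  then have "\<alpha> * \<bar>integral {p..q} (\<lambda>y. (x - y) powr (\<alpha> - 1) * r y)\<bar> \<le> \<alpha> * (((x - p) powr \<alpha> - (x - q) powr \<alpha>) / \<alpha> * \<epsilon>)"
    using assms(1) by (intro mult_left_mono) auto
  then show ?thesis using assms(1) by (simp add: abs_mult mult.commute)
qed

text \<open>At \<open>y = x\<close> the kernel takes the junk value \<open>0 powr (\<alpha> - 1) = 0\<close>, so the pointwise bound
  has to be modified at the right endpoint.\<close>

lemma kernel_diff_mult_bound:
  fixes \<alpha> x x' p q \<epsilon> :: real
  assumes "0 < \<alpha>" "\<alpha> < 1" "p \<le> q" "q \<le> x" "x \<le> x'" "continuous_on {p..q} r"
    and "\<And>y. y \<in> {p..q} \<Longrightarrow> \<bar>r y\<bar> \<le> \<epsilon>"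
  shows "\<bar>\<alpha> * integral {p..q} (\<lambda>y. (x' - y) powr (\<alpha> - 1) * r y)
      - \<alpha> * integral {p..q} (\<lambda>y. (x - y) powr (\<alpha> - 1) * r y)\<bar>
    \<le> \<epsilon> * (((x - p) powr \<alpha> - (x - q) powr \<alpha>) - ((x' - p) powr \<alpha> - (x' - q) powr \<alpha>))"
    (is "\<bar>\<alpha> * ?I' - \<alpha> * ?I\<bar> \<le> \<epsilon> * (?J - ?J')")
proof -
  define d where "d y = (x' - y) powr (\<alpha> - 1) * r y - (x - y) powr (\<alpha> - 1) * r y" for y
  \<comment> \<open>The kernel decreases when \<open>x\<close> moves to \<open>x'\<close>, so the
    dominating function integrates to a difference of cell weights, which telescopes over the cells
    later.\<close>
  define b where "b y = ((x - y) powr (\<alpha> - 1) - (x' - y) powr (\<alpha> - 1)) * \<epsilon>" for y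
  have "\<bar>?I' - ?I\<bar> \<le> (?J / \<alpha> - ?J' / \<alpha>) * \<epsilon>"
  proof (rule abs_integral_le)
    show "(d has_integral (?I' - ?I)) {p..q}"
      unfolding d_def using assms
      by (intro has_integral_diff integrable_integral kernel_mult_integrable) auto
    have "(b has_integral (?J / \<alpha> - ?J' / \<alpha>) * \<epsilon>) {p..q}"
      unfolding b_def using assms
      by (intro has_integral_mult_left has_integral_diff kernel_has_integral) auto
    then show "((\<lambda>y. if y = q then \<bar>d q\<bar> else b y) has_integral (?J / \<alpha> - ?J' / \<alpha>) * \<epsilon>) {p..q}"
      by (rule has_integral_spike_finite[of "{q}", rotated 2]) auto
    show "\<bar>d y\<bar> \<le> (if y = q then \<bar>d q\<bar> else b y)" if "y \<in> {p..q}" for y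
    proof (cases "y = q")
      case False
      then have y: "0 < x - y" using that assms by auto
      have le: "(x' - y) powr (\<alpha> - 1) \<le> (x - y) powr (\<alpha> - 1)"
        using y assms by (intro powr_mono2') auto
      have "\<bar>d y\<bar> = \<bar>(x' - y) powr (\<alpha> - 1) - (x - y) powr (\<alpha> - 1)\<bar> * \<bar>r y\<bar>"
        by (simp add: d_def abs_mult[symmetric] left_diff_distrib)
      also have "\<dots> \<le> \<bar>(x' - y) powr (\<alpha> - 1) - (x - y) powr (\<alpha> - 1)\<bar> * \<epsilon>"
        using assms(7)[OF that] by (intro mult_left_mono) auto
      also have "\<dots> = b y" using le by (simp add: b_def)
      finally show ?thesis using False by simp
    qed simp
  qed
  then have "\<alpha> * \<bar>?I' - ?I\<bar> \<le> \<alpha> * ((?J / \<alpha> - ?J' / \<alpha>) * \<epsilon>)"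
    using assms(1) by (intro mult_left_mono) auto
  also have "\<dots> = \<epsilon> * (?J - ?J')" using assms(1) by (simp add: diff_divide_distrib[symmetric])
  also have "\<alpha> * \<bar>?I' - ?I\<bar> = \<bar>\<alpha> * ?I' - \<alpha> * ?I\<bar>"
    using assms(1) by (simp add: abs_mult right_diff_distrib[symmetric])
  finally show ?thesis .
qed

section \<open>Decomposition of the residual over the grid cells\<close>

text \<open>Cells are numbered from \<open>0\<close> and midpoints from \<open>1\<close>, so the
  midpoint of \<open>cell h i\<close> is \<open>midgrid h (Suc i)\<close>.\<close>

definition cell :: "real \<Rightarrow> nat \<Rightarrow> real set" where
  "cell h i = {grid h i..grid h (Suc i)}"

definition taylor_rem :: "real \<Rightarrow> (real \<Rightarrow> real) \<Rightarrow> (real \<Rightarrow> real) \<Rightarrow> nat \<Rightarrow> real \<Rightarrow> real" where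
  "taylor_rem h \<phi> \<phi>' i y = \<phi> y - \<phi> (midgrid h (Suc i)) - \<phi>' (midgrid h (Suc i)) * (y - midgrid h (Suc i))"

text \<open>The factor \<open>\<alpha>\<close> fits the scaling by
  \<open>Gamma (\<alpha> + 1) = \<alpha> * Gamma \<alpha>\<close>, under which the residual is
  expanded.\<close>

definition rem_integral :: "real \<Rightarrow> real \<Rightarrow> (real \<Rightarrow> real) \<Rightarrow> (real \<Rightarrow> real) \<Rightarrow> nat \<Rightarrow> nat \<Rightarrow> real" where
  "rem_integral \<alpha> h \<phi> \<phi>' n i =
     \<alpha> * integral (cell h i) (\<lambda>y. (grid h n - y) powr (\<alpha> - 1) * taylor_rem h \<phi> \<phi>' i y)"

lemma grid_powr_diff:
  assumes "0 < h" "i < n"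
  shows "(grid h n - grid h i) powr \<alpha> - (grid h n - grid h (Suc i)) powr \<alpha> = h powr \<alpha> * powr_step \<alpha> (n - Suc i)"
proof -
  obtain m where n: "n = Suc (i + m)" using less_imp_Suc_add[OF assms(2)] by blast
  have "grid h n - grid h i = h * (real m + 1)" "grid h n - grid h (Suc i) = h * real m"
    by (auto simp: grid_def n algebra_simps)
  then show ?thesis using assms(1) by (simp add: powr_step_def powr_mult right_diff_distrib n)
qed

lemma cell_subset:
  assumes "0 < h" "real n * h \<le> a" "i < n"
  shows "cell h i \<subseteq> {0..a}"
proof -
  have "real (Suc i) * h \<le> real n * h" using assms by (intro mult_right_mono) auto
  moreover have "0 \<le> real i * h" using assms by simp
  ultimately show ?thesis using assms(2) by (auto simp: cell_def grid_def)
qed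

lemma cell_midgrid:
  assumes "0 < h"
  shows "midgrid h (Suc i) \<in> cell h i" "y \<in> cell h i \<Longrightarrow> \<bar>midgrid h (Suc i) - y\<bar> \<le> h"
  using assms by (auto simp: cell_def grid_def midgrid_def algebra_simps abs_if)

text \<open>The expansion about the midpoint splits the integral into the zeroth moment, which is
  the quadrature weight, the first moment, which is \<tau>, and the remainder.\<close>

lemma cell_integral:
  assumes "0 < \<alpha>" "0 < h" "real n * h \<le> a" "i < n" "continuous_on {0..a} \<phi>"
  shows "\<alpha> * integral (cell h i) (\<lambda>y. (grid h n - y) powr (\<alpha> - 1) * \<phi> y)
    = h powr \<alpha> * powr_step \<alpha> (n - Suc i) * \<phi> (midgrid h (Suc i))
      + h powr (\<alpha> + 1) * scaled_tau \<alpha> (n - Suc i) * \<phi>' (midgrid h (Suc i)) + rem_integral \<alpha> h \<phi> \<phi>' n i"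
proof -
  let ?K = "\<lambda>y. (grid h n - y) powr (\<alpha> - 1)" and ?c = "midgrid h (Suc i)"
  have sub: "cell h i \<subseteq> {0..a}" using cell_subset[OF assms(2-4)] .
  have le: "grid h i \<le> grid h (Suc i)" "grid h (Suc i) \<le> grid h n"
    using assms by (auto simp: grid_def intro!: mult_right_mono)
  have K: "(?K has_integral h powr \<alpha> * powr_step \<alpha> (n - Suc i) / \<alpha>) (cell h i)"
    unfolding grid_powr_diff[OF assms(2,4), symmetric] cell_def
    by (rule kernel_has_integral[OF assms(1) le])
  have lin: "((\<lambda>y. ?K y * (y - ?c)) has_integral h powr (\<alpha> + 1) * scaled_tau \<alpha> (n - Suc i) / \<alpha>) (cell h i)"
  proof -
    have "?c + (real (n - Suc i) + 1/2) * h = grid h n" "?c - h/2 = grid h i" "?c + h/2 = grid h (Suc i)"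
      using assms(4) by (auto simp: midgrid_def grid_def of_nat_diff algebra_simps)
    then show ?thesis
      using kernel_linear_has_integral_scaled_tau[OF assms(1,2), where c="?c" and m="n - Suc i"] by (simp add: cell_def)
  qed
  have "continuous_on (cell h i) (taylor_rem h \<phi> \<phi>' i)"
    unfolding taylor_rem_def[abs_def]
    by (intro continuous_intros continuous_on_subset[OF assms(5) sub])
  then have "((\<lambda>y. ?K y * taylor_rem h \<phi> \<phi>' i y) has_integral rem_integral \<alpha> h \<phi> \<phi>' n i / \<alpha>) (cell h i)"
    unfolding rem_integral_def using assms(1) kernel_mult_integrable[OF assms(1) le]
    by (simp add: cell_def integrable_integral)
  from has_integral_add[OF has_integral_add[OF has_integral_mult_left[OF K, of "\<phi> ?c"]
        has_integral_mult_left[OF lin, of "\<phi>' ?c"]] this]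
  have "((\<lambda>y. ?K y * \<phi> y) has_integral (h powr \<alpha> * powr_step \<alpha> (n - Suc i) / \<alpha> * \<phi> ?c
      + h powr (\<alpha> + 1) * scaled_tau \<alpha> (n - Suc i) / \<alpha> * \<phi>' ?c + rem_integral \<alpha> h \<phi> \<phi>' n i / \<alpha>)) (cell h i)"
    by (rule has_integral_eq[rotated]) (simp add: taylor_rem_def algebra_simps)
  then show ?thesis using assms(1) by (simp add: integral_unique ring_distribs)
qed

lemma integral_sum_cells:
  fixes f :: "real \<Rightarrow> real"
  assumes "0 < h" "f integrable_on {0..grid h n}"
  shows "integral {0..grid h n} f = (\<Sum>i<n. integral (cell h i) f)"
  using assms(2)
proof (induction n)
  case 0
  then show ?case by (simp add: grid_def)
next
  case (Suc n)
  have le: "0 \<le> grid h n" "grid h n \<le> grid h (Suc n)" using assms(1) by (auto simp: grid_def)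
  have "f integrable_on {0..grid h n}"
    by (rule integrable_on_subinterval[OF Suc.prems]) (use le in auto)
  then show ?case
    using Suc Henstock_Kurzweil_Integration.integral_combine[OF le Suc.prems] by (simp add: cell_def)
qed

text \<open>Summed over the cells, the zeroth moments cancel the midpoint sum. The correction
  weights multiply \<open>\<phi> (midgrid h 2) - \<phi> (midgrid h 1)\<close>, which is
  \<open>h * \<phi>' (midgrid h 1)\<close> up to a remainder. The main part is what subtracts the
  slope at the first midpoint from all slopes; the remainder is the last term.\<close>

lemma quad_residual_eq:
  assumes "0 < \<alpha>" "0 < h" "real n * h \<le> a" "continuous_on {0..a} \<phi>"
  shows "Gamma (\<alpha> + 1) * quad_residual \<alpha> h n \<phi> =
     h powr (\<alpha> + 1) * (\<Sum>i<n. scaled_tau \<alpha> (n - Suc i) * (\<phi>' (midgrid h (Suc i)) - \<phi>' (midgrid h 1)))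
     + (\<Sum>i<n. rem_integral \<alpha> h \<phi> \<phi>' n i)
     - h powr \<alpha> * (\<Sum>i<n. scaled_tau \<alpha> i) * (\<phi> (midgrid h 2) - \<phi> (midgrid h 1) - h * \<phi>' (midgrid h 1))"
proof -
  let ?I = "integral {0..grid h n} (\<lambda>y. (grid h n - y) powr (\<alpha> - 1) * \<phi> y)"
  have G: "Gamma (\<alpha> + 1) = \<alpha> * Gamma \<alpha>" "Gamma \<alpha> \<noteq> 0"
    using assms(1) Gamma_plus1[of \<alpha>] less_imp_neq[OF Gamma_real_pos[of \<alpha>]]
    by (auto simp: nonpos_Ints_def)
  have "grid h n \<le> a" "0 \<le> grid h n" using assms(2,3) by (auto simp: grid_def)
  then have "(\<lambda>y. (grid h n - y) powr (\<alpha> - 1) * \<phi> y) integrable_on {0..grid h n}"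
    using assms(1) by (intro kernel_mult_integrable continuous_on_subset[OF assms(4)]) auto
  then have "\<alpha> * ?I = (\<Sum>i<n. \<alpha> * integral (cell h i) (\<lambda>y. (grid h n - y) powr (\<alpha> - 1) * \<phi> y))"
    using assms(2) by (simp add: integral_sum_cells sum_distrib_left)
  also have "\<dots> = (\<Sum>i<n. h powr \<alpha> * powr_step \<alpha> (n - Suc i) * \<phi> (midgrid h (Suc i))
      + h powr (\<alpha> + 1) * scaled_tau \<alpha> (n - Suc i) * \<phi>' (midgrid h (Suc i)) + rem_integral \<alpha> h \<phi> \<phi>' n i)"
    using assms by (intro sum.cong cell_integral) auto
  also have "\<dots> = h powr \<alpha> * (\<Sum>i<n. powr_step \<alpha> (n - Suc i) * \<phi> (midgrid h (Suc i)))
      + h powr (\<alpha> + 1) * (\<Sum>i<n. scaled_tau \<alpha> (n - Suc i) * \<phi>' (midgrid h (Suc i)))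
      + (\<Sum>i<n. rem_integral \<alpha> h \<phi> \<phi>' n i)"
    by (simp add: sum.distrib sum_distrib_left mult.assoc)
  finally have I: "\<alpha> * ?I = \<dots>" .
  have powr_step: "Gamma (\<alpha> + 1) * (\<Sum>j=1..n. omega_wt \<alpha> (n - j) * \<phi> (midgrid h j))
      = (\<Sum>i<n. powr_step \<alpha> (n - Suc i) * \<phi> (midgrid h (Suc i)))"
    unfolding sum_distrib_left One_nat_def sum.atLeast1_atMost_eq
    using G assms(1) by (intro sum.cong) (auto simp: omega_wt_def powr_step_def simp del: of_nat_diff)
  have "{1..2::nat} = {1, 2}" by auto
  then have corr: "Gamma (\<alpha> + 1) * (\<Sum>j=1..2. corr_wt \<alpha> n j * \<phi> (midgrid h j))
      = (\<Sum>i<n. scaled_tau \<alpha> i) * (\<phi> (midgrid h 2) - \<phi> (midgrid h 1))"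
    using sum_distrib_left[of "Gamma (\<alpha> + 1)" "tau \<alpha>" "{..<n}", symmetric]
    by (simp add: corr_wt_def scaled_tau_def[abs_def] algebra_simps)
  have "Gamma (\<alpha> + 1) * quad_residual \<alpha> h n \<phi> = \<alpha> * ?I
     - h powr \<alpha> * (Gamma (\<alpha> + 1) * (\<Sum>j=1..n. omega_wt \<alpha> (n - j) * \<phi> (midgrid h j)))
     - h powr \<alpha> * (Gamma (\<alpha> + 1) * (\<Sum>j=1..2. corr_wt \<alpha> n j * \<phi> (midgrid h j)))"
    using G by (simp add: quad_residual_def algebra_simps)
  moreover have d: "(\<Sum>i<n. scaled_tau \<alpha> (n - Suc i) * (\<phi>' (midgrid h (Suc i)) - \<phi>' (midgrid h 1)))
     = (\<Sum>i<n. scaled_tau \<alpha> (n - Suc i) * \<phi>' (midgrid h (Suc i))) - (\<Sum>i<n. scaled_tau \<alpha> i) * \<phi>' (midgrid h 1)"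
    using sum.nat_diff_reindex[of "scaled_tau \<alpha>" n]
    by (simp add: right_diff_distrib sum_subtractf flip: sum_distrib_right)
  moreover have "h powr (\<alpha> + 1) = h powr \<alpha> * h" using assms(2) by (simp add: powr_add)
  ultimately show ?thesis unfolding powr_step corr I d by (simp add: algebra_simps)
qed

section \<open>Size of the residual and of its increments\<close>

lemma taylor_holder_nonneg: "taylor_holder \<gamma> a L \<phi> \<phi>' \<Longrightarrow> 0 \<le> a \<Longrightarrow> 0 \<le> L"
  unfolding taylor_holder_def by (metis abs_ge_zero atLeastAtMost_iff order_refl order_trans)

lemma taylor_holder_cont: "taylor_holder \<gamma> a L \<phi> \<phi>' \<Longrightarrow> continuous_on {0..a} \<phi>"
  by (simp add: taylor_holder_def)

lemma taylor_holderD: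
  assumes "taylor_holder \<gamma> a L \<phi> \<phi>'" "x \<in> {0..a}"
  shows "\<bar>\<phi> x\<bar> \<le> L" "\<bar>\<phi>' x\<bar> \<le> L"
    "y \<in> {0..a} \<Longrightarrow> \<bar>\<phi>' x - \<phi>' y\<bar> \<le> L * \<bar>x - y\<bar> powr (\<gamma> - 1)"
    "y \<in> {0..a} \<Longrightarrow> \<bar>\<phi> y - \<phi> x - \<phi>' x * (y - x)\<bar> \<le> L * \<bar>x - y\<bar> powr \<gamma>"
  using assms by (auto simp: taylor_holder_def)

lemma taylor_holder_remainder:
  assumes "taylor_holder \<gamma> a L \<phi> \<phi>'" "0 < \<gamma>" "x \<in> {0..a}" "y \<in> {0..a}" "\<bar>x - y\<bar> \<le> h"
  shows "\<bar>\<phi> y - \<phi> x - \<phi>' x * (y - x)\<bar> \<le> L * h powr \<gamma>"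
proof -
  have "0 \<le> L" using taylor_holder_nonneg[OF assms(1)] assms(3) by auto
  have "\<bar>\<phi> y - \<phi> x - \<phi>' x * (y - x)\<bar> \<le> L * \<bar>x - y\<bar> powr \<gamma>"
    using taylor_holderD(4)[OF assms(1,3,4)] .
  also have "\<dots> \<le> L * h powr \<gamma>"
    using assms \<open>0 \<le> L\<close> by (intro mult_left_mono powr_mono2) auto
  finally show ?thesis .
qed

lemma continuous_on_taylor_rem:
  assumes "continuous_on {0..a} \<phi>" "0 < h" "real n * h \<le> a" "i < n"
  shows "continuous_on (cell h i) (taylor_rem h \<phi> \<phi>' i)"
  unfolding taylor_rem_def[abs_def]
  by (intro continuous_intros continuous_on_subset[OF assms(1) cell_subset[OF assms(2-4)]])

lemma taylor_rem_bound:
  assumes "taylor_holder \<gamma> a L \<phi> \<phi>'" "0 < \<gamma>" "0 < h" "real n * h \<le> a" "i < n" "y \<in> cell h i"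
  shows "\<bar>taylor_rem h \<phi> \<phi>' i y\<bar> \<le> L * h powr \<gamma>"
  unfolding taylor_rem_def
  using cell_subset[OF assms(3-5)] cell_midgrid[OF assms(3), where i=i] assms(6)
  by (intro taylor_holder_remainder[OF assms(1,2)]) auto

lemma rem_integral_bound:
  assumes "0 < \<alpha>" "taylor_holder \<gamma> a L \<phi> \<phi>'" "0 < \<gamma>" "0 < h" "real n * h \<le> a" "i < n"
  shows "\<bar>rem_integral \<alpha> h \<phi> \<phi>' n i\<bar> \<le> L * h powr \<gamma> * (h powr \<alpha> * powr_step \<alpha> (n - Suc i))"
  unfolding rem_integral_def grid_powr_diff[OF assms(4,6), symmetric] cell_def
proof (rule kernel_mult_bound[OF assms(1)])
  show "continuous_on {grid h i..grid h (Suc i)} (taylor_rem h \<phi> \<phi>' i)"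
    using continuous_on_taylor_rem[OF taylor_holder_cont[OF assms(2)] assms(4-6)] by (simp add: cell_def)
  show "\<bar>taylor_rem h \<phi> \<phi>' i y\<bar> \<le> L * h powr \<gamma>" if "y \<in> {grid h i..grid h (Suc i)}" for y
    using taylor_rem_bound[OF assms(2-6)] that by (simp add: cell_def)
qed (use assms in \<open>auto simp: grid_def intro!: mult_right_mono\<close>)

text \<open>Consecutive rows integrate the same remainder over the same cell; only the kernel
  changes, and it changes monotonically. The bound is a difference of weights and telescopes in
  \<open>i\<close>.\<close>

lemma rem_integral_diff_bound:
  assumes "0 < \<alpha>" "\<alpha> < 1" "taylor_holder \<gamma> a L \<phi> \<phi>'" "0 < \<gamma>" "0 < h" "real (Suc n) * h \<le> a" "i < n"
  shows "\<bar>rem_integral \<alpha> h \<phi> \<phi>' (Suc n) i - rem_integral \<alpha> h \<phi> \<phi>' n i\<bar>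
    \<le> L * h powr \<gamma> * (h powr \<alpha> * powr_step \<alpha> (n - Suc i) - h powr \<alpha> * powr_step \<alpha> (n - i))"
proof -
  have i: "i < Suc n" using assms(7) by simp
  have "(grid h (Suc n) - grid h i) powr \<alpha> - (grid h (Suc n) - grid h (Suc i)) powr \<alpha> = h powr \<alpha> * powr_step \<alpha> (n - i)"
    using grid_powr_diff[OF assms(5) i] by simp
  then show ?thesis
    unfolding rem_integral_def grid_powr_diff[OF assms(5,7), symmetric] cell_def
  proof (elim subst, intro kernel_diff_mult_bound[OF assms(1,2)])
    show "continuous_on {grid h i..grid h (Suc i)} (taylor_rem h \<phi> \<phi>' i)"
      using continuous_on_taylor_rem[OF taylor_holder_cont[OF assms(3)] assms(5,6) i] by (simp add: cell_def)
    show "\<bar>taylor_rem h \<phi> \<phi>' i y\<bar> \<le> L * h powr \<gamma>" if "y \<in> {grid h i..grid h (Suc i)}" for y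
      using taylor_rem_bound[OF assms(3-6) i] that by (simp add: cell_def)
  qed (use assms in \<open>auto simp: grid_def intro!: mult_right_mono\<close>)
qed

lemma midgrid_in:
  assumes "0 < h" "real n * h \<le> a" "i < n"
  shows "midgrid h (Suc i) \<in> {0..a}"
  by (rule subsetD[OF cell_subset[OF assms] cell_midgrid(1)[OF assms(1)]])

lemma first_midgrid_remainder:
  assumes "taylor_holder \<gamma> a L \<phi> \<phi>'" "0 < \<gamma>" "0 < h" "2 * h \<le> a"
  shows "\<bar>\<phi> (midgrid h 2) - \<phi> (midgrid h 1) - h * \<phi>' (midgrid h 1)\<bar> \<le> L * h powr \<gamma>"
proof -
  have "\<bar>\<phi> (midgrid h 2) - \<phi> (midgrid h 1) - \<phi>' (midgrid h 1) * (midgrid h 2 - midgrid h 1)\<bar> \<le> L * h powr \<gamma>"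
    using assms(3,4) by (intro taylor_holder_remainder[OF assms(1,2)]) (auto simp: midgrid_def)
  moreover have "midgrid h 2 - midgrid h 1 = h" by (simp add: midgrid_def)
  ultimately show ?thesis by (simp add: mult.commute)
qed

text \<open>The \<tau> weights have total mass at most \<open>1\<close> and slopes differ by at most
  \<open>2 * L\<close>, which gives the \<open>h powr (\<alpha> + 1)\<close> term. The remainder
  integrals are summed against weights of total
  \<open>(n * h) powr \<alpha> \<le> a powr \<alpha>\<close>, and the correction remainder adds one
  more \<open>h powr \<gamma>\<close>.\<close>

lemma quad_residual_bound:
  assumes "0 < \<alpha>" "\<alpha> < 1" "taylor_holder \<gamma> a L \<phi> \<phi>'" "0 < \<gamma>" "0 < h" "h \<le> 1"
    "real n * h \<le> a" "2 * h \<le> a"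
  shows "\<bar>Gamma (\<alpha> + 1) * quad_residual \<alpha> h n \<phi>\<bar> \<le> L * (2 * h powr (\<alpha> + 1) + (a powr \<alpha> + 1) * h powr \<gamma>)"
proof -
  have a: "0 \<le> a" using assms by linarith
  have L: "0 \<le> L" using taylor_holder_nonneg[OF assms(3) a] .
  define S1 where "S1 = (\<Sum>i<n. scaled_tau \<alpha> (n - Suc i) * (\<phi>' (midgrid h (Suc i)) - \<phi>' (midgrid h 1)))"
  define S2 where "S2 = (\<Sum>i<n. rem_integral \<alpha> h \<phi> \<phi>' n i)"
  define r where "r = \<phi> (midgrid h 2) - \<phi> (midgrid h 1) - h * \<phi>' (midgrid h 1)"
  have scaled_tau: "0 \<le> (\<Sum>i<n. scaled_tau \<alpha> i)" "(\<Sum>i<n. scaled_tau \<alpha> i) \<le> 1"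
    using scaled_tau_nonneg[OF assms(1,2)] sum_scaled_tau_le_1[OF assms(1,2)] by (auto intro: sum_nonneg)
  have "\<bar>S1\<bar> \<le> (\<Sum>i<n. scaled_tau \<alpha> (n - Suc i) * (2 * L))"
    unfolding S1_def
  proof (rule order_trans[OF sum_abs sum_mono])
    fix i assume i: "i \<in> {..<n}"
    have "\<bar>\<phi>' (midgrid h (Suc i))\<bar> \<le> L"
      using i by (intro taylor_holderD(2)[OF assms(3)] midgrid_in[OF assms(5,7)]) auto
    moreover have "\<bar>\<phi>' (midgrid h 1)\<bar> \<le> L"
      using assms(5,8) by (intro taylor_holderD(2)[OF assms(3)]) (auto simp: midgrid_def)
    ultimately show "\<bar>scaled_tau \<alpha> (n - Suc i) * (\<phi>' (midgrid h (Suc i)) - \<phi>' (midgrid h 1))\<bar> \<le> scaled_tau \<alpha> (n - Suc i) * (2 * L)"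
      using scaled_tau_nonneg[OF assms(1,2)] unfolding abs_mult by (intro mult_mono) auto
  qed
  also have "\<dots> = (\<Sum>i<n. scaled_tau \<alpha> i) * (2 * L)"
    by (simp only: sum_distrib_right[symmetric] sum.nat_diff_reindex)
  also have "\<dots> \<le> 2 * L" using scaled_tau L by (simp add: mult_left_le_one_le)
  finally have S1: "\<bar>h powr (\<alpha> + 1) * S1\<bar> \<le> h powr (\<alpha> + 1) * (2 * L)"
    unfolding abs_mult by (intro mult_mono) auto
  have "\<bar>S2\<bar> \<le> (\<Sum>i<n. L * h powr \<gamma> * (h powr \<alpha> * powr_step \<alpha> (n - Suc i)))"
    unfolding S2_def using assms
    by (intro order_trans[OF sum_abs sum_mono] rem_integral_bound) auto
  also have "\<dots> = L * h powr \<gamma> * (h powr \<alpha> * (\<Sum>i<n. powr_step \<alpha> (n - Suc i)))"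
    by (simp only: sum_distrib_left)
  also have "(\<Sum>i<n. powr_step \<alpha> (n - Suc i)) = real n powr \<alpha>"
    by (simp only: sum.nat_diff_reindex sum_powr_step)
  also have "h powr \<alpha> * real n powr \<alpha> = (real n * h) powr \<alpha>"
    using assms(5) by (simp add: powr_mult mult.commute)
  also have "L * h powr \<gamma> * (real n * h) powr \<alpha> \<le> L * h powr \<gamma> * a powr \<alpha>"
    using L assms by (intro mult_left_mono powr_mono2) auto
  finally have S2: "\<bar>S2\<bar> \<le> L * h powr \<gamma> * a powr \<alpha>" .
  have "\<bar>h powr \<alpha> * (\<Sum>i<n. scaled_tau \<alpha> i) * r\<bar> \<le> 1 * 1 * (L * h powr \<gamma>)"
    unfolding abs_mult
  proof (intro mult_mono)
    show "\<bar>h powr \<alpha>\<bar> \<le> 1" using powr_le1[of \<alpha> h] assms by simp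
    show "\<bar>r\<bar> \<le> L * h powr \<gamma>" unfolding r_def by (rule first_midgrid_remainder[OF assms(3-5,8)])
  qed (use scaled_tau in auto)
  then have "\<bar>h powr (\<alpha> + 1) * S1 + S2 - h powr \<alpha> * (\<Sum>i<n. scaled_tau \<alpha> i) * r\<bar>
      \<le> h powr (\<alpha> + 1) * (2 * L) + L * h powr \<gamma> * a powr \<alpha> + L * h powr \<gamma>"
    using S1 S2 by linarith
  then show ?thesis
    unfolding quad_residual_eq[OF assms(1,5,7) taylor_holder_cont[OF assms(3)], of \<phi>']
      S1_def[symmetric] S2_def[symmetric] r_def[symmetric]
    by (simp add: algebra_simps)
qed

text \<open>Differencing in \<open>n\<close> turns slopes into increments of slopes and kernels into
  telescoping kernel differences. The three parts of the residual contribute \<open>1\<close>,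
  \<open>2\<close> and \<open>1\<close> to the constant \<open>4\<close>.\<close>

lemma quad_residual_diff_bound:
  assumes "0 < \<alpha>" "\<alpha> < 1" "taylor_holder \<gamma> a L \<phi> \<phi>'" "0 < \<gamma>" "0 < h"
    "real (Suc n) * h \<le> a" "2 * h \<le> a"
  shows "\<bar>Gamma (\<alpha> + 1) * (quad_residual \<alpha> h (Suc n) \<phi> - quad_residual \<alpha> h n \<phi>)\<bar> \<le> 4 * L * h powr (\<gamma> + \<alpha>)"
proof -
  have a: "0 \<le> a" using assms by linarith
  have L: "0 \<le> L" using taylor_holder_nonneg[OF assms(3) a] .
  have nh: "real n * h \<le> a" using assms(5,6) by (simp add: distrib_right)
  define d where "d i = \<phi>' (midgrid h (Suc i))" for i
  define T1 where "T1 = (\<Sum>i<Suc n. scaled_tau \<alpha> (Suc n - Suc i) * (d i - d 0)) - (\<Sum>i<n. scaled_tau \<alpha> (n - Suc i) * (d i - d 0))"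
  define T2 where "T2 = (\<Sum>i<Suc n. rem_integral \<alpha> h \<phi> \<phi>' (Suc n) i) - (\<Sum>i<n. rem_integral \<alpha> h \<phi> \<phi>' n i)"
  define r where "r = \<phi> (midgrid h 2) - \<phi> (midgrid h 1) - h * \<phi>' (midgrid h 1)"
  have scaled_tau: "0 \<le> (\<Sum>i<n. scaled_tau \<alpha> i)" "(\<Sum>i<n. scaled_tau \<alpha> i) \<le> 1" "(\<Sum>i<Suc n. scaled_tau \<alpha> i) \<le> 1"
    using scaled_tau_nonneg[OF assms(1,2)] sum_scaled_tau_le_1[OF assms(1,2)] by (auto intro: sum_nonneg simp del: sum.lessThan_Suc)
  \<comment> \<open>Terms with equal \<tau> index are paired. The longer sum has one extra term, at
    \<open>i = 0\<close>, and it vanishes because the slope at the first midpoint has been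
    subtracted.\<close>
  have "T1 = (\<Sum>i<n. scaled_tau \<alpha> (n - Suc i) * (d (Suc i) - d i))"
    unfolding T1_def sum.lessThan_Suc_shift
    by (simp add: sum_subtractf[symmetric] right_diff_distrib)
  also have "\<bar>\<dots>\<bar> \<le> (\<Sum>i<n. scaled_tau \<alpha> (n - Suc i) * (L * h powr (\<gamma> - 1)))"
  proof (rule order_trans[OF sum_abs sum_mono])
    fix i assume i: "i \<in> {..<n}"
    have "\<bar>d (Suc i) - d i\<bar> \<le> L * \<bar>midgrid h (Suc (Suc i)) - midgrid h (Suc i)\<bar> powr (\<gamma> - 1)"
      unfolding d_def using i by (intro taylor_holderD(3)[OF assms(3)] midgrid_in[OF assms(5,6)]) auto
    also have "midgrid h (Suc (Suc i)) - midgrid h (Suc i) = h" by (simp add: midgrid_def algebra_simps)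
    finally show "\<bar>scaled_tau \<alpha> (n - Suc i) * (d (Suc i) - d i)\<bar> \<le> scaled_tau \<alpha> (n - Suc i) * (L * h powr (\<gamma> - 1))"
      using scaled_tau_nonneg[OF assms(1,2)] assms(5) unfolding abs_mult by (intro mult_mono) auto
  qed
  also have "\<dots> = (\<Sum>i<n. scaled_tau \<alpha> i) * (L * h powr (\<gamma> - 1))"
    by (simp only: sum_distrib_right[symmetric] sum.nat_diff_reindex)
  also have "\<dots> \<le> L * h powr (\<gamma> - 1)" using scaled_tau L by (simp add: mult_left_le_one_le)
  finally have "\<bar>h powr (\<alpha> + 1) * T1\<bar> \<le> h powr (\<alpha> + 1) * (L * h powr (\<gamma> - 1))"
    unfolding abs_mult by (intro mult_mono) auto
  also have "\<dots> = L * (h powr (\<alpha> + 1) * h powr (\<gamma> - 1))" by (simp add: mult_ac)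
  also have "h powr (\<alpha> + 1) * h powr (\<gamma> - 1) = h powr (\<gamma> + \<alpha>)"
    by (simp add: add.commute flip: powr_add)
  finally have T1: "\<bar>h powr (\<alpha> + 1) * T1\<bar> \<le> L * h powr (\<gamma> + \<alpha>)" .
  have tele: "(\<Sum>i<n. L * h powr \<gamma> * (h powr \<alpha> * powr_step \<alpha> (n - Suc i) - h powr \<alpha> * powr_step \<alpha> (n - i)))
      = L * h powr \<gamma> * h powr \<alpha> * (1 - powr_step \<alpha> n)"
  proof -
    have "(\<Sum>i<n. L * h powr \<gamma> * (h powr \<alpha> * powr_step \<alpha> (n - Suc i) - h powr \<alpha> * powr_step \<alpha> (n - i)))
        = (\<Sum>i<n. L * h powr \<gamma> * h powr \<alpha> * (powr_step \<alpha> (n - Suc i) - powr_step \<alpha> (Suc (n - Suc i))))"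
      by (intro sum.cong) (auto simp: right_diff_distrib mult.assoc Suc_diff_Suc)
    also have "\<dots> = (\<Sum>i<n. L * h powr \<gamma> * h powr \<alpha> * (powr_step \<alpha> i - powr_step \<alpha> (Suc i)))"
      by (rule sum.nat_diff_reindex)
    also have "\<dots> = L * h powr \<gamma> * h powr \<alpha> * (1 - powr_step \<alpha> n)"
      by (simp add: sum_distrib_left[symmetric] sum_lessThan_telescope')
    finally show ?thesis .
  qed
  have T2_split: "T2 = (\<Sum>i<n. rem_integral \<alpha> h \<phi> \<phi>' (Suc n) i - rem_integral \<alpha> h \<phi> \<phi>' n i)
      + rem_integral \<alpha> h \<phi> \<phi>' (Suc n) n"
    by (simp add: T2_def sum_subtractf)
  \<comment> \<open>The old cells contribute a telescoping sum and the new last cell one full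
    weight, together at most \<open>2\<close>.\<close>
  have "\<bar>\<Sum>i<n. rem_integral \<alpha> h \<phi> \<phi>' (Suc n) i - rem_integral \<alpha> h \<phi> \<phi>' n i\<bar>
      \<le> L * h powr \<gamma> * h powr \<alpha> * (1 - powr_step \<alpha> n)"
    unfolding tele[symmetric] using rem_integral_diff_bound[OF assms(1-6)]
    by (intro order_trans[OF sum_abs sum_mono]) auto
  moreover have "\<bar>rem_integral \<alpha> h \<phi> \<phi>' (Suc n) n\<bar> \<le> L * h powr \<gamma> * h powr \<alpha>"
    using rem_integral_bound[OF assms(1,3-6), of n] by (simp add: mult.assoc)
  ultimately have "\<bar>T2\<bar> \<le> L * h powr \<gamma> * h powr \<alpha> * ((1 - powr_step \<alpha> n) + 1)"
    unfolding T2_split distrib_left mult_1_right by linarith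
  also have "\<dots> \<le> L * h powr \<gamma> * h powr \<alpha> * 2"
    using L powr_step_pos[OF assms(1), of n] by (intro mult_left_mono) auto
  finally have T2: "\<bar>T2\<bar> \<le> 2 * L * h powr (\<gamma> + \<alpha>)" by (simp add: powr_add)
  have "scaled_tau \<alpha> n \<le> 1" using scaled_tau by simp
  then have "\<bar>h powr \<alpha> * scaled_tau \<alpha> n * r\<bar> \<le> h powr \<alpha> * 1 * (L * h powr \<gamma>)"
    unfolding abs_mult r_def using first_midgrid_remainder[OF assms(3-5,7)] scaled_tau_nonneg[OF assms(1,2)]
    by (intro mult_mono) auto
  then have T3: "\<bar>h powr \<alpha> * scaled_tau \<alpha> n * r\<bar> \<le> L * h powr (\<gamma> + \<alpha>)" by (simp add: powr_add mult_ac)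
  have "Gamma (\<alpha> + 1) * (quad_residual \<alpha> h (Suc n) \<phi> - quad_residual \<alpha> h n \<phi>)
      = h powr (\<alpha> + 1) * T1 + T2 - h powr \<alpha> * scaled_tau \<alpha> n * r"
    unfolding right_diff_distrib
      quad_residual_eq[OF assms(1,5,6) taylor_holder_cont[OF assms(3)], of \<phi>']
      quad_residual_eq[OF assms(1,5) nh taylor_holder_cont[OF assms(3)], of \<phi>']
      r_def[symmetric]
    unfolding T1_def T2_def d_def by (simp add: algebra_simps)
  then show ?thesis using T1 T2 T3 by linarith
qed

section \<open>Kernel and solution\<close>

lemma powr_le_powr_mult_bound:
  fixes t a p q :: real
  assumes "0 \<le> t" "t \<le> a" "q \<le> p"
  shows "t powr p \<le> a powr (p - q) * t powr q"
proof -
  have "t powr p = t powr (p - q) * t powr q" by (simp flip: powr_add)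
  also have "\<dots> \<le> a powr (p - q) * t powr q"
    using assms by (intro mult_right_mono powr_mono2) auto
  finally show ?thesis .
qed

text \<open>The increment is a bounded slope times the distance plus the remainder; on a bounded
  interval both are dominated by the power \<open>\<gamma> - 1\<close>, the exponent in which slopes
  of products are measured.\<close>

lemma taylor_holder_lipschitz:
  assumes "taylor_holder \<gamma> a L \<phi> \<phi>'" "\<gamma> \<le> 2" "x \<in> {0..a}" "y \<in> {0..a}"
  shows "\<bar>\<phi> x - \<phi> y\<bar> \<le> L * (a powr (2 - \<gamma>) + a) * \<bar>x - y\<bar> powr (\<gamma> - 1)"
proof -
  let ?t = "\<bar>x - y\<bar>"
  have a: "0 \<le> a" and t: "0 \<le> ?t" "?t \<le> a" using assms by auto
  have L: "0 \<le> L" using taylor_holder_nonneg[OF assms(1) a] .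
  have "\<bar>\<phi>' x * (y - x)\<bar> \<le> L * ?t"
    unfolding abs_mult using taylor_holderD(2)[OF assms(1,3)] by (intro mult_mono) (auto simp: L)
  then have "\<bar>\<phi> x - \<phi> y\<bar> \<le> L * ?t + L * ?t powr \<gamma>"
    using taylor_holderD(4)[OF assms(1,3,4)] by linarith
  also have "\<dots> \<le> L * (a powr (2 - \<gamma>) * ?t powr (\<gamma> - 1)) + L * (a * ?t powr (\<gamma> - 1))"
  proof (intro add_mono mult_left_mono)
    show "?t \<le> a powr (2 - \<gamma>) * ?t powr (\<gamma> - 1)"
      using powr_le_powr_mult_bound[of ?t a "\<gamma> - 1" 1] t assms(2) by simp
    show "?t powr \<gamma> \<le> a * ?t powr (\<gamma> - 1)"
      using powr_le_powr_mult_bound[of ?t a "\<gamma> - 1" \<gamma>] t a by simp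
  qed (use L in auto)
  finally show ?thesis by (simp add: algebra_simps)
qed

lemma taylor_holder_weaken:
  assumes "taylor_holder \<gamma>' a L \<phi> \<phi>'" "\<gamma> \<le> \<gamma>'" "0 \<le> a"
  shows "taylor_holder \<gamma> a (L * (1 + a powr (\<gamma>' - \<gamma>))) \<phi> \<phi>'"
proof -
  have L: "0 \<le> L" using taylor_holder_nonneg[OF assms(1,3)] .
  have le: "L \<le> L * (1 + a powr (\<gamma>' - \<gamma>))"
    using L by (simp add: mult_le_cancel_left1)
  have p: "L * \<bar>x - y\<bar> powr p' \<le> L * (1 + a powr (\<gamma>' - \<gamma>)) * \<bar>x - y\<bar> powr p"
    if "x \<in> {0..a}" "y \<in> {0..a}" "p' - p = \<gamma>' - \<gamma>" for x y p p'
  proof -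
    have "\<bar>x - y\<bar> powr p' \<le> a powr (p' - p) * \<bar>x - y\<bar> powr p"
      using that assms(2) by (intro powr_le_powr_mult_bound) auto
    also have "\<dots> \<le> (1 + a powr (\<gamma>' - \<gamma>)) * \<bar>x - y\<bar> powr p"
      unfolding that(3) by (intro mult_right_mono) auto
    finally show ?thesis unfolding mult.assoc by (intro mult_left_mono L)
  qed
  show ?thesis
    unfolding taylor_holder_def
  proof (intro conjI ballI)
    fix x assume x: "x \<in> {0..a}"
    show "\<bar>\<phi> x\<bar> \<le> L * (1 + a powr (\<gamma>' - \<gamma>))" "\<bar>\<phi>' x\<bar> \<le> L * (1 + a powr (\<gamma>' - \<gamma>))"
      using taylor_holderD(1,2)[OF assms(1) x] le by auto
    fix y assume y: "y \<in> {0..a}"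
    show "\<bar>\<phi>' x - \<phi>' y\<bar> \<le> L * (1 + a powr (\<gamma>' - \<gamma>)) * \<bar>x - y\<bar> powr (\<gamma> - 1)"
      using taylor_holderD(3)[OF assms(1) x y] p[OF x y, of "\<gamma>' - 1" "\<gamma> - 1"] by simp
    show "\<bar>\<phi> y - \<phi> x - \<phi>' x * (y - x)\<bar> \<le> L * (1 + a powr (\<gamma>' - \<gamma>)) * \<bar>x - y\<bar> powr \<gamma>"
      using taylor_holderD(4)[OF assms(1) x y] p[OF x y, of "\<gamma>'" \<gamma>] by simp
  qed (rule taylor_holder_cont[OF assms(1)])
qed

text \<open>The slope is given by the product rule. The constant is a multiple of
  \<open>K * L\<close>, so if one factor has a constant proportional to a distance, so does the
  product.\<close>

lemma taylor_holder_mult: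
  assumes \<phi>: "taylor_holder \<gamma> a K \<phi> \<phi>'" and \<psi>: "taylor_holder \<gamma> a L \<psi> \<psi>'" and "\<gamma> \<le> 2" "0 \<le> a"
  shows "taylor_holder \<gamma> a ((2 + 2 * (a powr (2 - \<gamma>) + a)) * (K * L))
    (\<lambda>x. \<phi> x * \<psi> x) (\<lambda>x. \<phi>' x * \<psi> x + \<phi> x * \<psi>' x)"
proof -
  define A where "A = a powr (2 - \<gamma>) + a"
  have A: "0 \<le> A" using assms by (simp add: A_def)
  have K: "0 \<le> K" and L: "0 \<le> L" using taylor_holder_nonneg \<phi> \<psi> assms(4) by blast+
  have KL: "0 \<le> K * L" using K L by simp
  show ?thesis
    unfolding taylor_holder_def A_def[symmetric]
  proof (intro conjI ballI)
    show "continuous_on {0..a} (\<lambda>x. \<phi> x * \<psi> x)"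
      by (intro continuous_on_mult taylor_holder_cont[OF \<phi>] taylor_holder_cont[OF \<psi>])
    fix x assume x: "x \<in> {0..a}"
    note bx = taylor_holderD(1,2)[OF \<phi> x] taylor_holderD(1,2)[OF \<psi> x]
    have "\<bar>\<phi> x * \<psi> x\<bar> \<le> K * L"
      unfolding abs_mult using bx K L by (intro mult_mono) auto
    also have "\<dots> \<le> (2 + 2 * A) * (K * L)" using KL A by (simp add: mult_le_cancel_right1)
    finally show "\<bar>\<phi> x * \<psi> x\<bar> \<le> (2 + 2 * A) * (K * L)" .
    have "\<bar>\<phi>' x * \<psi> x + \<phi> x * \<psi>' x\<bar> \<le> K * L + K * L"
      using bx K L by (intro order_trans[OF abs_triangle_ineq] add_mono) (auto simp: abs_mult intro!: mult_mono)
    also have "\<dots> \<le> (2 + 2 * A) * (K * L)" using KL A by (simp add: distrib_right)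
    finally show "\<bar>\<phi>' x * \<psi> x + \<phi> x * \<psi>' x\<bar> \<le> (2 + 2 * A) * (K * L)" .
    fix y assume y: "y \<in> {0..a}"
    note bdy = taylor_holderD(1,2)[OF \<phi> y] taylor_holderD(1,2)[OF \<psi> y]
    let ?s = "\<bar>x - y\<bar> powr (\<gamma> - 1)" and ?t = "\<bar>x - y\<bar> powr \<gamma>"
    have lip\<phi>: "\<bar>\<phi> x - \<phi> y\<bar> \<le> K * A * ?s" and lip\<psi>: "\<bar>\<psi> x - \<psi> y\<bar> \<le> L * A * ?s"
      unfolding A_def using \<phi> \<psi> assms(3) x y by (auto intro!: taylor_holder_lipschitz)
    have "\<bar>\<phi>' x * \<psi> x + \<phi> x * \<psi>' x - (\<phi>' y * \<psi> y + \<phi> y * \<psi>' y)\<bar> =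
        \<bar>(\<phi>' x - \<phi>' y) * \<psi> x + \<phi>' y * (\<psi> x - \<psi> y) + (\<phi> x - \<phi> y) * \<psi>' x + \<phi> y * (\<psi>' x - \<psi>' y)\<bar>"
      by (simp add: algebra_simps)
    also have "\<dots> \<le> \<bar>(\<phi>' x - \<phi>' y) * \<psi> x\<bar> + \<bar>\<phi>' y * (\<psi> x - \<psi> y)\<bar> + \<bar>(\<phi> x - \<phi> y) * \<psi>' x\<bar> + \<bar>\<phi> y * (\<psi>' x - \<psi>' y)\<bar>"
      by linarith
    also have "\<dots> \<le> K * ?s * L + K * (L * A * ?s) + K * A * ?s * L + K * (L * ?s)"
      unfolding abs_mult
      by (intro add_mono mult_mono taylor_holderD(3)[OF \<phi> x y] taylor_holderD(3)[OF \<psi> x y]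
          bx bdy lip\<phi> lip\<psi>) (simp_all add: K L A)
    also have "\<dots> = (2 + 2 * A) * (K * L) * ?s" by (simp add: algebra_simps)
    finally show "\<bar>\<phi>' x * \<psi> x + \<phi> x * \<psi>' x - (\<phi>' y * \<psi> y + \<phi> y * \<psi>' y)\<bar> \<le> (2 + 2 * A) * (K * L) * ?s" .
    \<comment> \<open>The remainder of the product is the two remainders plus a cross term; there
      the power \<open>\<gamma> - 1\<close> from the increment and the factor \<open>y - x\<close>
      combine to the power \<open>\<gamma>\<close>.\<close>
    have "\<bar>\<phi> y * \<psi> y - \<phi> x * \<psi> x - (\<phi>' x * \<psi> x + \<phi> x * \<psi>' x) * (y - x)\<bar> =
        \<bar>\<phi> y * (\<psi> y - \<psi> x - \<psi>' x * (y - x)) - (\<phi> x - \<phi> y) * (\<psi>' x * (y - x))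
          + \<psi> x * (\<phi> y - \<phi> x - \<phi>' x * (y - x))\<bar>"
      by (simp add: algebra_simps)
    also have "\<dots> \<le> \<bar>\<phi> y * (\<psi> y - \<psi> x - \<psi>' x * (y - x))\<bar> + \<bar>(\<phi> x - \<phi> y) * (\<psi>' x * (y - x))\<bar>
          + \<bar>\<psi> x * (\<phi> y - \<phi> x - \<phi>' x * (y - x))\<bar>"
      by linarith
    also have "\<dots> \<le> K * (L * ?t) + K * A * ?s * (L * \<bar>x - y\<bar>) + L * (K * ?t)"
      unfolding abs_mult
      by (intro add_mono mult_mono taylor_holderD(4)[OF \<phi> x y] taylor_holderD(4)[OF \<psi> x y]
          bx bdy lip\<phi>) (simp_all add: K L A abs_minus_commute)
    also have "\<dots> = K * (L * ?t) + K * A * L * (\<bar>x - y\<bar> * ?s) + L * (K * ?t)"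
      by (simp add: mult_ac)
    also have "\<bar>x - y\<bar> * ?s = ?t" using powr_mult_base[of "\<bar>x - y\<bar>" "\<gamma> - 1"] by simp
    also have "K * (L * ?t) + K * A * L * ?t + L * (K * ?t) = (2 + A) * (K * L) * ?t" by (simp add: algebra_simps)
    also have "\<dots> \<le> (2 + 2 * A) * (K * L) * ?t"
      using A KL by (intro mult_right_mono) auto
    finally show "\<bar>\<phi> y * \<psi> y - \<phi> x * \<psi> x - (\<phi>' x * \<psi> x + \<phi> x * \<psi>' x) * (y - x)\<bar> \<le> (2 + 2 * A) * (K * L) * ?t" .
  qed
qed

text \<open>The mean value theorem turns the remainder into
  \<open>(\<phi>' z - \<phi>' x) * (y - x)\<close> with \<open>z\<close> between the points. As
  \<open>\<gamma> > 1\<close>, the Holder bound at distance \<open>\<bar>x - z\<bar>\<close> is at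
  most the one at \<open>\<bar>x - y\<bar>\<close>.\<close>

lemma taylor_holder_of_deriv:
  assumes "1 < \<gamma>" and deriv: "\<And>x. x \<in> {0..a} \<Longrightarrow> (\<phi> has_real_derivative \<phi>' x) (at x within {0..a})"
    and "\<And>x. x \<in> {0..a} \<Longrightarrow> \<bar>\<phi> x\<bar> \<le> L" "\<And>x. x \<in> {0..a} \<Longrightarrow> \<bar>\<phi>' x\<bar> \<le> L"
    and holder: "\<And>x y. x \<in> {0..a} \<Longrightarrow> y \<in> {0..a} \<Longrightarrow> \<bar>\<phi>' x - \<phi>' y\<bar> \<le> L * \<bar>x - y\<bar> powr (\<gamma> - 1)"
  shows "taylor_holder \<gamma> a L \<phi> \<phi>'"
proof -
  have mvt: "\<exists>z\<in>{0..a}. \<bar>x - z\<bar> \<le> \<bar>x - y\<bar> \<and> \<phi> y - \<phi> x = \<phi>' z * (y - x)"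
    if xy: "x \<in> {0..a}" "y \<in> {0..a}" for x y
  proof -
    have *: "\<exists>z\<in>{p<..<q}. \<phi> q - \<phi> p = \<phi>' z * (q - p)" if "p < q" "p \<in> {0..a}" "q \<in> {0..a}" for p q
    proof (rule mvt_simple[OF that(1), of \<phi> "\<lambda>z. (*) (\<phi>' z)"])
      fix z assume "p \<le> z" "z \<le> q"
      then show "(\<phi> has_derivative (*) (\<phi>' z)) (at z within {p..q})"
        using deriv[of z] that unfolding has_field_derivative_def
        by (auto intro: has_derivative_subset)
    qed
    consider "x < y" | "x = y" | "y < x" by linarith
    then show ?thesis
    proof cases
      case 1
      then show ?thesis using *[of x y] xy by force
    next
      case 3
      then obtain z where "z \<in> {y<..<x}" "\<phi> x - \<phi> y = \<phi>' z * (x - y)" using *[OF 3 xy(2,1)] by blast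
      then show ?thesis using xy by (intro bexI[of _ z]) (auto simp: algebra_simps)
    qed (use xy in auto)
  qed
  show ?thesis
    unfolding taylor_holder_def
  proof (intro conjI ballI)
    show "continuous_on {0..a} \<phi>"
      using deriv DERIV_continuous_on by blast
    fix x y assume xy: "x \<in> {0..a}" "y \<in> {0..a}"
    obtain z where z: "z \<in> {0..a}" "\<bar>x - z\<bar> \<le> \<bar>x - y\<bar>" "\<phi> y - \<phi> x = \<phi>' z * (y - x)"
      using mvt[OF xy] by blast
    have L: "0 \<le> L" using assms(3)[OF xy(1)] by linarith
    have "\<bar>\<phi> y - \<phi> x - \<phi>' x * (y - x)\<bar> = \<bar>\<phi>' x - \<phi>' z\<bar> * \<bar>x - y\<bar>"
      unfolding z(3) by (simp add: abs_mult[symmetric] algebra_simps abs_minus_commute)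
    also have "\<dots> \<le> L * \<bar>x - y\<bar> powr (\<gamma> - 1) * \<bar>x - y\<bar>"
    proof (rule mult_right_mono)
      have "\<bar>\<phi>' x - \<phi>' z\<bar> \<le> L * \<bar>x - z\<bar> powr (\<gamma> - 1)" using holder xy z by blast
      also have "\<dots> \<le> L * \<bar>x - y\<bar> powr (\<gamma> - 1)"
        using z(2) assms(1) L by (intro mult_left_mono powr_mono2) auto
      finally show "\<bar>\<phi>' x - \<phi>' z\<bar> \<le> L * \<bar>x - y\<bar> powr (\<gamma> - 1)" .
    qed simp
    also have "\<dots> = L * \<bar>x - y\<bar> powr \<gamma>"
      using powr_mult_base[of "\<bar>x - y\<bar>" "\<gamma> - 1"] by (simp add: mult_ac)
    finally show "\<bar>\<phi> y - \<phi> x - \<phi>' x * (y - x)\<bar> \<le> L * \<bar>x - y\<bar> powr \<gamma>" .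
  qed (use assms in auto)
qed

section \<open>The solution, the kernel and their product\<close>

lemma continuous_abs_bounded:
  fixes f :: "real \<Rightarrow> real"
  assumes "continuous_on {a..b} f"
  obtains B where "0 \<le> B" "\<And>x. x \<in> {a..b} \<Longrightarrow> \<bar>f x\<bar> \<le> B"
proof -
  have "bounded (f ` {a..b})"
    using assms by (intro compact_imp_bounded compact_continuous_image) auto
  then obtain B where "\<forall>y\<in>f ` {a..b}. norm y \<le> B"
    unfolding bounded_iff by blast
  then show ?thesis by (intro that[of "max 0 B"]) (auto intro: max.coboundedI2)
qed

text \<open>From \<open>\<gamma> \<le> 2\<close> and \<open>\<beta> > 0\<close> the number of
  derivatives is \<open>0\<close> or \<open>1\<close>. In the first case the slope is taken to be
  \<open>0\<close> and the Holder condition is the remainder bound; in the second the slope is the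
  derivative.\<close>

lemma F_space_imp_taylor_holder:
  assumes "u \<in> F_space \<gamma> 0 a" "\<gamma> \<le> 2"
  obtains L u' where "taylor_holder \<gamma> a L u u'"
proof -
  obtain m \<beta> D C where \<gamma>: "\<gamma> = real m + \<beta>" "0 < \<beta>" "\<beta> \<le> 1" and D: "C_derivs m 0 a u D"
    and C: "0 \<le> C" "\<And>x y. x \<in> {0..a} \<Longrightarrow> y \<in> {0..a} \<Longrightarrow> \<bar>D m x - D m y\<bar> \<le> C * \<bar>x - y\<bar> powr \<beta>"
    using assms(1) unfolding F_space_def by blast
  have cont: "continuous_on {0..a} (D m)" and D0: "\<And>x. x \<in> {0..a} \<Longrightarrow> D 0 x = u x"
    using D by (auto simp: C_derivs_def)
  obtain B where B: "0 \<le> B" "\<And>x. x \<in> {0..a} \<Longrightarrow> \<bar>D m x\<bar> \<le> B"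
    using continuous_abs_bounded[OF cont] by blast
  have "real m < 2" using \<gamma> assms(2) by linarith
  then consider "m = 0" | "m = 1" by linarith
  then show ?thesis
  proof cases
    case 1
    have "taylor_holder \<gamma> a (B + C) u (\<lambda>_. 0)"
      unfolding taylor_holder_def
    proof (intro conjI ballI)
      show "continuous_on {0..a} u"
        using cont D0 1 by (auto intro: continuous_on_eq)
      fix x y assume xy: "x \<in> {0..a}" "y \<in> {0..a}"
      have "\<bar>u y - u x\<bar> \<le> C * \<bar>x - y\<bar> powr \<gamma>"
        using C(2)[OF xy] D0 xy 1 \<gamma> by (simp add: abs_minus_commute)
      also have "\<dots> \<le> (B + C) * \<bar>x - y\<bar> powr \<gamma>" using B by (intro mult_right_mono) auto
      finally show "\<bar>u y - u x - 0 * (y - x)\<bar> \<le> (B + C) * \<bar>x - y\<bar> powr \<gamma>" by simp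
    next
      fix x assume "x \<in> {0..a}"
      then show "\<bar>u x\<bar> \<le> B + C" using B(2)[of x] D0[of x] C(1) 1 by simp
    qed (use B C in auto)
    then show ?thesis by (rule that)
  next
    case 2
    have der: "(u has_real_derivative D 1 x) (at x within {0..a})" if "x \<in> {0..a}" for x
    proof -
      have "(D 0 has_real_derivative D 1 x) (at x within {0..a})"
        using D 2 that by (simp add: C_derivs_def)
      then show ?thesis
        by (rule has_field_derivative_transform_within[OF _ zero_less_one that]) (simp add: D0)
    qed
    have "continuous_on {0..a} u" using der DERIV_continuous_on by blast
    then obtain B' where B': "0 \<le> B'" "\<And>x. x \<in> {0..a} \<Longrightarrow> \<bar>u x\<bar> \<le> B'"
      using continuous_abs_bounded by blast
    have "taylor_holder \<gamma> a (B + B' + C) u (D 1)"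
    proof (rule taylor_holder_of_deriv[OF _ der])
      fix x y assume "x \<in> {0..a}" "y \<in> {0..a}"
      then have "\<bar>D 1 x - D 1 y\<bar> \<le> C * \<bar>x - y\<bar> powr (\<gamma> - 1)" using C(2)[of x y] 2 \<gamma> by simp
      also have "\<dots> \<le> (B + B' + C) * \<bar>x - y\<bar> powr (\<gamma> - 1)" using B B' by (intro mult_right_mono) auto
      finally show "\<bar>D 1 x - D 1 y\<bar> \<le> (B + B' + C) * \<bar>x - y\<bar> powr (\<gamma> - 1)" .
    next
      fix x assume x: "x \<in> {0..a}"
      show "\<bar>u x\<bar> \<le> B + B' + C" using B'(2)[OF x] B C by linarith
      show "\<bar>D 1 x\<bar> \<le> B + B' + C" using B(2)[OF x] B' C 2 by simp
    qed (use \<gamma> 2 in auto)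
    then show ?thesis by (rule that)
  qed
qed

text \<open>The third claim asks for a constant proportional to \<open>\<bar>x - x'\<bar>\<close>.
  For the slopes this is a mixed second difference of \<open>ky\<close>, controlled by the Lipschitz
  constant of the mixed partial derivative \<open>kyx\<close>.\<close>

lemma lipschitz_partials_kernel:
  assumes "lipschitz_partials 2 {0..a} k" "0 \<le> a"
  obtains L ky where "0 \<le> L"
    "\<And>x. x \<in> {0..a} \<Longrightarrow> taylor_holder 2 a L (k x) (ky x)"
    "\<And>x x'. x \<in> {0..a} \<Longrightarrow> x' \<in> {0..a} \<Longrightarrow>
      taylor_holder 2 a (L * \<bar>x - x'\<bar>) (\<lambda>y. k x y - k x' y) (\<lambda>y. ky x y - ky x' y)"
proof -
  have "lipschitz_partials (Suc (Suc 0)) {0..a} k" using assms(1) by (simp add: numeral_2_eq_2)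
  then obtain L0 ky where L0: "L0-lipschitz_on ({0..a} \<times> {0..a}) (\<lambda>(x, y). k x y)"
    and ky': "\<forall>x\<in>{0..a}. \<forall>y\<in>{0..a}. ((\<lambda>t. k x t) has_real_derivative ky x y) (at y within {0..a})"
    and "lipschitz_partials (Suc 0) {0..a} ky"
    unfolding lipschitz_partials.simps(2)[of "Suc 0"] by (elim conjE exE)
  from this(3) obtain L1 kyx where L1: "L1-lipschitz_on ({0..a} \<times> {0..a}) (\<lambda>(x, y). ky x y)"
    and kyx': "\<forall>x\<in>{0..a}. \<forall>y\<in>{0..a}. ((\<lambda>s. ky s y) has_real_derivative kyx x y) (at x within {0..a})"
    and "lipschitz_partials 0 {0..a} kyx"
    unfolding lipschitz_partials.simps(2)[of 0] by (elim conjE exE)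
  from this(3) obtain L2 where L2: "L2-lipschitz_on ({0..a} \<times> {0..a}) (\<lambda>(x, y). kyx x y)"
    by auto
  note ky = bspec[OF bspec[OF ky']] and kyx = bspec[OF bspec[OF kyx']]
  have bounded: "\<exists>B\<ge>0. \<forall>x\<in>{0..a}. \<forall>y\<in>{0..a}. \<bar>g x y\<bar> \<le> B"
    if "C-lipschitz_on ({0..a} \<times> {0..a}) (\<lambda>(x, y). g x y)" for C and g :: "real \<Rightarrow> real \<Rightarrow> real"
  proof -
    have "bounded ((\<lambda>(x, y). g x y) ` ({0..a} \<times> {0..a}))"
      using lipschitz_on_continuous_on[OF that]
      by (intro compact_imp_bounded compact_continuous_image compact_Times) auto
    then obtain B where "\<forall>z\<in>(\<lambda>(x, y). g x y) ` ({0..a} \<times> {0..a}). norm z \<le> B"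
      unfolding bounded_iff by blast
    then show ?thesis by (intro exI[of _ "max 0 B"]) (auto intro: max.coboundedI2)
  qed
  have lip1: "\<bar>g x y - g x' y\<bar> \<le> C * \<bar>x - x'\<bar>" and lip2: "\<bar>g x y - g x y'\<bar> \<le> C * \<bar>y - y'\<bar>"
    if "C-lipschitz_on ({0..a} \<times> {0..a}) (\<lambda>(x, y). g x y)"
      "x \<in> {0..a}" "x' \<in> {0..a}" "y \<in> {0..a}" "y' \<in> {0..a}"
    for C and g :: "real \<Rightarrow> real \<Rightarrow> real" and x x' y y'
    using lipschitz_onD[OF that(1), of "(x, y)" "(x', y)"] lipschitz_onD[OF that(1), of "(x, y)" "(x, y')"] that
    by (auto simp: dist_Pair_Pair dist_real_def)
  obtain B0 where B0: "0 \<le> B0" "\<And>x y. x \<in> {0..a} \<Longrightarrow> y \<in> {0..a} \<Longrightarrow> \<bar>k x y\<bar> \<le> B0"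
    using bounded[OF L0] by blast
  obtain B1 where B1: "0 \<le> B1" "\<And>x y. x \<in> {0..a} \<Longrightarrow> y \<in> {0..a} \<Longrightarrow> \<bar>ky x y\<bar> \<le> B1"
    using bounded[OF L1] by blast
  define L where "L = B0 + B1 + L0 + L1 + L2"
  have pos: "0 \<le> L0" "0 \<le> L1" "0 \<le> L2" using L0 L1 L2 lipschitz_on_nonneg by blast+
  have le: "L0 \<le> L" "L1 \<le> L" "L2 \<le> L" "B0 \<le> L" "B1 \<le> L" "0 \<le> L" using pos B0 B1 by (auto simp: L_def)
  have mixed: "\<bar>(ky x y - ky x' y) - (ky x z - ky x' z)\<bar> \<le> L2 * \<bar>y - z\<bar> * \<bar>x - x'\<bar>"
    if x: "x \<in> {0..a}" "x' \<in> {0..a}" and yz: "y \<in> {0..a}" "z \<in> {0..a}" for x x' y z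
  proof -
    \<comment> \<open>The mean value inequality is applied in the first variable to a difference in
      the second, whose derivative is small by the Lipschitz bound for \<open>kyx\<close>.\<close>
    have "norm ((\<lambda>s. ky s y - ky s z) x - (\<lambda>s. ky s y - ky s z) x') \<le> L2 * \<bar>y - z\<bar> * norm (x - x')"
    proof (rule field_differentiable_bound[where S = "{0..a}"])
      fix s assume s: "s \<in> {0..a}"
      show "((\<lambda>s. ky s y - ky s z) has_field_derivative kyx s y - kyx s z) (at s within {0..a})"
        using kyx[OF s yz(1)] kyx[OF s yz(2)] by (intro DERIV_diff)
      show "norm (kyx s y - kyx s z) \<le> L2 * \<bar>y - z\<bar>"
        using lip2[OF L2 s s yz] by simp
    qed (use x in auto)
    then show ?thesis by (simp add: algebra_simps)
  qed
  show ?thesis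
  proof (rule that[OF le(6)])
    fix x assume x: "x \<in> {0..a}"
    show "taylor_holder 2 a L (k x) (ky x)"
    proof (rule taylor_holder_of_deriv)
      fix y z assume yz: "y \<in> {0..a}" "z \<in> {0..a}"
      have "\<bar>ky x y - ky x z\<bar> \<le> L1 * \<bar>y - z\<bar>" using lip2[OF L1 x x yz] .
      also have "\<dots> \<le> L * \<bar>y - z\<bar>" using le by (intro mult_right_mono) auto
      finally show "\<bar>ky x y - ky x z\<bar> \<le> L * \<bar>y - z\<bar> powr (2 - 1)" by simp
    next
      fix y assume y: "y \<in> {0..a}"
      show "\<bar>k x y\<bar> \<le> L" "\<bar>ky x y\<bar> \<le> L" using B0(2)[OF x y] B1(2)[OF x y] le by linarith+
    qed (use ky x in auto)
    fix x' assume x': "x' \<in> {0..a}"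
    show "taylor_holder 2 a (L * \<bar>x - x'\<bar>) (\<lambda>y. k x y - k x' y) (\<lambda>y. ky x y - ky x' y)"
    proof (rule taylor_holder_of_deriv)
      fix y z assume yz: "y \<in> {0..a}" "z \<in> {0..a}"
      have "\<bar>(ky x y - ky x' y) - (ky x z - ky x' z)\<bar> \<le> L2 * (\<bar>x - x'\<bar> * \<bar>y - z\<bar>)"
        using mixed[OF x x' yz] by (simp add: mult_ac)
      also have "\<dots> \<le> L * (\<bar>x - x'\<bar> * \<bar>y - z\<bar>)" using le by (intro mult_right_mono) auto
      finally show "\<bar>(ky x y - ky x' y) - (ky x z - ky x' z)\<bar> \<le> L * \<bar>x - x'\<bar> * \<bar>y - z\<bar> powr (2 - 1)"
        by simp
    next
      fix y assume y: "y \<in> {0..a}"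
      have "\<bar>k x y - k x' y\<bar> \<le> L0 * \<bar>x - x'\<bar>" "\<bar>ky x y - ky x' y\<bar> \<le> L1 * \<bar>x - x'\<bar>"
        using lip1[OF L0 x x' y y] lip1[OF L1 x x' y y] .
      moreover have "L0 * \<bar>x - x'\<bar> \<le> L * \<bar>x - x'\<bar>" "L1 * \<bar>x - x'\<bar> \<le> L * \<bar>x - x'\<bar>"
        using le by (auto intro: mult_right_mono)
      ultimately show "\<bar>k x y - k x' y\<bar> \<le> L * \<bar>x - x'\<bar>" "\<bar>ky x y - ky x' y\<bar> \<le> L * \<bar>x - x'\<bar>"
        by linarith+
      show "((\<lambda>y. k x y - k x' y) has_real_derivative ky x y - ky x' y) (at y within {0..a})"
        using ky x x' y by (intro DERIV_diff)
    qed simp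
  qed
qed

text \<open>Kernel sections have order \<open>2\<close> and are weakened to order
  \<open>\<gamma>\<close>, at the cost of the factor \<open>w\<close>, before being multiplied by
  the solution. The bound with \<open>\<bar>x - x'\<bar>\<close> lets the integrand vary with the
  row of the scheme.\<close>

lemma kernel_times_solution_taylor_holder:
  assumes "lipschitz_partials 2 {0..a} k" "u \<in> F_space \<gamma> 0 a" "\<gamma> \<le> 2" "0 \<le> a"
  obtains L \<psi> where "0 \<le> L"
    "\<And>x. x \<in> {0..a} \<Longrightarrow> taylor_holder \<gamma> a L (\<lambda>y. k x y * u y) (\<psi> x)"
    "\<And>x x'. x \<in> {0..a} \<Longrightarrow> x' \<in> {0..a} \<Longrightarrow>
      \<exists>\<chi>. taylor_holder \<gamma> a (L * \<bar>x - x'\<bar>) (\<lambda>y. k x y * u y - k x' y * u y) \<chi>"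
    "\<And>x x' y. x \<in> {0..a} \<Longrightarrow> x' \<in> {0..a} \<Longrightarrow> y \<in> {0..a} \<Longrightarrow> \<bar>k x y - k x' y\<bar> \<le> L * \<bar>x - x'\<bar>"
proof -
  obtain K ky where K: "0 \<le> K"
    "\<And>x. x \<in> {0..a} \<Longrightarrow> taylor_holder 2 a K (k x) (ky x)"
    "\<And>x x'. x \<in> {0..a} \<Longrightarrow> x' \<in> {0..a} \<Longrightarrow>
      taylor_holder 2 a (K * \<bar>x - x'\<bar>) (\<lambda>y. k x y - k x' y) (\<lambda>y. ky x y - ky x' y)"
    using lipschitz_partials_kernel[OF assms(1,4)] by blast
  obtain U u' where U: "taylor_holder \<gamma> a U u u'"
    using F_space_imp_taylor_holder[OF assms(2,3)] by blast
  have U0: "0 \<le> U" using taylor_holder_nonneg[OF U assms(4)] .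
  define w where "w = 1 + a powr (2 - \<gamma>)"
  have w: "1 \<le> w" by (simp add: w_def)
  define C where "C = 2 + 2 * (a powr (2 - \<gamma>) + a)"
  have C: "0 \<le> C" using assms(4) by (simp add: C_def)
  define L where "L = C * (K * w * U) + K"
  have L: "0 \<le> C * (K * w * U)" "C * (K * w * U) \<le> L" "K \<le> L" "0 \<le> L"
    using C K(1) w U0 by (auto simp: L_def)
  have mono: "taylor_holder \<gamma> a M' \<phi> \<phi>'" if "taylor_holder \<gamma> a M \<phi> \<phi>'" "M \<le> M'" for M M' \<phi> \<phi>'
    using that unfolding taylor_holder_def
    by (meson mult_right_mono order_trans powr_ge_zero)
  note weak = taylor_holder_weaken[where \<gamma> = \<gamma>, OF _ assms(3,4)]
  show ?thesis
  proof (rule that[OF L(4)])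
    fix x assume x: "x \<in> {0..a}"
    have "taylor_holder \<gamma> a (C * (K * w * U)) (\<lambda>y. k x y * u y) (\<lambda>y. ky x y * u y + k x y * u' y)"
      unfolding C_def w_def by (rule taylor_holder_mult[OF weak[OF K(2)[OF x]] U assms(3,4)])
    then show "taylor_holder \<gamma> a L (\<lambda>y. k x y * u y) ((\<lambda>x y. ky x y * u y + k x y * u' y) x)"
      using L(2) by (rule mono)
    fix x' assume x': "x' \<in> {0..a}"
    have "taylor_holder \<gamma> a (C * (K * \<bar>x - x'\<bar> * w * U)) (\<lambda>y. (k x y - k x' y) * u y)
        (\<lambda>y. (ky x y - ky x' y) * u y + (k x y - k x' y) * u' y)"
      unfolding C_def w_def by (rule taylor_holder_mult[OF weak[OF K(3)[OF x x']] U assms(3,4)])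
    moreover have "C * (K * \<bar>x - x'\<bar> * w * U) = C * (K * w * U) * \<bar>x - x'\<bar>" by simp
    moreover have "\<dots> \<le> L * \<bar>x - x'\<bar>" using L(2) by (intro mult_right_mono) auto
    ultimately show "\<exists>\<chi>. taylor_holder \<gamma> a (L * \<bar>x - x'\<bar>) (\<lambda>y. k x y * u y - k x' y * u y) \<chi>"
      using mono by (metis (no_types, lifting) ext left_diff_distrib)
    fix y assume y: "y \<in> {0..a}"
    have "\<bar>k x y - k x' y\<bar> \<le> K * \<bar>x - x'\<bar>" using taylor_holderD(1)[OF K(3)[OF x x'] y] .
    also have "\<dots> \<le> L * \<bar>x - x'\<bar>" using L(3) by (intro mult_right_mono) auto
    finally show "\<bar>k x y - k x' y\<bar> \<le> L * \<bar>x - x'\<bar>" .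
  qed
qed

section \<open>Convergence rates\<close>

lemma quad_residual_0: "quad_residual \<alpha> h 0 \<phi> = 0"
proof -
  have "corr_wt \<alpha> 0 j = 0" for j by (simp add: corr_wt_def)
  then show ?thesis by (simp add: quad_residual_def grid_def)
qed

lemma quad_residual_diff:
  assumes "0 < \<alpha>" "0 < h" "real n * h \<le> a" "continuous_on {0..a} \<phi>" "continuous_on {0..a} \<psi>"
  shows "quad_residual \<alpha> h n (\<lambda>y. \<phi> y - \<psi> y) = quad_residual \<alpha> h n \<phi> - quad_residual \<alpha> h n \<psi>"
proof -
  have "0 \<le> grid h n" "grid h n \<le> a" using assms by (auto simp: grid_def)
  then have "(\<lambda>y. (grid h n - y) powr (\<alpha> - 1) * \<phi> y) integrable_on {0..grid h n}"
      "(\<lambda>y. (grid h n - y) powr (\<alpha> - 1) * \<psi> y) integrable_on {0..grid h n}"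
    using assms(1,4,5) by (auto intro!: kernel_mult_integrable elim!: continuous_on_subset)
  then have "integral {0..grid h n} (\<lambda>y. (grid h n - y) powr (\<alpha> - 1) * (\<phi> y - \<psi> y))
     = integral {0..grid h n} (\<lambda>y. (grid h n - y) powr (\<alpha> - 1) * \<phi> y)
       - integral {0..grid h n} (\<lambda>y. (grid h n - y) powr (\<alpha> - 1) * \<psi> y)"
    unfolding right_diff_distrib by (rule integral_diff)
  then show ?thesis
    by (simp add: quad_residual_def right_diff_distrib sum_subtractf diff_divide_distrib)
qed

text \<open>The integrand contains \<open>k\<close> at the current grid point, so both the rule and
  the function it is applied to change with \<open>n\<close>.\<close>

definition exact_residual ::
    "real \<Rightarrow> (real \<Rightarrow> real \<Rightarrow> real) \<Rightarrow> (real \<Rightarrow> real) \<Rightarrow> real \<Rightarrow> nat \<Rightarrow> real" where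
  "exact_residual \<alpha> k u h n = quad_residual \<alpha> h n (\<lambda>y. k (grid h n) y * u y)"

lemma modified_scheme_error:
  assumes "modified_scheme \<alpha> k h N g v"
    and "\<And>n. n \<in> {1..N} \<Longrightarrow>
      1 / Gamma \<alpha> * integral {0..grid h n} (\<lambda>y. (grid h n - y) powr (\<alpha> - 1) * k (grid h n) y * u y) = f (grid h n)"
  shows "modified_scheme \<alpha> k h N (\<lambda>n. (g n - f (grid h n)) + exact_residual \<alpha> k u h n)
    (\<lambda>j. v j - u (midgrid h j))"
  unfolding modified_scheme_def
proof
  fix n assume n: "n \<in> {1..N}"
  have "f (grid h n) - exact_residual \<alpha> k u h n =
      h powr \<alpha> * (\<Sum>j=1..n. omega_wt \<alpha> (n - j) * k (grid h n) (midgrid h j) * u (midgrid h j))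
      + h powr \<alpha> * (\<Sum>j=1..2. corr_wt \<alpha> n j * k (grid h n) (midgrid h j) * u (midgrid h j))"
    unfolding assms(2)[OF n, symmetric] exact_residual_def quad_residual_def by (simp add: mult.assoc)
  moreover have "h powr \<alpha> * (\<Sum>j=1..n. omega_wt \<alpha> (n - j) * k (grid h n) (midgrid h j) * v j)
      + h powr \<alpha> * (\<Sum>j=1..2. corr_wt \<alpha> n j * k (grid h n) (midgrid h j) * v j) = g n"
    using assms(1) n unfolding modified_scheme_def by blast
  ultimately show "h powr \<alpha> * (\<Sum>j=1..n. omega_wt \<alpha> (n - j) * k (grid h n) (midgrid h j) * (v j - u (midgrid h j)))
      + h powr \<alpha> * (\<Sum>j=1..2. corr_wt \<alpha> n j * k (grid h n) (midgrid h j) * (v j - u (midgrid h j)))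
      = g n - f (grid h n) + exact_residual \<alpha> k u h n"
    by (simp add: right_diff_distrib sum_subtractf)
qed

text \<open>For the increments, the rule first advances by one row with the integrand frozen, and
  then the integrand changes under the old rule. The second change has Taylor-Holder constant
  \<open>L * h\<close>, so the plain size bound suffices for it.\<close>

lemma exact_residual_bounds:
  assumes "0 < \<alpha>" "\<alpha> < 1" "0 < a" "0 < \<gamma>" "\<gamma> \<le> 2"
    "lipschitz_partials 2 {0..a} k" "u \<in> F_space \<gamma> 0 a"
  obtains C where "0 \<le> C"
    "\<And>N h n. 2 \<le> N \<Longrightarrow> h = a / real N \<Longrightarrow> h \<le> 1 \<Longrightarrow> n \<in> {1..N} \<Longrightarrow> \<gamma> \<le> \<alpha> + 1 \<Longrightarrow>
      \<bar>exact_residual \<alpha> k u h n\<bar> \<le> C * h powr \<gamma>"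
    "\<And>N h n. 2 \<le> N \<Longrightarrow> h = a / real N \<Longrightarrow> h \<le> 1 \<Longrightarrow> n \<in> {1..N} \<Longrightarrow>
      \<bar>exact_residual \<alpha> k u h n - exact_residual \<alpha> k u h (n - 1)\<bar> \<le> C * h powr (\<gamma> + \<alpha>)"
proof -
  obtain L \<psi> where L: "0 \<le> L"
    "\<And>x. x \<in> {0..a} \<Longrightarrow> taylor_holder \<gamma> a L (\<lambda>y. k x y * u y) (\<psi> x)"
    "\<And>x x'. x \<in> {0..a} \<Longrightarrow> x' \<in> {0..a} \<Longrightarrow>
      \<exists>\<chi>. taylor_holder \<gamma> a (L * \<bar>x - x'\<bar>) (\<lambda>y. k x y * u y - k x' y * u y) \<chi>"
    "\<And>x x' y. x \<in> {0..a} \<Longrightarrow> x' \<in> {0..a} \<Longrightarrow> y \<in> {0..a} \<Longrightarrow> \<bar>k x y - k x' y\<bar> \<le> L * \<bar>x - x'\<bar>"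
    by (rule kernel_times_solution_taylor_holder[OF assms(6,7,5) less_imp_le[OF assms(3)]]) (rule that, assumption, blast+)
  define G where "G = Gamma (\<alpha> + 1)"
  have G: "0 < G" using assms unfolding G_def by (intro Gamma_real_pos) auto
  \<comment> \<open>The increments need \<open>4\<close> from the advancing rule and
    \<open>a powr \<alpha> + 3\<close> from the changing integrand; the same constant also covers
    the size bound.\<close>
  define M where "M = a powr \<alpha> + 7"
  have M: "0 \<le> M" by (simp add: M_def)
  have divG: "\<bar>x\<bar> \<le> y / G" if "\<bar>G * x\<bar> \<le> y" for x y
    using that G by (simp add: abs_mult pos_le_divide_eq mult.commute)
  show ?thesis
  proof (rule that[of "L * M / G"])
    show "0 \<le> L * M / G" using L G M by simp
    fix N n :: nat and h :: real
    assume N: "2 \<le> N" and h: "h = a / real N" and h1: "h \<le> 1" and n: "n \<in> {1..N}"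
    have hpos: "0 < h" using h N assms by simp
    have Nh: "real N * h = a" using h N by simp
    have le: "real m * h \<le> a" if "m \<le> N" for m
    proof -
      have "real m * h \<le> real N * h" using that hpos by (intro mult_right_mono) auto
      then show ?thesis using Nh by simp
    qed
    have h2: "2 * h \<le> a" using le[OF N] by simp
    have x_in: "grid h m \<in> {0..a}" if "m \<le> N" for m
      using le[OF that] hpos by (simp add: grid_def)
    note Ln = L(2)[OF x_in]
    show "\<bar>exact_residual \<alpha> k u h n\<bar> \<le> L * M / G * h powr \<gamma>" if "\<gamma> \<le> \<alpha> + 1"
    proof -
      have "\<bar>G * exact_residual \<alpha> k u h n\<bar> \<le> L * (2 * h powr (\<alpha> + 1) + (a powr \<alpha> + 1) * h powr \<gamma>)"
        unfolding G_def exact_residual_def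
        using n by (intro quad_residual_bound[OF assms(1,2) Ln assms(4) hpos h1 le h2]) auto
      also have "\<dots> \<le> L * (2 * h powr \<gamma> + (a powr \<alpha> + 5) * h powr \<gamma>)"
      proof (rule mult_left_mono[OF add_mono L(1)])
        show "2 * h powr (\<alpha> + 1) \<le> 2 * h powr \<gamma>" using powr_mono'[OF that, of h] h1 hpos by simp
        show "(a powr \<alpha> + 1) * h powr \<gamma> \<le> (a powr \<alpha> + 5) * h powr \<gamma>" by (rule mult_right_mono) auto
      qed
      also have "\<dots> = L * M * h powr \<gamma>" by (simp add: M_def algebra_simps)
      finally show ?thesis using divG by fastforce
    qed
    obtain m where m: "n = Suc m" using n by (cases n) auto
    obtain \<chi> where \<chi>: "taylor_holder \<gamma> a (L * \<bar>grid h n - grid h m\<bar>)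
        (\<lambda>y. k (grid h n) y * u y - k (grid h m) y * u y) \<chi>"
      using L(3)[OF x_in x_in, of n m] n m by auto
    have "\<bar>grid h n - grid h m\<bar> = h" using hpos by (simp add: m grid_def algebra_simps)
    note \<chi> = \<chi>[unfolded this]
    define Q where "Q = (\<lambda>i \<phi>. quad_residual \<alpha> h i \<phi>)"
    have split: "exact_residual \<alpha> k u h n - exact_residual \<alpha> k u h (n - 1)
        = (Q (Suc m) (\<lambda>y. k (grid h n) y * u y) - Q m (\<lambda>y. k (grid h n) y * u y))
          + Q m (\<lambda>y. k (grid h n) y * u y - k (grid h m) y * u y)"
      unfolding Q_def using n m
      by (subst quad_residual_diff[OF assms(1) hpos le taylor_holder_cont[OF Ln] taylor_holder_cont[OF Ln]])
         (auto simp: exact_residual_def)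
    have "\<bar>G * (Q (Suc m) (\<lambda>y. k (grid h n) y * u y) - Q m (\<lambda>y. k (grid h n) y * u y))\<bar>
        \<le> 4 * L * h powr (\<gamma> + \<alpha>)"
      unfolding G_def Q_def
      using n m by (intro quad_residual_diff_bound[OF assms(1,2) Ln assms(4) hpos le h2]) auto
    moreover have "\<bar>G * Q m (\<lambda>y. k (grid h n) y * u y - k (grid h m) y * u y)\<bar> \<le> L * (a powr \<alpha> + 3) * h powr (\<gamma> + \<alpha>)"
    proof -
      have "\<bar>G * Q m (\<lambda>y. k (grid h n) y * u y - k (grid h m) y * u y)\<bar>
          \<le> L * h * (2 * h powr (\<alpha> + 1) + (a powr \<alpha> + 1) * h powr \<gamma>)"
        unfolding G_def Q_def
        using n m by (intro quad_residual_bound[OF assms(1,2) \<chi> assms(4) hpos h1 le h2]) auto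
      also have "\<dots> = L * (2 * (h * h powr (\<alpha> + 1)) + (a powr \<alpha> + 1) * (h * h powr \<gamma>))"
        by (simp add: algebra_simps)
      also have "\<dots> = L * (2 * h powr (\<alpha> + 2) + (a powr \<alpha> + 1) * h powr (\<gamma> + 1))"
        using hpos powr_mult_base[of h "\<alpha> + 1"] powr_mult_base[of h \<gamma>]
        by (simp add: add.commute)
      \<comment> \<open>With \<open>h \<le> 1\<close> the first exponent is sufficient because
        \<open>\<gamma> \<le> 2\<close>, the second because \<open>\<alpha> < 1\<close>.\<close>
      also have "\<dots> \<le> L * (2 * h powr (\<gamma> + \<alpha>) + (a powr \<alpha> + 1) * h powr (\<gamma> + \<alpha>))"
      proof (rule mult_left_mono[OF add_mono L(1)])
        show "2 * h powr (\<alpha> + 2) \<le> 2 * h powr (\<gamma> + \<alpha>)"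
          using powr_mono'[of "\<gamma> + \<alpha>" "\<alpha> + 2" h] assms(5) h1 hpos by simp
        show "(a powr \<alpha> + 1) * h powr (\<gamma> + 1) \<le> (a powr \<alpha> + 1) * h powr (\<gamma> + \<alpha>)"
          using powr_mono'[of "\<gamma> + \<alpha>" "\<gamma> + 1" h] assms(2) h1 hpos by (intro mult_left_mono) auto
      qed
      finally show ?thesis by (simp add: algebra_simps)
    qed
    ultimately have "\<bar>G * (exact_residual \<alpha> k u h n - exact_residual \<alpha> k u h (n - 1))\<bar>
        \<le> 4 * L * h powr (\<gamma> + \<alpha>) + L * (a powr \<alpha> + 3) * h powr (\<gamma> + \<alpha>)"
      unfolding split distrib_left[of G] by linarith
    also have "\<dots> = L * M * h powr (\<gamma> + \<alpha>)" by (simp add: M_def algebra_simps)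
    finally show "\<bar>exact_residual \<alpha> k u h n - exact_residual \<alpha> k u h (n - 1)\<bar> \<le> L * M / G * h powr (\<gamma> + \<alpha>)"
      using divG by fastforce
  qed
qed

section \<open>The two error rates\<close>

lemma scheme_error_bigoI:
  assumes "0 < h0" "0 < a"
    and "\<And>N h \<delta> g v n. 2 \<le> N \<Longrightarrow> h = a / real N \<Longrightarrow> 0 < h \<Longrightarrow> h \<le> h0 \<Longrightarrow> 0 < \<delta> \<Longrightarrow>
      (\<And>n. n \<in> {1..N} \<Longrightarrow> \<bar>g n - f (grid h n)\<bar> \<le> \<delta>) \<Longrightarrow> modified_scheme \<alpha> k h N g v \<Longrightarrow> n \<in> {1..N} \<Longrightarrow>
      \<bar>v n - u (midgrid h n)\<bar> \<le> C * R h \<delta>"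
  shows "scheme_error_bigo \<alpha> a k f u R"
  unfolding scheme_error_bigo_def
proof (intro exI conjI allI impI)
  show "0 < h0" by fact
  show "0 < (1::real)" by simp
  fix N :: nat and h \<delta> :: real and g v
  assume *: "2 \<le> N \<and> h = a / real N \<and> h \<le> h0 \<and> 0 < \<delta> \<and> \<delta> \<le> 1 \<and>
    (\<forall>n\<in>{1..N}. \<bar>g n - f (grid h n)\<bar> \<le> \<delta>) \<and> modified_scheme \<alpha> k h N g v"
  then have "0 < h" using assms(2) by simp
  with * have "\<bar>v n - u (midgrid h n)\<bar> \<le> C * R h \<delta>" if "n \<in> {1..N}" for n
    using that by (intro assms(3)[of N]) auto
  then show "Max ((\<lambda>n. \<bar>v n - u (midgrid h n)\<bar>) ` {1..N}) \<le> C * R h \<delta>"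
    using * by (subst Max_le_iff) auto
qed

text \<open>The stability estimate is used in two ways. Counting the residual as data of bounded
  size gives \<open>h powr \<gamma> / h powr \<alpha>\<close>; counting it through its increments
  gives \<open>h powr (\<gamma> + \<alpha>) / h\<close>. The noise is always counted by
  size.\<close>

lemma modified_scheme_rates:
  fixes \<alpha> a \<gamma> :: real
  assumes "0 < \<alpha>" "\<alpha> < 1" "0 < a" "0 < \<gamma>" "\<gamma> \<le> 2"
    and "lipschitz_partials 2 {0..a} k"
    and diag: "\<And>x. x \<in> {0..a} \<Longrightarrow> k x x = 1"
    and "u \<in> F_space \<gamma> 0 a"
    and sol: "\<And>x. x \<in> {0..a} \<Longrightarrow>
           1 / Gamma \<alpha> * integral {0..x} (\<lambda>y. (x - y) powr (\<alpha> - 1) * k x y * u y) = f x"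
  shows "\<gamma> \<le> \<alpha> + 1 \<Longrightarrow> scheme_error_bigo \<alpha> a k f u (\<lambda>h \<delta>. h powr (\<gamma> - \<alpha>) + \<delta> / h powr \<alpha>)"
    and "scheme_error_bigo \<alpha> a k f u (\<lambda>h \<delta>. h powr (\<gamma> - 1 + \<alpha>) + \<delta> / h powr \<alpha>)"
proof -
  obtain L \<psi> where L: "0 \<le> L"
    "\<And>x. x \<in> {0..a} \<Longrightarrow> taylor_holder \<gamma> a L (\<lambda>y. k x y * u y) (\<psi> x)"
    "\<And>x x'. x \<in> {0..a} \<Longrightarrow> x' \<in> {0..a} \<Longrightarrow>
      \<exists>\<chi>. taylor_holder \<gamma> a (L * \<bar>x - x'\<bar>) (\<lambda>y. k x y * u y - k x' y * u y) \<chi>"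
    "\<And>x x' y. x \<in> {0..a} \<Longrightarrow> x' \<in> {0..a} \<Longrightarrow> y \<in> {0..a} \<Longrightarrow> \<bar>k x y - k x' y\<bar> \<le> L * \<bar>x - x'\<bar>"
    by (rule kernel_times_solution_taylor_holder[OF assms(6,8,5) less_imp_le[OF assms(3)]]) (rule that, assumption, blast+)
  obtain C h0 where h0: "0 < h0" and C: "0 \<le> C" and stable: "\<And>N h e \<eta> R E D n. 2 \<le> N \<Longrightarrow> h = a / real N \<Longrightarrow> h \<le> h0 \<Longrightarrow>
      modified_scheme \<alpha> k h N (\<lambda>n. \<eta> n + R n) e \<Longrightarrow>
      (\<And>n. n \<in> {1..N} \<Longrightarrow> \<bar>\<eta> n\<bar> \<le> E) \<Longrightarrow>
      (\<And>n. n \<in> {1..N} \<Longrightarrow> \<bar>R n - R (n - 1)\<bar> \<le> D) \<Longrightarrow> R 0 = 0 \<Longrightarrow> n \<in> {1..N} \<Longrightarrow>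
      \<bar>e n\<bar> \<le> C * (E / h powr \<alpha> + D / h)"
    by (rule modified_scheme_stability[OF assms(1-3) L(1,4) diag]) (assumption+, rule that, assumption+, blast+)
  obtain C' where C': "0 \<le> C'" and
    res: "\<And>N h n. 2 \<le> N \<Longrightarrow> h = a / real N \<Longrightarrow> h \<le> 1 \<Longrightarrow> n \<in> {1..N} \<Longrightarrow> \<gamma> \<le> \<alpha> + 1 \<Longrightarrow>
      \<bar>exact_residual \<alpha> k u h n\<bar> \<le> C' * h powr \<gamma>" and
    res_diff: "\<And>N h n. 2 \<le> N \<Longrightarrow> h = a / real N \<Longrightarrow> h \<le> 1 \<Longrightarrow> n \<in> {1..N} \<Longrightarrow>
      \<bar>exact_residual \<alpha> k u h n - exact_residual \<alpha> k u h (n - 1)\<bar> \<le> C' * h powr (\<gamma> + \<alpha>)"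
    by (rule exact_residual_bounds[OF assms(1-6,8)]) (rule that, assumption, blast+)
  define h1 where "h1 = min h0 1"
  have h1: "0 < h1" using h0 by (simp add: h1_def)
  have final: "C * (C' * p + d) \<le> C * (1 + C') * (p + d)" if "0 \<le> p" "0 \<le> d" for p d
  proof -
    have "C' * p + d \<le> (1 + C') * (p + d)" using that C' by (simp add: algebra_simps)
    then show ?thesis using C by (simp add: mult_left_mono mult.assoc)
  qed
  have err: "modified_scheme \<alpha> k h N (\<lambda>n. (g n - f (grid h n)) + exact_residual \<alpha> k u h n)
      (\<lambda>j. v j - u (midgrid h j))"
    if "2 \<le> N" "h = a / real N" "0 < h" "modified_scheme \<alpha> k h N g v" for N h g v
  proof (rule modified_scheme_error[OF that(4)])
    fix n assume "n \<in> {1..N}"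
    then have "real n * h \<le> real N * h" using that(3) by (intro mult_right_mono) auto
    moreover have "real N * h = a" using that(1,2) by simp
    ultimately have "grid h n \<in> {0..a}" using that(3) by (simp add: grid_def)
    then show "1 / Gamma \<alpha> * integral {0..grid h n} (\<lambda>y. (grid h n - y) powr (\<alpha> - 1) * k (grid h n) y * u y)
        = f (grid h n)"
      by (rule sol)
  qed
  show "scheme_error_bigo \<alpha> a k f u (\<lambda>h \<delta>. h powr (\<gamma> - \<alpha>) + \<delta> / h powr \<alpha>)" if "\<gamma> \<le> \<alpha> + 1"
  proof (rule scheme_error_bigoI[OF h1 assms(3)])
    fix N n :: nat and h \<delta> :: real and g v
    assume N: "2 \<le> N" "h = a / real N" and h: "0 < h" "h \<le> h1" and \<delta>: "0 < \<delta>"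
      and g: "\<And>n. n \<in> {1..N} \<Longrightarrow> \<bar>g n - f (grid h n)\<bar> \<le> \<delta>"
      and sch: "modified_scheme \<alpha> k h N g v" and n: "n \<in> {1..N}"
    have "\<bar>v n - u (midgrid h n)\<bar> \<le> C * ((\<delta> + C' * h powr \<gamma>) / h powr \<alpha> + 0 / h)"
    \<comment> \<open>Everything, noise and residual, goes into the part measured by size.\<close>
    proof (rule stable[OF N _ _ _ _ _ n, where R = "\<lambda>_. 0"])
      show "modified_scheme \<alpha> k h N (\<lambda>n. ((g n - f (grid h n)) + exact_residual \<alpha> k u h n) + 0)
          (\<lambda>j. v j - u (midgrid h j))"
        using err[OF N h(1) sch] by simp
      show "\<bar>(g m - f (grid h m)) + exact_residual \<alpha> k u h m\<bar> \<le> \<delta> + C' * h powr \<gamma>" if "m \<in> {1..N}" for m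
        using g[OF that] res[OF N _ that \<open>\<gamma> \<le> \<alpha> + 1\<close>] h by (simp add: h1_def)
    qed (use h in \<open>auto simp: h1_def\<close>)
    also have "\<dots> = C * (C' * h powr (\<gamma> - \<alpha>) + \<delta> / h powr \<alpha>)"
      using h by (simp add: powr_diff add_divide_distrib add.commute)
    also have "\<dots> \<le> C * (1 + C') * (h powr (\<gamma> - \<alpha>) + \<delta> / h powr \<alpha>)"
      using \<delta> by (intro final) auto
    finally show "\<bar>v n - u (midgrid h n)\<bar> \<le> C * (1 + C') * (h powr (\<gamma> - \<alpha>) + \<delta> / h powr \<alpha>)" .
  qed
  show "scheme_error_bigo \<alpha> a k f u (\<lambda>h \<delta>. h powr (\<gamma> - 1 + \<alpha>) + \<delta> / h powr \<alpha>)"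
  proof (rule scheme_error_bigoI[OF h1 assms(3)])
    fix N n :: nat and h \<delta> :: real and g v
    assume N: "2 \<le> N" "h = a / real N" and h: "0 < h" "h \<le> h1" and \<delta>: "0 < \<delta>"
      and g: "\<And>n. n \<in> {1..N} \<Longrightarrow> \<bar>g n - f (grid h n)\<bar> \<le> \<delta>"
      and sch: "modified_scheme \<alpha> k h N g v" and n: "n \<in> {1..N}"
    have "\<bar>v n - u (midgrid h n)\<bar> \<le> C * (\<delta> / h powr \<alpha> + C' * h powr (\<gamma> + \<alpha>) / h)"
    \<comment> \<open>Only the noise is measured by size here; the residual takes the place of
      \<open>R\<close>, and it vanishes at index \<open>0\<close>.\<close>
    proof (rule stable[OF N _ err[OF N h(1) sch] g _ _ n])
      show "\<bar>exact_residual \<alpha> k u h m - exact_residual \<alpha> k u h (m - 1)\<bar> \<le> C' * h powr (\<gamma> + \<alpha>)"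
        if "m \<in> {1..N}" for m
        using res_diff[OF N _ that] h by (simp add: h1_def)
    qed (use h in \<open>auto simp: h1_def exact_residual_def quad_residual_0\<close>)
    also have "h powr (\<gamma> + \<alpha>) = h powr (\<gamma> - 1 + \<alpha>) * h"
      using h(1) powr_mult_base[of h "\<gamma> - 1 + \<alpha>"] by (simp add: algebra_simps)
    also have "C * (\<delta> / h powr \<alpha> + C' * (h powr (\<gamma> - 1 + \<alpha>) * h) / h)
        = C * (C' * h powr (\<gamma> - 1 + \<alpha>) + \<delta> / h powr \<alpha>)"
      using h(1) by (simp add: add.commute)
    also have "\<dots> \<le> C * (1 + C') * (h powr (\<gamma> - 1 + \<alpha>) + \<delta> / h powr \<alpha>)"
      using \<delta> by (intro final) auto
    finally show "\<bar>v n - u (midgrid h n)\<bar> \<le> C * (1 + C') * (h powr (\<gamma> - 1 + \<alpha>) + \<delta> / h powr \<alpha>)" .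
  qed
qed

theorem theorem4p5:
  fixes \<alpha> a \<gamma> :: real
    and k :: "real \<Rightarrow> real \<Rightarrow> real"
    and f u :: "real \<Rightarrow> real"
  assumes "0 < \<alpha>" and "\<alpha> < 1" and "0 < a"
    and "min \<alpha> (1 - \<alpha>) < \<gamma>" and "\<gamma> \<le> 2"
    and "lipschitz_partials 2 {0..a} k"
    and "\<And>x. x \<in> {0..a} \<Longrightarrow> k x x = 1"
    and "u \<in> F_space \<gamma> 0 a"
    and "\<And>x. x \<in> {0..a} \<Longrightarrow>
           1 / Gamma \<alpha> * integral {0..x} (\<lambda>y. (x - y) powr (\<alpha> - 1) * k x y * u y) = f x"
  shows "(\<alpha> \<le> 1/2 \<longrightarrow>
            (\<alpha> < \<gamma> \<and> \<gamma> \<le> \<alpha> + 1 \<longrightarrow>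
               scheme_error_bigo \<alpha> a k f u (\<lambda>h \<delta>. h powr (\<gamma> - \<alpha>) + \<delta> / h powr \<alpha>)) \<and>
            (2 - \<alpha> < \<gamma> \<and> \<gamma> \<le> 2 \<longrightarrow>
               scheme_error_bigo \<alpha> a k f u (\<lambda>h \<delta>. h powr (\<gamma> - 1 + \<alpha>) + \<delta> / h powr \<alpha>)))
       \<and> (\<alpha> \<ge> 1/2 \<and> 1 - \<alpha> < \<gamma> \<and> \<gamma> \<le> 2 \<longrightarrow>
            scheme_error_bigo \<alpha> a k f u (\<lambda>h \<delta>. h powr (\<gamma> - 1 + \<alpha>) + \<delta> / h powr \<alpha>))"
proof -
  \<comment> \<open>Both \<open>\<alpha>\<close> and \<open>1 - \<alpha>\<close> are positive, hence
    so is their minimum.\<close>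
  have "0 < \<gamma>" using assms(1,2,4) by linarith
  note rates = modified_scheme_rates[OF assms(1-3) this assms(5-9)]
  show ?thesis using rates by blast
qed

end
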